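(* Let $f=\max_{j\in[N]}f_j$ with $f_j(x)=\log\sum_{i=1}^{m_j}f_{ij}\exp(a_{ij}^\top x)$, $x\in\mathbb{R}^n$, where $f_{ij}>0$ and $\mathcal{A}_j=\{a_{1j},\dots,a_{m_jj}\}$ consists of $m_j$ distinct vectors. Let $\mathcal{A}=\bigcup_j\mathcal{A}_j=\{b_1,\dots,b_M\}$, $M=|\mathcal{A}|$, with $\|b_1\|_2\ge\cdots\ge\|b_M\|_2$. Assume that $\mathcal{A}\subset\mathbb{Z}^n$ and $\{x\in\mathbb{R}^n: a^\top x\le0\ \text{for all } a\in\mathcal{A}\}=\{0\}$. Set $$R=(\lceil f(0)\rceil-\lfloor t_{\min}(f)\rfloor)\Big\lceil\sqrt{\textstyle\prod_{k=1}^n(\|b_k\|_2^2+1)}\Big\rceil+1+\lceil\log4\rceil,\quad t_{\max}=\lceil f(0)\rceil+(a(f)+1)R,$$ $$\bar t=\lceil f(0)\rceil+\tfrac{(a(f)+1)R}{2},\qquad R_{\max}=(a(f)+1)R+\lceil f(0)\rceil-\lfloor t_{\min}(f)\rfloor,$$ $$K=\{(x,t)\in\mathbb{R}^n\times\mathbb{R}: f(x)\le t,\ \|x\|_\infty\le R,\ t\le t_{\max}\},$$ $$\hat K=\{(x,t,z_1,\dots,z_N)\in K\times\Delta_{++}^{m_1}\times\cdots\times\Delta_{++}^{m_N}: f_{ij}e^{a_{ij}^\top x}\le z_{ij}e^t,\ i\in[m_j],\ j\in[N]\},$$ and $w=(0,\bar t,z_1(f),\dots,z_N(f))$ with $z_j(f)=\frac{1}{\sum_{i=1}^{m_j}f_{ij}}(f_{1j},\dots,f_{m_jj})^\top$.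 Consider the problem of minimizing $t$ over $(x,t,z_1,\dots,z_N)\in\hat K$, and the barrier $$\beta=-\sum_{j=1}^N\sum_{i=1}^{m_j}\Big(\log z_{ij}+\log(\log z_{ij}-a_{ij}^\top x+t-\log f_{ij})\Big)-\sum_{k=1}^n\log(R^2-x_k^2)-\log(t_{\max}-t).$$ The short-step interior-point algorithm with the barrier $\beta$ starting at the point $w$ finds the value $f_{\min}=\inf_{\mathbb{R}^n}f$ within precision $\varepsilon>0$ in $$O\Big(\sqrt{1+n+2\textstyle\sum_{j=1}^Nm_j}\ \log\frac{2\big(1+n+2\sum_{j=1}^Nm_j\big)R_{\max}}{\varepsilon\mu}\Big)$$ iterations.
   Context: $[N]=\{1,\dots,N\}$; $t_{\min}(f)=\min_{i,j}\log f_{ij}$; $a(f)=\max\{\|a\|_1: a\in\mathcal{A}\}$; $\mu=\min_{j\in[N]}\min_{i\in[m_j]}\frac{f_{ij}}{\sum_{l=1}^{m_j}f_{lj}}$; $\Delta_{++}^m=\{z\in\mathbb{R}^m: z_i>0,\ \sum_iz_i=1\}$; $z_j=(z_{1j},\dots,z_{m_jj})^\top$. The set $\hat K$ is viewed as a full-dimensional subset of the affine space $\Sigma=\mathbb{R}^{n+1}\times\Delta^{m_1}\times\cdots\times\Delta^{m_N}$, with $\Delta^m=\{z\in\mathbb{R}^m:\sum_iz_i=1\}$; derivatives of $\beta$ are taken along $\Sigma$. Short-step interior-point algorithm (due to Renegar, "A Mathematical View of Interior-Point Methods in Convex Optimization"; it is described in full here): for minimizing a linear functional $c^\top y$ over the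 closure of a bounded open convex domain $D$ with a self-concordant barrier $\beta$ of parameter $\theta$, let $g(y),H(y)$ be the gradient and Hessian of $\beta$ and $\|v\|_y=(v^\top H(y)v)^{1/2}$. Path following with linear term $\eta p$ (for a vector $p$): given $y$ close to the minimizer of $\eta p^\top y+\beta(y)$ (Newton step of local norm at most a fixed absolute constant such as $1/9$), multiply $\eta$ by a factor $1\pm\frac{1}{8\sqrt\theta}$ and take one Newton step for the new function; this is one iteration. Starting from an arbitrary $y'\in D$, the algorithm first follows the path with $p=-g(y')$, decreasing $\eta$ from $1$ until the iterate is close (in local norm, up to an absolute constant) to the minimizer of $\beta$; then it follows the central path with $p=c$, increasing $\eta$ from an initial value proportional to $1/\|H(y)^{-1}c\|_y$, until the objective value is within the desired precision of the optimal value. The constant in $O(\cdot)$ is absolute; iterations are counted in exact arithmetic.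
   Formalization: For ε > R_max the iteration bound is stated with R_max in place of ε, because the logarithm in the stated bound becomes negative for ε > 2(1+n+2∑m_j)R_max/μ; it is also shown that w already has precision ε when ε > R_max. *)

theory Defs
  imports "HOL-Analysis.Analysis" "HOL-Analysis.Finite_Function_Topology"
begin

section \<open>Vectors of variable dimension\<close>

text \<open>
  The complexity bound has an absolute constant, so the dimension \<open>n\<close>, the number \<open>N\<close> and the sizes
  \<open>m j\<close> are quantified inside a formula and cannot be types.  Vectors are therefore finitely supported
  families (a real normed vector space in the library), and \<open>R\<^sup>n\<close> is the subspace of those supported
  on \<open>{1..n}\<close>.  A point \<open>(x, t, z)\<close> carries all blocks \<open>z\<^sub>1, \<dots>, z\<^sub>N\<close> in one family with
  \<open>z (i, j) = z\<^sub>i\<^sub>j\<close>.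
\<close>

type_synonym rvec = "nat \<Rightarrow>\<^sub>0 real"
type_synonym point = "rvec \<times> real \<times> (nat \<times> nat \<Rightarrow>\<^sub>0 real)"

definition Rn :: "nat \<Rightarrow> rvec set" where
  "Rn n = {x. Poly_Mapping.keys x \<subseteq> {1..n}}"

definition Zn :: "nat \<Rightarrow> rvec set" where
  "Zn n = {x \<in> Rn n. \<forall>k\<in>{1..n}. Poly_Mapping.lookup x k \<in> \<int>}"

definition dot :: "nat \<Rightarrow> rvec \<Rightarrow> rvec \<Rightarrow> real" where
  "dot n x y = (\<Sum>k=1..n. Poly_Mapping.lookup x k * Poly_Mapping.lookup y k)"

definition norm1 :: "nat \<Rightarrow> rvec \<Rightarrow> real" where
  "norm1 n x = (\<Sum>k=1..n. \<bar>Poly_Mapping.lookup x k\<bar>)"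

definition norm2 :: "nat \<Rightarrow> rvec \<Rightarrow> real" where
  "norm2 n x = sqrt (\<Sum>k=1..n. (Poly_Mapping.lookup x k)\<^sup>2)"

section \<open>Maxima of log-sum-exp functions\<close>

text \<open>Throughout, \<open>F i j = f\<^sub>i\<^sub>j\<close> and \<open>a i j = a\<^sub>i\<^sub>j\<close> for \<open>j \<in> {1..N}\<close> and \<open>i \<in> {1..m j}\<close>.\<close>

definition exponents :: "nat \<Rightarrow> (nat \<Rightarrow> nat) \<Rightarrow> (nat \<Rightarrow> nat \<Rightarrow> rvec) \<Rightarrow> rvec set" where
  "exponents N m a = (\<Union>j\<in>{1..N}. (\<lambda>i. a i j) ` {1..m j})"

definition lse ::
  "nat \<Rightarrow> (nat \<Rightarrow> nat) \<Rightarrow> (nat \<Rightarrow> nat \<Rightarrow> real) \<Rightarrow> (nat \<Rightarrow> nat \<Rightarrow> rvec) \<Rightarrow> nat \<Rightarrow> rvec \<Rightarrow> real" where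
  "lse n m F a j x = ln (\<Sum>i=1..m j. F i j * exp (dot n (a i j) x))"

definition max_lse ::
  "nat \<Rightarrow> nat \<Rightarrow> (nat \<Rightarrow> nat) \<Rightarrow> (nat \<Rightarrow> nat \<Rightarrow> real) \<Rightarrow> (nat \<Rightarrow> nat \<Rightarrow> rvec) \<Rightarrow> rvec \<Rightarrow> real" where
  "max_lse n N m F a x = (MAX j\<in>{1..N}. lse n m F a j x)"

definition t_min :: "nat \<Rightarrow> (nat \<Rightarrow> nat) \<Rightarrow> (nat \<Rightarrow> nat \<Rightarrow> real) \<Rightarrow> real" where
  "t_min N m F = (MIN j\<in>{1..N}. MIN i\<in>{1..m j}. ln (F i j))"

definition a_max :: "nat \<Rightarrow> nat \<Rightarrow> (nat \<Rightarrow> nat) \<Rightarrow> (nat \<Rightarrow> nat \<Rightarrow> rvec) \<Rightarrow> real" where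
  "a_max n N m a = (MAX v\<in>exponents N m a. norm1 n v)"

definition mu :: "nat \<Rightarrow> (nat \<Rightarrow> nat) \<Rightarrow> (nat \<Rightarrow> nat \<Rightarrow> real) \<Rightarrow> real" where
  "mu N m F = (MIN j\<in>{1..N}. MIN i\<in>{1..m j}. F i j / (\<Sum>l=1..m j. F l j))"

section \<open>The extended feasible set, its barrier and the starting point\<close>

definition K_set ::
  "nat \<Rightarrow> nat \<Rightarrow> (nat \<Rightarrow> nat) \<Rightarrow> (nat \<Rightarrow> nat \<Rightarrow> real) \<Rightarrow> (nat \<Rightarrow> nat \<Rightarrow> rvec) \<Rightarrow> real \<Rightarrow> real
    \<Rightarrow> (rvec \<times> real) set" where
  "K_set n N m F a R tmax =
     {(x, t). x \<in> Rn n \<and> max_lse n N m F a x \<le> t \<and>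
              (\<forall>k\<in>{1..n}. \<bar>Poly_Mapping.lookup x k\<bar> \<le> R) \<and> t \<le> tmax}"

definition index_set :: "nat \<Rightarrow> (nat \<Rightarrow> nat) \<Rightarrow> (nat \<times> nat) set" where
  "index_set N m = {(i, j). j \<in> {1..N} \<and> i \<in> {1..m j}}"

definition aff_space :: "nat \<Rightarrow> nat \<Rightarrow> (nat \<Rightarrow> nat) \<Rightarrow> point set" where
  "aff_space n N m =
     {(x, t, z). x \<in> Rn n \<and> Poly_Mapping.keys z \<subseteq> index_set N m \<and>
                 (\<forall>j\<in>{1..N}. (\<Sum>i=1..m j. Poly_Mapping.lookup z (i, j)) = 1)}"

definition K_hat ::
  "nat \<Rightarrow> nat \<Rightarrow> (nat \<Rightarrow> nat) \<Rightarrow> (nat \<Rightarrow> nat \<Rightarrow> real) \<Rightarrow> (nat \<Rightarrow> nat \<Rightarrow> rvec) \<Rightarrow> real \<Rightarrow> real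
    \<Rightarrow> point set" where
  "K_hat n N m F a R tmax =
     {(x, t, z) \<in> aff_space n N m. (x, t) \<in> K_set n N m F a R tmax \<and>
        (\<forall>j\<in>{1..N}. \<forall>i\<in>{1..m j}. 0 < Poly_Mapping.lookup z (i, j) \<and>
           F i j * exp (dot n (a i j) x) \<le> Poly_Mapping.lookup z (i, j) * exp t)}"

definition barrier ::
  "nat \<Rightarrow> nat \<Rightarrow> (nat \<Rightarrow> nat) \<Rightarrow> (nat \<Rightarrow> nat \<Rightarrow> real) \<Rightarrow> (nat \<Rightarrow> nat \<Rightarrow> rvec) \<Rightarrow> real \<Rightarrow> real
    \<Rightarrow> point \<Rightarrow> real" where
  "barrier n N m F a R tmax = (\<lambda>(x, t, z).
     - (\<Sum>j=1..N. \<Sum>i=1..m j. ln (Poly_Mapping.lookup z (i, j)) +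
          ln (ln (Poly_Mapping.lookup z (i, j)) - dot n (a i j) x + t - ln (F i j)))
     - (\<Sum>k=1..n. ln (R\<^sup>2 - (Poly_Mapping.lookup x k)\<^sup>2)) - ln (tmax - t))"

definition start_point :: "nat \<Rightarrow> (nat \<Rightarrow> nat) \<Rightarrow> (nat \<Rightarrow> nat \<Rightarrow> real) \<Rightarrow> real \<Rightarrow> point" where
  "start_point N m F tbar =
     (0, tbar, \<Sum>j=1..N. \<Sum>i=1..m j. Poly_Mapping.single (i, j) (F i j / (\<Sum>l=1..m j. F l j)))"

definition t_coord :: "point \<Rightarrow> real" where
  "t_coord = (\<lambda>(x, t, z). t)"

section \<open>The short-step interior-point algorithm\<close>

text \<open>
  All derivatives are taken along an affine space \<open>S\<close>.  The gradient at \<open>y\<close> is the functional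
  \<open>grad \<beta> y\<close>, and the Hessian the bilinear form \<open>hess \<beta> y\<close>, both to be evaluated on the directions of \<open>S\<close>.
  For a linear functional \<open>l\<close>, \<open>inv_hess \<beta> S y l\<close> is the direction \<open>H(y)\<^sup>-\<^sup>1 l\<close>.
\<close>

definition directions :: "'a::real_normed_vector set \<Rightarrow> 'a set" where
  "directions S = {u - v | u v. u \<in> S \<and> v \<in> S}"

definition grad :: "('a::real_normed_vector \<Rightarrow> real) \<Rightarrow> 'a \<Rightarrow> 'a \<Rightarrow> real" where
  "grad \<beta> y v = deriv (\<lambda>s. \<beta> (y + s *\<^sub>R v)) 0"

definition hess :: "('a::real_normed_vector \<Rightarrow> real) \<Rightarrow> 'a \<Rightarrow> 'a \<Rightarrow> 'a \<Rightarrow> real" where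
  "hess \<beta> y u v = deriv (\<lambda>s. grad \<beta> (y + s *\<^sub>R u) v) 0"

definition local_norm :: "('a::real_normed_vector \<Rightarrow> real) \<Rightarrow> 'a \<Rightarrow> 'a \<Rightarrow> real" where
  "local_norm \<beta> y v = sqrt (hess \<beta> y v v)"

definition inv_hess ::
  "('a::real_normed_vector \<Rightarrow> real) \<Rightarrow> 'a set \<Rightarrow> 'a \<Rightarrow> ('a \<Rightarrow> real) \<Rightarrow> 'a" where
  "inv_hess \<beta> S y l =
     (THE v. v \<in> directions S \<and> (\<forall>u\<in>directions S. hess \<beta> y v u = l u))"

text \<open>The Newton step at \<open>y\<close> for the function \<open>\<eta> p + \<beta>\<close>, where \<open>p\<close> is linear.\<close>

definition newton_step ::
  "('a::real_normed_vector \<Rightarrow> real) \<Rightarrow> 'a set \<Rightarrow> ('a \<Rightarrow> real) \<Rightarrow> real \<Rightarrow> 'a \<Rightarrow> 'a" where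
  "newton_step \<beta> S p \<eta> y = inv_hess \<beta> S y (\<lambda>u. - (\<eta> * p u + grad \<beta> y u))"

definition path_step ::
  "('a::real_normed_vector \<Rightarrow> real) \<Rightarrow> 'a set \<Rightarrow> ('a \<Rightarrow> real) \<Rightarrow> real \<Rightarrow> 'a \<times> real \<Rightarrow> 'a \<times> real" where
  "path_step \<beta> S p r = (\<lambda>(y, \<eta>). (y + newton_step \<beta> S p (r * \<eta>) y, r * \<eta>))"

definition phase1 ::
  "('a::real_normed_vector \<Rightarrow> real) \<Rightarrow> 'a set \<Rightarrow> real \<Rightarrow> 'a \<Rightarrow> nat \<Rightarrow> 'a" where
  "phase1 \<beta> S \<theta> y0 k =
     fst ((path_step \<beta> S (\<lambda>u. - grad \<beta> y0 u) (1 - 1 / (8 * sqrt \<theta>)) ^^ k) (y0, 1))"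

definition phase2 ::
  "('a::real_normed_vector \<Rightarrow> real) \<Rightarrow> 'a set \<Rightarrow> real \<Rightarrow> ('a \<Rightarrow> real) \<Rightarrow> real \<Rightarrow> 'a \<Rightarrow> nat \<Rightarrow> 'a" where
  "phase2 \<beta> S \<theta> c \<kappa> y1 k =
     fst ((path_step \<beta> S c (1 + 1 / (8 * sqrt \<theta>)) ^^ k)
            (y1, \<kappa> / local_norm \<beta> y1 (inv_hess \<beta> S y1 c)))"

text \<open>
  \<open>near_center \<beta> S \<delta> y\<close>: the Newton step for \<open>\<beta>\<close> itself (that is, \<open>\<eta> = 0\<close>) has local norm at most \<open>\<delta>\<close>.
\<close>

definition near_center :: "('a::real_normed_vector \<Rightarrow> real) \<Rightarrow> 'a set \<Rightarrow> real \<Rightarrow> 'a \<Rightarrow> bool" where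
  "near_center \<beta> S \<delta> y \<longleftrightarrow> local_norm \<beta> y (newton_step \<beta> S (\<lambda>_. 0) 0 y) \<le> \<delta>"

text \<open>
  \<open>short_step_ipm D S \<beta> \<theta> c \<delta> \<kappa> \<epsilon> y0 k y\<close>: started at \<open>y0\<close>, the algorithm for minimizing \<open>c\<close> over the
  closure of \<open>D\<close> (open in the affine space \<open>S\<close>) with barrier \<open>\<beta>\<close> of parameter \<open>\<theta>\<close> stops after exactly
  \<open>k\<close> iterations and returns \<open>y\<close>.  The first phase ends at the first iterate near the center, the second
  at the first iterate whose objective value is within \<open>\<epsilon>\<close> of the optimal value; all iterates must lie
  in \<open>D\<close>.  The absolute constants of the algorithm are the threshold \<open>\<delta>\<close> of the first phase and the
  factor \<open>\<kappa>\<close> in the initial \<open>\<eta>\<close> of the second.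
\<close>

definition short_step_ipm ::
  "'a::real_normed_vector set \<Rightarrow> 'a set \<Rightarrow> ('a \<Rightarrow> real) \<Rightarrow> real \<Rightarrow> ('a \<Rightarrow> real) \<Rightarrow> real \<Rightarrow> real \<Rightarrow> real
    \<Rightarrow> 'a \<Rightarrow> nat \<Rightarrow> 'a \<Rightarrow> bool" where
  "short_step_ipm D S \<beta> \<theta> c \<delta> \<kappa> \<epsilon> y0 k y \<longleftrightarrow>
     (\<exists>k1 k2 y1.
        (\<forall>i\<le>k1. phase1 \<beta> S \<theta> y0 i \<in> D) \<and>
        (\<forall>i<k1. \<not> near_center \<beta> S \<delta> (phase1 \<beta> S \<theta> y0 i)) \<and>
        y1 = phase1 \<beta> S \<theta> y0 k1 \<and> near_center \<beta> S \<delta> y1 \<and>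
        (\<forall>i\<le>k2. phase2 \<beta> S \<theta> c \<kappa> y1 i \<in> D) \<and>
        (\<forall>i<k2. (INF v\<in>closure D. c v) + \<epsilon> < c (phase2 \<beta> S \<theta> c \<kappa> y1 i)) \<and>
        y = phase2 \<beta> S \<theta> c \<kappa> y1 k2 \<and> c y \<le> (INF v\<in>closure D. c v) + \<epsilon> \<and>
        k = k1 + k2)"

end

theory Submission
  imports Defs "Jordan_Normal_Form.Determinant"
begin

text \<open>
  The barrier is a sum of affine substitutions of three elementary self-concordant barriers:
  \<open>- ln z - ln (ln z + s)\<close> (parameter \<open>2\<close>), \<open>- ln (R\<^sup>2 - x\<^sup>2)\<close> and \<open>- ln s\<close> (parameter \<open>1\<close> each).  Each short step keeps the
  Newton step below \<open>1/9\<close>, by the quadratic contraction \<open>\<nu> \<mapsto> (\<nu> / (1 - \<nu>))\<^sup>2\<close>.  The first phase ends once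
  \<open>\<eta>\<close> times the variation of the initial gradient over the domain, which is \<open>O(\<theta> / \<mu>)\<close> by direct estimation,
  is small; in the second phase the objective gap is at most \<open>2 \<theta> / \<eta>\<close>, where initially
  \<open>1 / \<eta> = O(R\<^bsub>max\<^esub>)\<close>.

  The box does not cut off the infimum of \<open>f\<close>: points with \<open>f x \<le> f 0\<close> satisfy \<open>a \<bullet> x \<le> f 0 - t\<^bsub>min\<^esub>\<close> for all
  exponents \<open>a\<close>.  The coordinates of such points are dominated by those of vertices of this polytope,
  which are bounded by Cramer's rule and Hadamard's inequality since the exponents are integral.
\<close>

text \<open>The start \<open>w\<close> is chosen so that \<mu> is the only datum besides \<theta>
  that enters the first phase. With \<open>B = (a_max n N m a + 1) * R\<close>, the point
  \<open>w\<close> leaves slack at least \<open>B / 2\<close> in every logarithmic constraint and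
  exactly \<open>B / 2\<close> below \<open>tmax\<close>, while \<open>t\<close> and the products
  with exponents vary over the domain by fixed multiples of \<open>B\<close>; these quotients are
  absolute constants. The box terms of the gradient cancel at \<open>x = 0\<close>. What remains is
  the division by the simplex coordinates of \<open>w\<close>, which are at least \<mu>.

  Points live in a space of infinite dimension, where the Hessian is degenerate. It is definite
  along the directions of the affine space, and a finite set spanning them takes the place of a
  finite-dimensional type.

  The iteration bound is stated with \<open>min \<epsilon> Rmax\<close>: the objective varies by at
  most \<open>Rmax\<close> on the domain, so for larger \<epsilon> the start is already accurate
  enough, whereas a logarithm with \<epsilon> itself could become negative.\<close>

abbreviation "lookup \<equiv> Poly_Mapping.lookup"
abbreviation "keys \<equiv> Poly_Mapping.keys"
abbreviation "single \<equiv> Poly_Mapping.single"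

section \<open>Quadratic forms\<close>

definition psd_form :: "('a::real_vector \<Rightarrow> 'a \<Rightarrow> real) \<Rightarrow> bool" where
  "psd_form B \<longleftrightarrow> bilinear B \<and> (\<forall>u v. B u v = B v u) \<and> (\<forall>u. 0 \<le> B u u)"

lemma psd_formI:
  assumes "\<And>x y z. B (x + y) z = B x z + B y z" "\<And>r x z. B (r *\<^sub>R x) z = r * B x z"
    and sym: "\<And>x y. B x y = B y x" and "\<And>x. 0 \<le> B x x"
  shows "psd_form B"
proof -
  have "linear (\<lambda>x. B x y)" for y
    using assms(1,2) by (intro linearI) auto
  moreover have "linear (B x)" for x
    using assms(1,2) by (intro linearI) (auto simp: sym[of x])
  ultimately show ?thesis
    using assms(3,4) unfolding psd_form_def bilinear_def by simp
qed

lemma psd_form_sym: "psd_form B \<Longrightarrow> B u v = B v u"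
  and psd_form_nonneg: "psd_form B \<Longrightarrow> 0 \<le> B u u"
  and psd_form_bilinear: "psd_form B \<Longrightarrow> bilinear B"
  unfolding psd_form_def by auto

lemmas psd_form_simps =
  bilinear_ladd[OF psd_form_bilinear] bilinear_radd[OF psd_form_bilinear]
  bilinear_lmul[OF psd_form_bilinear] bilinear_rmul[OF psd_form_bilinear]
  bilinear_lsub[OF psd_form_bilinear] bilinear_rsub[OF psd_form_bilinear]

lemma psd_form_cauchy:
  assumes B: "psd_form B"
  shows "(B u v)\<^sup>2 \<le> B u u * B v v"
proof -
  have *: "0 \<le> B u u - 2 * t * B u v + t\<^sup>2 * B v v" for t
    using psd_form_nonneg[OF B, of "u - t *\<^sub>R v"] psd_form_sym[OF B, of v u]
    by (simp add: psd_form_simps[OF B] power2_eq_square algebra_simps)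
  show ?thesis
  proof (cases "B v v = 0")
    case True
    have "B u v = 0"
    proof (rule ccontr)
      assume "B u v \<noteq> 0"
      then show False
        using *[of "(B u u + 1) / (2 * B u v)"] True by simp
    qed
    then show ?thesis using True by simp
  next
    case False
    then have "0 < B v v" using psd_form_nonneg[OF B, of v] by simp
    then show ?thesis
      using *[of "B u v / B v v"] by (simp add: field_simps power2_eq_square)
  qed
qed

lemma psd_form_cauchy_sqrt:
  assumes B: "psd_form B"
  shows "\<bar>B u v\<bar> \<le> sqrt (B u u) * sqrt (B v v)"
  using real_sqrt_le_mono[OF psd_form_cauchy[OF B, of u v]] by (simp add: real_sqrt_mult)

text \<open>Polarization expresses \<open>C x y\<close> by diagonal values, and the parallelogram
  law adds up their bounds by \<open>B\<close>. Scaling both vectors to equal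
  \<open>B\<close>-length first turns the arithmetic mean into the product of the lengths. In the
  Newton analysis \<open>C\<close> is a difference of two Hessians, which has no sign.\<close>

lemma dominated_form_cauchy:
  assumes B: "psd_form B" and C: "bilinear C" "\<And>u v. C u v = C v u"
    and dom: "\<And>h. \<bar>C h h\<bar> \<le> c * B h h" and pos: "0 < B u u" "0 < B v v"
  shows "\<bar>C u v\<bar> \<le> c * (sqrt (B u u) * sqrt (B v v))"
proof -
  define a b where "a = sqrt (B u u)" and "b = sqrt (B v v)"
  have ab: "0 < a" "0 < b" "B u u = a\<^sup>2" "B v v = b\<^sup>2"
    using pos by (auto simp: a_def b_def)
  define x y where "x = b *\<^sub>R u" and "y = a *\<^sub>R v"
  have "4 * C x y = C (x + y) (x + y) - C (x - y) (x - y)"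
    using C(2)[of y x]
    by (simp add: bilinear_ladd[OF C(1)] bilinear_radd[OF C(1)] bilinear_lsub[OF C(1)]
        bilinear_rsub[OF C(1)])
  then have "\<bar>4 * C x y\<bar> \<le> c * B (x + y) (x + y) + c * B (x - y) (x - y)"
    using dom[of "x + y"] dom[of "x - y"] by linarith
  also have "\<dots> = 2 * c * (B x x + B y y)"
    using psd_form_sym[OF B, of y x] by (simp add: psd_form_simps[OF B] algebra_simps)
  also have "\<dots> = 4 * c * (a * b)\<^sup>2"
    by (simp add: x_def y_def psd_form_simps[OF B] ab power2_eq_square)
  finally have "\<bar>C x y\<bar> \<le> c * (a * b)\<^sup>2"
    by simp
  moreover have "C x y = (a * b) * C u v"
    by (simp add: x_def y_def bilinear_lmul[OF C(1)] bilinear_rmul[OF C(1)])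
  ultimately have "(a * b) * \<bar>C u v\<bar> \<le> (a * b) * (c * (a * b))"
    using ab(1,2) by (simp add: abs_mult power2_eq_square algebra_simps)
  then show ?thesis
    using ab(1,2) by (simp add: a_def[symmetric] b_def[symmetric])
qed

text \<open>Gram-Schmidt by induction over the spanning vectors: \<open>b\<close> minus its
  \<open>H\<close>-projection \<open>w\<close> onto the old span is orthogonal to that span, so the
  representing vector only has to be corrected along \<open>b - w\<close>.\<close>

lemma riesz_span:
  assumes H: "psd_form H" and "finite B"
    and "\<And>v. v \<in> span B \<Longrightarrow> H v v = 0 \<Longrightarrow> v = 0" and "linear l"
  shows "\<exists>v\<in>span B. \<forall>u\<in>span B. H v u = l u"
  using assms(2-)
proof (induction B arbitrary: l rule: finite_induct)
  case empty
  then show ?case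
    by (simp add: linear_0 bilinear_rzero[OF psd_form_bilinear[OF H]])
next
  case (insert b B)
  have sub: "span B \<subseteq> span (insert b B)"
    by (rule span_mono) auto
  have pd: "v = 0" if "v \<in> span B" "H v v = 0" for v
    using insert.prems(1)[of v] that sub by auto
  obtain v where v: "v \<in> span B" "\<And>u. u \<in> span B \<Longrightarrow> H v u = l u"
    using insert.IH[of l] pd insert.prems(2) by blast
  have "linear (H b)"
    using psd_form_bilinear[OF H] by (simp add: bilinear_def)
  then obtain w where w: "w \<in> span B" "\<And>u. u \<in> span B \<Longrightarrow> H w u = H b u"
    using insert.IH[of "H b"] pd by blast
  define e where "e = b - w"
  have eV: "e \<in> span (insert b B)"
    unfolding e_def using w(1) sub by (auto intro!: span_diff intro: span_base)
  have eorth: "H e u = 0" if "u \<in> span B" for u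
    using w(2)[OF that] by (simp add: e_def psd_form_simps[OF H])
  have dec: "\<exists>u' c. u' \<in> span B \<and> u = u' + c *\<^sub>R e" if u: "u \<in> span (insert b B)" for u
  proof -
    obtain k where k: "u - k *\<^sub>R b \<in> span B"
      using u by (auto simp: span_insert)
    have "u = (u - k *\<^sub>R b + k *\<^sub>R w) + k *\<^sub>R e"
      by (simp add: e_def algebra_simps)
    then show ?thesis
      using k w(1) span_add span_scale by blast
  qed
  show ?case
  proof (cases "e = 0")
    case True
    then have "H v u = l u" if "u \<in> span (insert b B)" for u
      using dec[OF that] v(2) by auto
    then show ?thesis using v(1) sub by blast
  next
    case False
    then have ne: "H e e \<noteq> 0" using insert.prems(1)[OF eV] by blast
    define v' where "v' = v + (l e / H e e) *\<^sub>R e"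
    have "H v' u = l u" if uV: "u \<in> span (insert b B)" for u
    proof -
      obtain u' c where u: "u' \<in> span B" "u = u' + c *\<^sub>R e"
        using dec[OF uV] by blast
      have "H v e = 0" using eorth[OF v(1)] psd_form_sym[OF H] by metis
      then show ?thesis
        using ne v(2)[OF u(1)] eorth[OF u(1)]
        by (simp add: u(2) v'_def psd_form_simps[OF H] linear_add[OF insert.prems(2)]
            linear_scale[OF insert.prems(2)])
    qed
    moreover have "v' \<in> span (insert b B)"
      unfolding v'_def using v(1) sub eV by (auto intro: span_add span_scale)
    ultimately show ?thesis by blast
  qed
qed

lemma subspace_finite_span:
  assumes "subspace V" "finite B" "V \<subseteq> span B"
  obtains B' where "finite B'" "span B' = V"
proof -
  obtain B' where B': "B' \<subseteq> V" "independent B'" "V \<subseteq> span B'"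
    using maximal_independent_subset by blast
  have "finite B'"
    using independent_span_bound[OF assms(2) B'(2)] B'(1) assms(3) by auto
  moreover have "span B' = V"
    using B' assms(1) by (simp add: span_minimal subset_antisym)
  ultimately show thesis by (rule that)
qed

text \<open>Stands in for integrating \<open>f'\<close>: an antiderivative \<open>W\<close> of a
  majorant bounds the increment, and no integrability is involved.\<close>

lemma abs_deriv_bound:
  fixes f W :: "real \<Rightarrow> real"
  assumes "a \<le> b"
    and "\<And>s. a \<le> s \<Longrightarrow> s \<le> b \<Longrightarrow> (f has_real_derivative f' s) (at s)"
    and "\<And>s. a \<le> s \<Longrightarrow> s \<le> b \<Longrightarrow> (W has_real_derivative W' s) (at s)"
    and "\<And>s. a \<le> s \<Longrightarrow> s \<le> b \<Longrightarrow> \<bar>f' s\<bar> \<le> W' s"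
  shows "\<bar>f b - f a\<bar> \<le> W b - W a"
proof -
  have "W a - f a \<le> W b - f b"
    by (rule DERIV_nonneg_imp_nondecreasing[OF assms(1)])
      (use assms(2-) in \<open>force intro!: exI derivative_intros\<close>)
  moreover have "W a + f a \<le> W b + f b"
    by (rule DERIV_nonneg_imp_nondecreasing[OF assms(1)])
      (use assms(2-) in \<open>force intro!: exI derivative_intros\<close>)
  ultimately show ?thesis by linarith
qed

lemma deriv_lower_bound:
  fixes f W :: "real \<Rightarrow> real"
  assumes "a \<le> b"
    and "\<And>s. a \<le> s \<Longrightarrow> s \<le> b \<Longrightarrow> (f has_real_derivative f' s) (at s)"
    and "\<And>s. a \<le> s \<Longrightarrow> s \<le> b \<Longrightarrow> (W has_real_derivative W' s) (at s)"
    and "\<And>s. a \<le> s \<Longrightarrow> s \<le> b \<Longrightarrow> W' s \<le> f' s"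
  shows "W b - W a \<le> f b - f a"
proof -
  have "f a - W a \<le> f b - W b"
    by (rule DERIV_nonneg_imp_nondecreasing[OF assms(1)])
      (use assms(2-) in \<open>force intro!: exI derivative_intros\<close>)
  then show ?thesis by linarith
qed

section \<open>Self-concordant barriers\<close>

text \<open>Self-concordance in Renegar's form: the Dikin ellipsoids lie in the domain, and the local norms at
  \<open>y\<close> and at a point \<open>y + d\<close> of the ellipsoid differ by a factor of at most \<open>1 / (1 - \<parallel>d\<parallel>\<^sub>y)\<close>.  This is stable
  under sums and affine substitutions and needs no third derivatives.\<close>

locale sc_barrier =
  fixes G :: "'a::real_normed_vector set" and \<beta> :: "'a \<Rightarrow> real"
    and g :: "'a \<Rightarrow> 'a \<Rightarrow> real" and H :: "'a \<Rightarrow> 'a \<Rightarrow> 'a \<Rightarrow> real" and \<theta> :: real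
  assumes convex_dom: "convex G"
    and param_nonneg: "0 \<le> \<theta>"
    and linear_g: "y \<in> G \<Longrightarrow> linear (g y)"
    and psd_H: "y \<in> G \<Longrightarrow> psd_form (H y)"
    and deriv_\<beta>: "y \<in> G \<Longrightarrow> ((\<lambda>s. \<beta> (y + s *\<^sub>R v)) has_real_derivative g y v) (at 0)"
    and deriv_g: "y \<in> G \<Longrightarrow> ((\<lambda>s. g (y + s *\<^sub>R u) v) has_real_derivative H y u v) (at 0)"
    and g_square_le: "y \<in> G \<Longrightarrow> (g y v)\<^sup>2 \<le> \<theta> * H y v v"
    and dikin: "y \<in> G \<Longrightarrow> H y d d < 1 \<Longrightarrow> y + d \<in> G"
    and H_lower: "y \<in> G \<Longrightarrow> H y d d < 1 \<Longrightarrow> (1 - sqrt (H y d d))\<^sup>2 * H y h h \<le> H (y + d) h h"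
    and H_upper: "y \<in> G \<Longrightarrow> H y d d < 1 \<Longrightarrow> (1 - sqrt (H y d d))\<^sup>2 * H (y + d) h h \<le> H y h h"
begin

abbreviation nrm :: "'a \<Rightarrow> 'a \<Rightarrow> real" where
  "nrm y v \<equiv> sqrt (H y v v)"

lemma nrm_square: "y \<in> G \<Longrightarrow> (nrm y v)\<^sup>2 = H y v v"
  using psd_form_nonneg[OF psd_H] by simp

lemma nrm_scale: "y \<in> G \<Longrightarrow> nrm y (s *\<^sub>R v) = \<bar>s\<bar> * nrm y v"
  by (simp add: psd_form_simps[OF psd_H] mult.assoc[symmetric] real_sqrt_mult)

lemma nrm_nonneg: "y \<in> G \<Longrightarrow> 0 \<le> nrm y v"
  using psd_form_nonneg[OF psd_H] by simp

lemma abs_g_le: "y \<in> G \<Longrightarrow> \<bar>g y v\<bar> \<le> sqrt \<theta> * nrm y v"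
  using real_sqrt_le_mono[OF g_square_le[of y v]] by (simp add: real_sqrt_mult)

lemma grad_eq: "y \<in> G \<Longrightarrow> grad \<beta> y v = g y v"
  unfolding grad_def by (intro DERIV_imp_deriv deriv_\<beta>)

text \<open>The Dikin ellipsoid serves as openness of \<open>G\<close> along lines; hence
  \<open>grad \<beta>\<close> agrees with \<open>g\<close> near \<open>y\<close> and can be
  differentiated once more.\<close>

lemma eventually_in_dom:
  assumes "y \<in> G"
  shows "\<forall>\<^sub>F s in nhds 0. y + s *\<^sub>R u \<in> G"
proof -
  have "((\<lambda>s::real. s\<^sup>2 * H y u u) \<longlongrightarrow> 0\<^sup>2 * H y u u) (nhds 0)"
    by (intro tendsto_intros filterlim_ident)
  then have "\<forall>\<^sub>F s::real in nhds 0. s\<^sup>2 * H y u u < 1"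
    by (rule order_tendstoD(2)) simp
  then show ?thesis
    by eventually_elim
      (intro dikin assms, simp add: psd_form_simps[OF psd_H[OF assms]] power2_eq_square)
qed

lemma hess_eq: "y \<in> G \<Longrightarrow> hess \<beta> y u v = H y u v"
proof -
  assume y: "y \<in> G"
  have "\<forall>\<^sub>F s in nhds 0. grad \<beta> (y + s *\<^sub>R u) v = g (y + s *\<^sub>R u) v"
    using eventually_in_dom[OF y, of u] by eventually_elim (rule grad_eq)
  then have "hess \<beta> y u v = deriv (\<lambda>s. g (y + s *\<^sub>R u) v) 0"
    unfolding hess_def by (intro deriv_cong_ev) auto
  then show ?thesis
    using DERIV_imp_deriv[OF deriv_g[OF y]] by simp
qed

lemma local_norm_eq: "y \<in> G \<Longrightarrow> local_norm \<beta> y v = nrm y v"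
  by (simp add: local_norm_def hess_eq)

lemma deriv_g_line:
  assumes "y + s *\<^sub>R u \<in> G"
  shows "((\<lambda>s. g (y + s *\<^sub>R u) v) has_real_derivative H (y + s *\<^sub>R u) u v) (at s)"
proof -
  have "((\<lambda>x. g (y + s *\<^sub>R u + x *\<^sub>R u) v) has_real_derivative H (y + s *\<^sub>R u) u v) (at 0)"
    by (rule deriv_g[OF assms])
  then have "((\<lambda>x. g (y + (x + s) *\<^sub>R u) v) has_real_derivative H (y + s *\<^sub>R u) u v) (at 0)"
    by (simp add: algebra_simps)
  then show ?thesis
    using DERIV_shift[of "\<lambda>x. g (y + x *\<^sub>R u) v" "H (y + s *\<^sub>R u) u v" 0 s] by simp
qed

lemma segment_dikin:
  assumes "y \<in> G" "0 \<le> s" "s * nrm y n < 1"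
  shows "y + s *\<^sub>R n \<in> G"
    and "(1 - s * nrm y n)\<^sup>2 * H y h h \<le> H (y + s *\<^sub>R n) h h"
    and "(1 - s * nrm y n)\<^sup>2 * H (y + s *\<^sub>R n) h h \<le> H y h h"
proof -
  have eq: "nrm y (s *\<^sub>R n) = s * nrm y n"
    using assms(2) nrm_scale[OF assms(1)] by simp
  have lt: "H y (s *\<^sub>R n) (s *\<^sub>R n) < 1"
    using assms(3) eq by (metis real_sqrt_lt_1_iff)
  show "y + s *\<^sub>R n \<in> G"
    by (rule dikin[OF assms(1) lt])
  show "(1 - s * nrm y n)\<^sup>2 * H y h h \<le> H (y + s *\<^sub>R n) h h"
    using H_lower[OF assms(1) lt] unfolding eq .
  show "(1 - s * nrm y n)\<^sup>2 * H (y + s *\<^sub>R n) h h \<le> H y h h"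
    using H_upper[OF assms(1) lt] unfolding eq .
qed

lemma segment_in_dom:
  assumes "y \<in> G" "y + h \<in> G" "0 \<le> s" "s \<le> 1"
  shows "y + s *\<^sub>R h \<in> G"
proof -
  have "(1 - s) *\<^sub>R y + s *\<^sub>R (y + h) \<in> G"
    using convex_dom assms by (intro convexD) auto
  then show ?thesis by (simp add: algebra_simps)
qed

lemma g_mono_segment:
  assumes "y \<in> G" "y + h \<in> G" "0 \<le> a" "a \<le> b" "b \<le> 1"
  shows "g (y + a *\<^sub>R h) h \<le> g (y + b *\<^sub>R h) h"
  by (rule DERIV_nonneg_imp_nondecreasing[OF assms(4)])
    (use assms segment_in_dom psd_form_nonneg[OF psd_H] in
      \<open>force intro!: exI deriv_g_line\<close>)

text \<open>Along a segment, \<open>\<psi> = g[h]\<close> satisfies \<open>\<theta> \<psi>' \<ge> \<psi>\<^sup>2\<close> and would blow up before the end point if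
  it started above \<open>\<theta>\<close>.\<close>

lemma g_le_param:
  assumes "y \<in> G" "y + h \<in> G"
  shows "g y h \<le> \<theta>"
proof (cases "g y h \<le> 0")
  case True
  then show ?thesis using param_nonneg by simp
next
  case False
  define \<psi> where "\<psi> s = g (y + s *\<^sub>R h) h" for s
  have mono: "\<psi> 0 \<le> \<psi> s" if "0 \<le> s" "s \<le> 1" for s
    unfolding \<psi>_def using g_mono_segment[OF assms, of 0 s] that by simp
  have pos: "0 < \<psi> s" if "0 \<le> s" "s \<le> 1" for s
    using mono[OF that] False by (simp add: \<psi>_def)
  have \<theta>: "0 < \<theta>"
  proof (rule ccontr)
    assume "\<not> 0 < \<theta>"
    then have "\<theta> = 0" using param_nonneg by simp
    moreover have "0 < (g y h)\<^sup>2" using False by (simp add: not_le)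
    ultimately show False using g_square_le[OF assms(1), of h] by (metis mult_zero_left not_le)
  qed
  have d: "(\<psi> has_real_derivative H (y + s *\<^sub>R h) h h) (at s)" if "0 \<le> s" "s \<le> 1" for s
    unfolding \<psi>_def using segment_in_dom[OF assms that] by (rule deriv_g_line)
  \<comment> \<open>The slope of \<open>- 1 / \<psi>\<close> is at least \<open>1 / \<theta>\<close>
    on the unit interval, while its value at the right end is still negative.\<close>
  have "1 / \<theta> * 1 - 1 / \<theta> * 0 \<le> - inverse (\<psi> 1) - (- inverse (\<psi> 0))"
  proof (rule deriv_lower_bound[where f = "\<lambda>s. - inverse (\<psi> s)" and W = "\<lambda>s. 1 / \<theta> * s"
        and f' = "\<lambda>s. H (y + s *\<^sub>R h) h h / (\<psi> s)\<^sup>2" and W' = "\<lambda>s. 1 / \<theta>"])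
    fix s :: real assume s: "0 \<le> s" "s \<le> 1"
    show "((\<lambda>s. - inverse (\<psi> s)) has_real_derivative H (y + s *\<^sub>R h) h h / (\<psi> s)\<^sup>2) (at s)"
      using pos[OF s] by (auto intro!: derivative_eq_intros d s simp: field_simps power2_eq_square)
    show "((\<lambda>s. 1 / \<theta> * s) has_real_derivative 1 / \<theta>) (at s)"
      using \<theta> by (auto intro!: derivative_eq_intros)
    show "1 / \<theta> \<le> H (y + s *\<^sub>R h) h h / (\<psi> s)\<^sup>2"
      using g_square_le[OF segment_in_dom[OF assms s], of h] pos[OF s] \<theta>
      by (simp add: \<psi>_def[symmetric] field_simps)
  qed simp
  moreover have "0 < inverse (\<psi> 1)" using pos[of 1] by simp
  ultimately have "1 / \<theta> \<le> inverse (\<psi> 0)" by linarith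
  then have "\<psi> 0 \<le> \<theta>"
    using pos[of 0] \<theta> by (simp add: field_simps)
  then show ?thesis by (simp add: \<psi>_def)
qed

text \<open>If \<open>h\<close> is long then \<open>g[h]\<close> gains a fixed multiple of \<open>\<parallel>h\<parallel>\<close> within half of the Dikin ellipsoid,
  and at that point it is still at most \<open>2 \<theta>\<close>.  This replaces a comparison with the exact minimizer
  on the central path, whose existence is never needed.\<close>

lemma g_plus_nrm_le:
  assumes "y \<in> G" "y + h \<in> G" "1 \<le> \<theta>"
  shows "g y h + nrm y h / 9 \<le> 2 * \<theta>"
proof (cases "nrm y h \<le> 1")
  case True
  then show ?thesis using g_le_param[OF assms(1,2)] assms(3) by linarith
next
  case False
  define \<rho> where "\<rho> = nrm y h"
  define a where "a = 1 / (2 * \<rho>)"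
  have \<rho>: "1 < \<rho>" using False by (simp add: \<rho>_def)
  then have a: "0 < a" "a \<le> 1 / 2" "a * \<rho> = 1 / 2" by (auto simp: a_def field_simps)
  define \<psi> where "\<psi> s = g (y + s *\<^sub>R h) h" for s
  have inG: "y + s *\<^sub>R h \<in> G" if "0 \<le> s" "s \<le> a" for s
    using that a by (intro segment_in_dom[OF assms(1,2)]) auto
  have "- (\<rho> * (1 - a * \<rho>) ^ 3 / 3) - - (\<rho> * (1 - 0 * \<rho>) ^ 3 / 3) \<le> \<psi> a - \<psi> 0"
  proof (rule deriv_lower_bound[where f = \<psi> and W = "\<lambda>s. - (\<rho> * (1 - s * \<rho>) ^ 3 / 3)"
        and f' = "\<lambda>s. H (y + s *\<^sub>R h) h h" and W' = "\<lambda>s. \<rho>\<^sup>2 * (1 - s * \<rho>)\<^sup>2"])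
    fix s :: real assume s: "0 \<le> s" "s \<le> a"
    show "(\<psi> has_real_derivative H (y + s *\<^sub>R h) h h) (at s)"
      unfolding \<psi>_def by (rule deriv_g_line[OF inG[OF s]])
    show "((\<lambda>s. - (\<rho> * (1 - s * \<rho>) ^ 3 / 3)) has_real_derivative \<rho>\<^sup>2 * (1 - s * \<rho>)\<^sup>2) (at s)"
      by (auto intro!: derivative_eq_intros simp: power2_eq_square)
    have "s * \<rho> \<le> a * \<rho>" using s \<rho> by simp
    then have "s * nrm y h < 1" using a by (simp add: \<rho>_def)
    from segment_dikin(2)[OF assms(1) s(1) this, of h]
    show "\<rho>\<^sup>2 * (1 - s * \<rho>)\<^sup>2 \<le> H (y + s *\<^sub>R h) h h"
      using nrm_square[OF assms(1), of h] by (simp add: \<rho>_def[symmetric] mult.commute)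
  qed (use a in auto)
  \<comment> \<open>The integral of \<open>\<rho>^2 * (1 - s * \<rho>)^2\<close> up to
    \<open>a\<close> is \<open>\<rho> / 3 * (1 - 1/8)\<close>, which exceeds
    \<open>\<rho> / 9\<close>.\<close>
  then have gain: "7 / 24 * \<rho> \<le> \<psi> a - \<psi> 0"
    unfolding a(3) by (simp add: power3_eq_cube)
  have "y + a *\<^sub>R h + (1 - a) *\<^sub>R h \<in> G"
    using assms(2) by (simp add: algebra_simps)
  then have "g (y + a *\<^sub>R h) ((1 - a) *\<^sub>R h) \<le> \<theta>"
    using inG[of a] a(1) by (intro g_le_param) auto
  then have le: "(1 - a) * \<psi> a \<le> \<theta>"
    using linear_scale[OF linear_g[OF inG[of a]]] a(1) by (simp add: \<psi>_def)
  \<comment> \<open>Since \<open>a \<le> 1/2\<close>, at least half of the segment lies ahead, and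
    \<open>g_le_param\<close> loses at most a factor 2.\<close>
  have "\<psi> a \<le> 2 * \<theta>"
  proof (cases "\<psi> a \<le> 0")
    case False
    then have "1 / 2 * \<psi> a \<le> (1 - a) * \<psi> a"
      using a by (intro mult_right_mono) auto
    then show ?thesis using le by simp
  qed (use assms(3) in auto)
  then show ?thesis
    using gain \<rho> by (simp add: \<psi>_def \<rho>_def[symmetric])
qed


text \<open>\<open>functional_bound V y l M\<close> says that the dual local norm of \<open>l\<close> restricted to \<open>V\<close> is at most \<open>M\<close>;
  for \<open>l = \<eta> p + g y\<close> this dual norm is the local norm of the Newton step.\<close>

definition functional_bound :: "'a set \<Rightarrow> 'a \<Rightarrow> ('a \<Rightarrow> real) \<Rightarrow> real \<Rightarrow> bool" where
  "functional_bound V y l M \<longleftrightarrow> (\<forall>u\<in>V. \<bar>l u\<bar> \<le> M * nrm y u)"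

lemma functional_boundI: "(\<And>u. u \<in> V \<Longrightarrow> \<bar>l u\<bar> \<le> M * nrm y u) \<Longrightarrow> functional_bound V y l M"
  and functional_boundD: "functional_bound V y l M \<Longrightarrow> u \<in> V \<Longrightarrow> \<bar>l u\<bar> \<le> M * nrm y u"
  unfolding functional_bound_def by auto

lemma functional_bound_mono:
  "y \<in> G \<Longrightarrow> functional_bound V y l M \<Longrightarrow> M \<le> M' \<Longrightarrow> functional_bound V y l M'"
  using nrm_nonneg unfolding functional_bound_def by (meson mult_right_mono order_trans)

lemma functional_bound_add:
  assumes "functional_bound V y l M" "functional_bound V y l' M'"
  shows "functional_bound V y (\<lambda>u. l u + l' u) (M + M')"
  using assms unfolding functional_bound_def
  by (smt (verit) distrib_right)

lemma functional_bound_scale: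
  assumes "functional_bound V y l M"
  shows "functional_bound V y (\<lambda>u. s * l u) (\<bar>s\<bar> * M)"
  using assms unfolding functional_bound_def
  by (simp add: abs_mult mult_left_mono mult.assoc)

lemma functional_bound_g: "y \<in> G \<Longrightarrow> functional_bound V y (g y) (sqrt \<theta>)"
  by (simp add: functional_bound_def abs_g_le)

end

lemma directions_affine:
  assumes "affine S" "S \<noteq> {}"
  shows "subspace (directions S)"
    and "\<And>y v. y \<in> S \<Longrightarrow> v \<in> directions S \<Longrightarrow> y + v \<in> S"
    and "\<And>y z. y \<in> S \<Longrightarrow> z \<in> S \<Longrightarrow> z - y \<in> directions S"
proof -
  show diff: "z - y \<in> directions S" if "y \<in> S" "z \<in> S" for y z
    using that unfolding directions_def by blast
  show add: "y + v \<in> S" if "y \<in> S" "v \<in> directions S" for y v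
  proof -
    obtain a b where ab: "a \<in> S" "b \<in> S" "v = a - b"
      using \<open>v \<in> directions S\<close> unfolding directions_def by blast
    \<comment> \<open>The point \<open>y + (a - b)\<close> arises from two affine combinations: the
      midpoint of \<open>y\<close> and \<open>a\<close>, then the reflection of \<open>b\<close> in
      it.\<close>
    define c where "c = (1/2) *\<^sub>R y + (1/2) *\<^sub>R a"
    have "c \<in> S"
      using mem_affine[OF assms(1) \<open>y \<in> S\<close> ab(1), of "1/2" "1/2"] by (simp add: c_def)
    then have "2 *\<^sub>R c + (-1) *\<^sub>R b \<in> S"
      using mem_affine[OF assms(1) _ ab(2), of c 2 "-1"] by simp
    moreover have "2 *\<^sub>R c + (-1) *\<^sub>R b = y + v"
      by (simp add: c_def ab(3) scaleR_add_right)
    ultimately show ?thesis by simp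
  qed
  obtain y0 where y0: "y0 \<in> S" using assms(2) by blast
  have "directions S = {- y0 + x | x. x \<in> S}"
  proof (rule subset_antisym; rule subsetI)
    fix v assume "v \<in> directions S"
    then have "v = - y0 + (y0 + v)" "y0 + v \<in> S" using add[OF y0] by auto
    then show "v \<in> {- y0 + x | x. x \<in> S}" by blast
  next
    fix v assume "v \<in> {- y0 + x | x. x \<in> S}"
    then obtain x where "x \<in> S" "v = x - y0" by auto
    then show "v \<in> directions S" using diff[OF y0] by blast
  qed
  also have "\<dots> = (\<lambda>x. - y0 + x) ` S" by blast
  finally show "subspace (directions S)"
    using affine_diffs_subspace[OF assms(1) y0] by simp
qed

section \<open>The short-step method\<close>

text \<open>Definiteness along \<open>S\<close> and a finite spanning set for its directions make
  the Newton equation uniquely solvable although the type may be infinite-dimensional.\<close>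

locale sc_barrier_affine = sc_barrier G \<beta> g H \<theta>
  for G :: "'a::real_normed_vector set" and \<beta> g H \<theta> +
  fixes S :: "'a set" and B :: "'a set"
  assumes affine_S: "affine S" and S_nonempty: "S \<noteq> {}"
    and finite_B: "finite B" and directions_span: "directions S \<subseteq> span B"
    and H_pos_def: "y \<in> G \<Longrightarrow> v \<in> directions S \<Longrightarrow> H y v v = 0 \<Longrightarrow> v = 0"
    and param_ge_1: "1 \<le> \<theta>"
begin

abbreviation V :: "'a set" where "V \<equiv> directions S"

lemmas subspace_V = directions_affine(1)[OF affine_S S_nonempty]
lemmas add_V = directions_affine(2)[OF affine_S S_nonempty]
lemmas diff_V = directions_affine(3)[OF affine_S S_nonempty]

text \<open>Justifies the definite description in \<open>inv_hess\<close>: existence by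
  \<open>riesz_span\<close>, uniqueness by definiteness of the Hessian along
  \<open>S\<close>.\<close>

lemma inv_hess_props:
  assumes y: "y \<in> G" and l: "linear l"
  shows "inv_hess \<beta> S y l \<in> V" and "\<And>u. u \<in> V \<Longrightarrow> H y (inv_hess \<beta> S y l) u = l u"
proof -
  obtain B' where B': "finite B'" "span B' = V"
    using subspace_finite_span[OF subspace_V finite_B directions_span] .
  obtain v where v: "v \<in> V" "\<forall>u\<in>V. H y v u = l u"
    using riesz_span[OF psd_H[OF y] B'(1) _ l] H_pos_def[OF y] unfolding B'(2) by blast
  have "w = v" if "w \<in> V" "\<forall>u\<in>V. H y w u = l u" for w
  proof -
    have d: "w - v \<in> V" using that(1) v(1) subspace_V by (simp add: subspace_diff)
    then have "H y (w - v) (w - v) = 0"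
      using v(2) that(2) by (simp add: bilinear_lsub[OF psd_form_bilinear[OF psd_H[OF y]]])
    then show ?thesis using H_pos_def[OF y d] by simp
  qed
  then have "\<exists>!v. v \<in> V \<and> (\<forall>u\<in>V. H y v u = l u)"
    using v by blast
  from theI'[OF this] show "inv_hess \<beta> S y l \<in> V"
    "\<And>u. u \<in> V \<Longrightarrow> H y (inv_hess \<beta> S y l) u = l u"
    unfolding inv_hess_def by (simp_all add: hess_eq[OF y])
qed

lemma inv_hess_bound:
  assumes y: "y \<in> G" and l: "linear l"
  shows "functional_bound V y l (nrm y (inv_hess \<beta> S y l))"
  using inv_hess_props[OF assms] psd_form_cauchy_sqrt[OF psd_H[OF y]]
  by (metis functional_boundI)

text \<open>Testing the bound on the solution \<open>v\<close> itself gives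
  \<open>(nrm y v)^2 = l v \<le> M * nrm y v\<close>. Together with \<open>inv_hess_bound\<close>,
  the local norm of \<open>inv_hess \<beta> S y l\<close> is the dual norm of
  \<open>l\<close>.\<close>

lemma nrm_inv_hess_le:
  assumes y: "y \<in> G" and l: "linear l" and bd: "functional_bound V y l M" and "0 \<le> M"
  shows "nrm y (inv_hess \<beta> S y l) \<le> M"
proof -
  define v where "v = inv_hess \<beta> S y l"
  have "(nrm y v)\<^sup>2 = l v"
    unfolding nrm_square[OF y] v_def by (rule inv_hess_props(2)[OF y l inv_hess_props(1)[OF y l]])
  also have "\<dots> \<le> M * nrm y v"
    using functional_boundD[OF bd, of v] inv_hess_props(1)[OF y l] by (simp add: v_def)
  finally have "nrm y v * nrm y v \<le> M * nrm y v" by (simp add: power2_eq_square)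
  then show ?thesis
    using \<open>0 \<le> M\<close> nrm_nonneg[OF y, of v]
    by (fold v_def) (metis less_eq_real_def mult_le_cancel_right not_less)
qed

lemma linear_newton:
  assumes "y \<in> G" "linear p"
  shows "linear (\<lambda>u. - (\<eta> * p u + grad \<beta> y u))"
  using linear_add[OF assms(2)] linear_scale[OF assms(2)]
    linear_add[OF linear_g[OF assms(1)]] linear_scale[OF linear_g[OF assms(1)]]
  by (intro linearI) (simp_all add: grad_eq[OF assms(1)] algebra_simps)

text \<open>The new residual is the integral over the step of the change of the Hessian, applied to
  the step and \<open>u\<close>. Along the step the Hessians differ by at most the relative amount
  \<open>1 / (1 - s * \<rho>)^2 - 1\<close>, which integrates to
  \<open>\<rho>^2 / (1 - \<rho>)\<close> in the old local norm.\<close>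

lemma newton_contraction:
  assumes y: "y \<in> G" "y \<in> S" and p: "linear p"
    and bd: "functional_bound V y (\<lambda>u. \<eta> * p u + g y u) lam" and lam: "0 \<le> lam" "lam < 1"
  defines "y' \<equiv> y + newton_step \<beta> S p \<eta> y"
  shows "y' \<in> G" and "y' \<in> S"
    and "functional_bound V y' (\<lambda>u. \<eta> * p u + g y' u) ((lam / (1 - lam))\<^sup>2)"
proof -
  define n where "n = newton_step \<beta> S p \<eta> y"
  define \<rho> where "\<rho> = nrm y n"
  note lin = linear_newton[OF y(1) p, of \<eta>]
  have nV: "n \<in> V"
    unfolding n_def newton_step_def by (rule inv_hess_props(1)[OF y(1) lin])
  have Hn: "H y n u = - (\<eta> * p u + g y u)" if "u \<in> V" for u
    unfolding n_def newton_step_def using inv_hess_props(2)[OF y(1) lin that]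
    by (simp add: grad_eq[OF y(1)])
  have "functional_bound V y (\<lambda>u. - (\<eta> * p u + grad \<beta> y u)) lam"
    using functional_bound_scale[OF bd, of "- 1"] by (simp add: grad_eq[OF y(1)] algebra_simps)
  then have "\<rho> \<le> lam"
    unfolding \<rho>_def n_def newton_step_def using lam by (intro nrm_inv_hess_le[OF y(1) lin])
  then have \<rho>: "0 \<le> \<rho>" "\<rho> \<le> lam" "\<rho> < 1"
    using lam nrm_nonneg[OF y(1), of n] unfolding \<rho>_def by linarith+
  have y': "y' = y + n" by (simp add: y'_def n_def)
  have seg: "y + s *\<^sub>R n \<in> G" "s * \<rho> < 1"
    "(1 - s * \<rho>)\<^sup>2 * H y h h \<le> H (y + s *\<^sub>R n) h h"
    "(1 - s * \<rho>)\<^sup>2 * H (y + s *\<^sub>R n) h h \<le> H y h h" if "0 \<le> s" "s \<le> 1" for s h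
  proof -
    have "s * \<rho> \<le> 1 * \<rho>" using that \<rho> by (intro mult_right_mono) auto
    then show s: "s * \<rho> < 1" using \<rho> by simp
    from segment_dikin[OF y(1) that(1) this[unfolded \<rho>_def]] show "y + s *\<^sub>R n \<in> G"
      "(1 - s * \<rho>)\<^sup>2 * H y h h \<le> H (y + s *\<^sub>R n) h h"
      "(1 - s * \<rho>)\<^sup>2 * H (y + s *\<^sub>R n) h h \<le> H y h h"
      unfolding \<rho>_def by auto
  qed
  show y'G: "y' \<in> G" using seg(1)[of 1] by (simp add: y')
  show "y' \<in> S" unfolding y' by (rule add_V[OF y(2) nV])
  show "functional_bound V y' (\<lambda>u. \<eta> * p u + g y' u) ((lam / (1 - lam))\<^sup>2)"
  proof (rule functional_boundI)
    fix u assume u: "u \<in> V"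
    have main: "\<bar>\<eta> * p u + g y' u\<bar> \<le> \<rho>\<^sup>2 / (1 - \<rho>) * nrm y u"
    proof (cases "n = 0 \<or> u = 0")
      case True
      then show ?thesis
      proof
        assume "n = 0"
        then have "\<eta> * p u + g y' u = 0"
          using Hn[OF u] by (simp add: y' bilinear_lzero[OF psd_form_bilinear[OF psd_H[OF y(1)]]])
        then show ?thesis using \<rho> nrm_nonneg[OF y(1)] by simp
      next
        assume "u = 0"
        then show ?thesis
          using linear_0[OF p] linear_0[OF linear_g[OF y'G]]
          by (simp add: bilinear_lzero[OF psd_form_bilinear[OF psd_H[OF y(1)]]])
      qed
    next
      case False
      \<comment> \<open>Strict positivity is what \<open>dominated_form_cauchy\<close> demands; the
        zero vectors were split off for this.\<close>
      have pos: "0 < H y n n" "0 < H y u u"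
        using H_pos_def[OF y(1)] nV u False psd_form_nonneg[OF psd_H[OF y(1)]]
        by (metis less_eq_real_def)+
      define \<nu> where "\<nu> = nrm y u"
      define f where "f s = g (y + s *\<^sub>R n) u - s * H y n u" for s
      \<comment> \<open>Antiderivative of
        \<open>(1 / (1 - s * \<rho>)^2 - 1) * (\<rho> * \<nu>)\<close>; its increment over the unit
        interval is \<open>\<rho>^2 / (1 - \<rho>) * \<nu>\<close>.\<close>
      define W where "W s = (1 / (1 - s * \<rho>) - s * \<rho>) * \<nu>" for s
      have "\<bar>f 1 - f 0\<bar> \<le> W 1 - W 0"
      proof (rule abs_deriv_bound[where f' = "\<lambda>s. H (y + s *\<^sub>R n) n u - H y n u"
            and W' = "\<lambda>s. (1 / (1 - s * \<rho>)\<^sup>2 - 1) * (\<rho> * \<nu>)"])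
        fix s :: real assume s: "0 \<le> s" "s \<le> 1"
        note sg = seg[OF s]
        show "(f has_real_derivative H (y + s *\<^sub>R n) n u - H y n u) (at s)"
          unfolding f_def
          by (auto intro!: derivative_eq_intros deriv_g_line sg(1))
        show "(W has_real_derivative (1 / (1 - s * \<rho>)\<^sup>2 - 1) * (\<rho> * \<nu>)) (at s)"
        proof -
          have d: "((\<lambda>s. s * \<rho>) has_real_derivative \<rho>) (at s)"
            by (auto intro!: derivative_eq_intros)
          then have "((\<lambda>s. 1 - s * \<rho>) has_real_derivative - \<rho>) (at s)"
            by (auto intro!: derivative_eq_intros)
          then have "((\<lambda>s. inverse (1 - s * \<rho>)) has_real_derivative
              - (inverse (1 - s * \<rho>) * - \<rho> * inverse (1 - s * \<rho>))) (at s)"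
            using sg(2) by (intro DERIV_inverse') auto
          from DERIV_cmult_right[OF DERIV_diff[OF this d], of \<nu>] show ?thesis
            unfolding W_def inverse_eq_divide
            by (rule DERIV_cong) (use sg(2) in \<open>simp add: field_simps power2_eq_square\<close>)
        qed
        define q where "q = (1 - s * \<rho>)\<^sup>2"
        have q: "0 < q" "q \<le> 1"
          using sg(2) s \<rho> by (auto simp: q_def power_le_one)
        show "\<bar>H (y + s *\<^sub>R n) n u - H y n u\<bar> \<le> (1 / (1 - s * \<rho>)\<^sup>2 - 1) * (\<rho> * \<nu>)"
          unfolding q_def[symmetric]
        proof -
          have bil: "bilinear (\<lambda>a b. H (y + s *\<^sub>R n) a b - H y a b)"
            using psd_form_bilinear[OF psd_H[OF sg(1)]] psd_form_bilinear[OF psd_H[OF y(1)]]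
            unfolding bilinear_def by (auto intro: linear_compose_sub)
          have "\<bar>H (y + s *\<^sub>R n) h h - H y h h\<bar> \<le> (1 / q - 1) * H y h h" for h
          proof -
            have nn: "0 \<le> H y h h" by (rule psd_form_nonneg[OF psd_H[OF y(1)]])
            have "H (y + s *\<^sub>R n) h h \<le> H y h h / q"
              using sg(4)[of h, folded q_def] q by (simp add: field_simps)
            moreover have "q * H y h h \<le> H (y + s *\<^sub>R n) h h"
              using sg(3)[of h] by (simp add: q_def)
            \<comment> \<open>The Hessian may also shrink, down to the factor \<open>q\<close>; this
              deviation is the smaller one, so a single constant covers both signs.\<close>
            moreover have "1 - q \<le> 1 / q - 1"
            proof -
              have "0 \<le> (1 - q)\<^sup>2 / q" using q by simp
              then show ?thesis using q by (simp add: field_simps power2_eq_square)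
            qed
            then have "(1 - q) * H y h h \<le> (1 / q - 1) * H y h h"
              using nn by (rule mult_right_mono)
            ultimately show ?thesis by (simp add: algebra_simps abs_le_iff)
          qed
          from dominated_form_cauchy[OF psd_H[OF y(1)] bil _ this pos]
            psd_form_sym[OF psd_H[OF y(1)]] psd_form_sym[OF psd_H[OF sg(1)]]
          show "\<bar>H (y + s *\<^sub>R n) n u - H y n u\<bar> \<le> (1 / q - 1) * (\<rho> * \<nu>)"
            unfolding \<rho>_def \<nu>_def by metis
        qed
      qed simp
      moreover have "f 1 - f 0 = \<eta> * p u + g y' u"
        using Hn[OF u] by (simp add: f_def y')
      moreover have "W 1 - W 0 = \<rho>\<^sup>2 / (1 - \<rho>) * \<nu>"
        using \<rho> by (simp add: W_def field_simps power2_eq_square)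
      ultimately show ?thesis by (simp add: \<nu>_def)
    qed
    \<comment> \<open>Passing to the local norm at \<open>y'\<close> costs a second factor
      \<open>1 / (1 - \<rho>)\<close>.\<close>
    have "((1 - \<rho>) * nrm y u)\<^sup>2 \<le> (nrm y' u)\<^sup>2"
      using seg(3)[of 1 u] nrm_square[OF y(1)] nrm_square[OF y'G]
      by (simp add: y' power_mult_distrib)
    then have "(1 - \<rho>) * nrm y u \<le> nrm y' u"
      using nrm_nonneg[OF y'G] by (rule power2_le_imp_le)
    then have "\<rho>\<^sup>2 / (1 - \<rho>)\<^sup>2 * ((1 - \<rho>) * nrm y u) \<le> \<rho>\<^sup>2 / (1 - \<rho>)\<^sup>2 * nrm y' u"
      by (intro mult_left_mono) auto
    moreover have "a / q\<^sup>2 * (q * x) = a / q * x" if "q \<noteq> 0" for a q x :: real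
      using that by (simp add: power2_eq_square)
    from this[of "1 - \<rho>"] \<rho>
    have "\<rho>\<^sup>2 / (1 - \<rho>)\<^sup>2 * ((1 - \<rho>) * nrm y u) = \<rho>\<^sup>2 / (1 - \<rho>) * nrm y u"
      by simp
    ultimately have "\<bar>\<eta> * p u + g y' u\<bar> \<le> (\<rho> / (1 - \<rho>))\<^sup>2 * nrm y' u"
      using main by (simp add: power_divide)
    also have "\<dots> \<le> (lam / (1 - lam))\<^sup>2 * nrm y' u"
      using \<rho> lam nrm_nonneg[OF y'G]
      by (intro mult_right_mono power_mono frac_le) auto
    finally show "\<bar>\<eta> * p u + g y' u\<bar> \<le> (lam / (1 - lam))\<^sup>2 * nrm y' u" .
  qed
qed

text \<open>The tolerance \<open>1/9\<close> of the path is the coefficient of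
  \<open>nrm y h\<close> in \<open>g_plus_nrm_le\<close>, so the error of the approximately centred
  point is absorbed there.\<close>

lemma objective_gap:
  assumes y: "y \<in> G" "y \<in> S" and v: "v \<in> G" "v \<in> S" and c: "linear c"
    and bd: "functional_bound V y (\<lambda>u. \<eta> * c u + g y u) (1 / 9)"
  shows "\<eta> * (c y - c v) \<le> 2 * \<theta>"
proof -
  define h where "h = v - y"
  have "h \<in> V" "y + h \<in> G" using diff_V[OF y(2) v(2)] v by (auto simp: h_def)
  then have "g y h + nrm y h / 9 \<le> 2 * \<theta>" "\<bar>\<eta> * c h + g y h\<bar> \<le> 1 / 9 * nrm y h"
    using g_plus_nrm_le[OF y(1) _ param_ge_1] functional_boundD[OF bd] by auto
  moreover have "\<eta> * (c y - c v) = - (\<eta> * c h)"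
    by (simp add: h_def linear_diff[OF c] algebra_simps)
  ultimately show ?thesis by linarith
qed

text \<open>The point \<open>y + u / (2 * nrm y u)\<close> lies inside the Dikin ellipsoid, hence in
  the domain, and there \<open>l\<close> has changed by at most \<open>M\<close>. This makes a
  global variation into a dual norm bound uniform in \<open>y\<close>.\<close>

lemma functional_bound_of_range:
  assumes y: "y \<in> G" "y \<in> S" and l: "linear l"
    and range: "\<And>u v. u \<in> G \<inter> S \<Longrightarrow> v \<in> G \<inter> S \<Longrightarrow> \<bar>l (u - v)\<bar> \<le> M"
  shows "functional_bound V y l (2 * M)"
proof (rule functional_boundI)
  fix u assume u: "u \<in> V"
  show "\<bar>l u\<bar> \<le> 2 * M * nrm y u"
  proof (cases "nrm y u = 0")
    case True
    then have "u = 0" using H_pos_def[OF y(1) u] by simp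
    then show ?thesis
      using linear_0[OF l] True by simp
  next
    case False
    then have pos: "0 < nrm y u" using nrm_nonneg[OF y(1), of u] by linarith
    define s where "s = 1 / (2 * nrm y u)"
    define d where "d = s *\<^sub>R u"
    have s: "0 < s" "s * nrm y u = 1 / 2" using pos by (auto simp: s_def)
    have "y + d \<in> G" unfolding d_def using segment_dikin(1)[OF y(1), of s u] s by simp
    moreover have "y + d \<in> S"
      unfolding d_def using add_V[OF y(2)] subspace_scale[OF subspace_V u] by blast
    ultimately have "\<bar>l ((y + d) - y)\<bar> \<le> M"
      using y by (intro range) auto
    then have "s * \<bar>l u\<bar> \<le> M"
      using s(1) linear_scale[OF l] by (simp add: d_def abs_mult)
    then show ?thesis
      using pos by (simp add: s_def field_simps)
  qed
qed

section \<open>Following the path: the common invariant and the two phases\<close>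

lemma path_parameter_bounds:
  defines "\<tau> \<equiv> 1 / (8 * sqrt \<theta>)"
  shows "0 < \<tau>" "\<tau> \<le> 1 / 8" "\<tau> * sqrt \<theta> = 1 / 8"
proof -
  have "1 \<le> sqrt \<theta>" using param_ge_1 by simp
  then show "0 < \<tau>" "\<tau> \<le> 1 / 8" "\<tau> * sqrt \<theta> = 1 / 8"
    unfolding \<tau>_def using param_ge_1 by (auto simp: field_simps)
qed

text \<open>The constants \<open>1/9\<close> and \<open>8\<close> fit together: writing
  \<open>r * \<eta> * p + g\<close> as \<open>r * (\<eta> * p + g) + (1 - r) * g\<close> and using
  that \<open>g\<close> has dual norm at most \<open>sqrt \<theta>\<close>, the error before the
  step is at most \<open>9/8 * 1/9 + 1/8 = 1/4\<close>, and the Newton step maps \<open>1/4\<close>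
  to \<open>(1/3)^2 = 1/9\<close>.\<close>

lemma path_iterates:
  assumes y: "y \<in> G" "y \<in> S" and p: "linear p"
    and bd: "functional_bound V y (\<lambda>u. \<eta> * p u + g y u) (1 / 9)"
    and r: "\<bar>1 - r\<bar> = 1 / (8 * sqrt \<theta>)" "0 < r"
  defines "it \<equiv> \<lambda>k. (path_step \<beta> S p r ^^ k) (y, \<eta>)"
  shows "fst (it k) \<in> G \<and> fst (it k) \<in> S \<and> snd (it k) = r ^ k * \<eta> \<and>
    functional_bound V (fst (it k)) (\<lambda>u. r ^ k * \<eta> * p u + g (fst (it k)) u) (1 / 9)"
proof (induction k)
  case 0
  then show ?case using y bd by (simp add: it_def)
next
  case (Suc k)
  define z e where "z = fst (it k)" and "e = r ^ k * \<eta>"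
  have z: "z \<in> G" "z \<in> S" and itk: "it k = (z, e)"
    and bdz: "functional_bound V z (\<lambda>u. e * p u + g z u) (1 / 9)"
    using Suc by (auto simp: z_def e_def prod_eq_iff)
  have it: "it (Suc k) = (z + newton_step \<beta> S p (r * e) z, r * e)"
    using itk by (simp add: it_def path_step_def)
  have "functional_bound V z (\<lambda>u. r * (e * p u + g z u) + (1 - r) * g z u)
      (\<bar>r\<bar> * (1 / 9) + \<bar>1 - r\<bar> * sqrt \<theta>)"
    by (intro functional_bound_add functional_bound_scale bdz functional_bound_g z)
  moreover have "\<bar>r\<bar> * (1 / 9) + \<bar>1 - r\<bar> * sqrt \<theta> \<le> 1 / 4"
  proof -
    have "\<bar>1 - r\<bar> * sqrt \<theta> = 1 / 8" "\<bar>1 - r\<bar> \<le> 1 / 8"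
      using path_parameter_bounds by (simp_all only: r(1))
    then show ?thesis using r(2) by linarith
  qed
  ultimately have "functional_bound V z (\<lambda>u. r * (e * p u + g z u) + (1 - r) * g z u) (1 / 4)"
    by (rule functional_bound_mono[OF z(1)])
  moreover have "(\<lambda>u. r * (e * p u + g z u) + (1 - r) * g z u) = (\<lambda>u. r * e * p u + g z u)"
    by (simp add: fun_eq_iff algebra_simps)
  ultimately have "functional_bound V z (\<lambda>u. r * e * p u + g z u) (1 / 4)"
    by simp
  note nc = newton_contraction[OF z p this]
  show ?case
    using nc by (simp add: it e_def power_divide mult.assoc)
qed

lemma near_centerI:
  assumes y: "y \<in> G" and bd: "functional_bound V y (g y) \<delta>" and "0 \<le> \<delta>"
  shows "near_center \<beta> S \<delta> y"
proof -
  have "functional_bound V y (\<lambda>u. - (0 * 0 + grad \<beta> y u)) \<delta>"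
    using functional_bound_scale[OF bd, of "- 1"] by (simp add: grad_eq[OF y])
  then show ?thesis
    unfolding near_center_def local_norm_eq[OF y] newton_step_def
    by (intro nrm_inv_hess_le[OF y linear_newton[OF y, of "\<lambda>_. 0" 0]] assms(3))
      (auto intro: linearI)
qed

lemma near_centerD:
  assumes y: "y \<in> G" and nc: "near_center \<beta> S \<delta> y"
  shows "functional_bound V y (g y) \<delta>"
proof -
  have lin: "linear (\<lambda>u. - (0 * 0 + grad \<beta> y u))"
    using linear_newton[OF y, of "\<lambda>_. 0" 0] by (simp add: linear_zero)
  have "functional_bound V y (\<lambda>u. - (0 * 0 + grad \<beta> y u)) \<delta>"
    using functional_bound_mono[OF y inv_hess_bound[OF y lin], of \<delta>] nc
    unfolding near_center_def local_norm_eq[OF y] newton_step_def by blast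
  from functional_bound_scale[OF this, of "- 1"] show ?thesis
    by (simp add: grad_eq[OF y])
qed

text \<open>Once \<open>\<eta> p\<close> has local norm at most \<open>\<delta> / 2\<close>, the error \<open>x\<close> before a Newton step is at most the
  error after the previous one plus \<open>\<delta> / 16\<close>, and the step maps \<open>x \<le> 1/4\<close> to at most \<open>4 x / 9\<close>; this
  recursion has the fixed point \<open>\<delta> / 20\<close>.\<close>

lemma phase1_reaches_center:
  assumes w: "w \<in> G" "w \<in> S"
    and range: "\<And>u v. u \<in> G \<inter> S \<Longrightarrow> v \<in> G \<inter> S \<Longrightarrow> \<bar>g w (u - v)\<bar> \<le> \<Gamma>"
    and \<delta>: "0 < \<delta>" "\<delta> \<le> 1 / 9"
    and I: "(1 - 1 / (8 * sqrt \<theta>)) ^ I * (4 * \<Gamma> / \<delta>) \<le> 1" and J: "(4 / 9) ^ J \<le> \<delta>"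
  shows "phase1 \<beta> S \<theta> w i \<in> G \<inter> S" and "near_center \<beta> S \<delta> (phase1 \<beta> S \<theta> w (I + J))"
proof -
  define r p where "r = 1 - 1 / (8 * sqrt \<theta>)" and "p = (\<lambda>u. - g w u)"
  define it where "it k = (path_step \<beta> S p r ^^ k) (w, 1)" for k
  have ph: "phase1 \<beta> S \<theta> w k = fst (it k)" for k
    unfolding phase1_def it_def r_def p_def by (simp add: grad_eq[OF w(1)])
  have r: "\<bar>1 - r\<bar> = 1 / (8 * sqrt \<theta>)" "0 < r" "r \<le> 1"
    using path_parameter_bounds unfolding r_def by linarith+
  have p: "linear p"
    unfolding p_def by (intro linear_compose_neg linear_g w)
  \<comment> \<open>For \<eta> equal to 1 the two gradients cancel: the start lies exactly on the
    path.\<close>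
  have "functional_bound V w (\<lambda>u. 1 * p u + g w u) (1 / 9)"
    using nrm_nonneg[OF w(1)] by (intro functional_boundI) (simp add: p_def)
  note inv = path_iterates[OF w p this r(1,2), folded it_def]
  show "phase1 \<beta> S \<theta> w i \<in> G \<inter> S" using inv by (simp add: ph)
  have \<Gamma>: "0 \<le> \<Gamma>" using range[of w w] w by auto
  \<comment> \<open>After \<open>I\<close> steps the factor \<open>r ^ I\<close> brings this bound,
    valid at every iterate, below \<open>\<delta> / 2\<close>.\<close>
  have pb: "functional_bound V y p (2 * \<Gamma>)" if "y \<in> G" "y \<in> S" for y
  proof (rule functional_bound_of_range[OF that p])
    fix u v assume "u \<in> G \<inter> S" "v \<in> G \<inter> S"
    from range[OF this] show "\<bar>p (u - v)\<bar> \<le> \<Gamma>" by (simp add: p_def)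
  qed
  have pbk: "functional_bound V (fst (it (I + j))) (\<lambda>u. r ^ (I + j) * p u) (\<delta> / 2)" for j
  proof -
    have "r ^ I * (4 * \<Gamma> / \<delta>) \<le> 1" using I by (simp only: r_def)
    then have I': "r ^ I * (2 * \<Gamma>) \<le> \<delta> / 2" using \<delta> by (simp add: field_simps)
    have "r ^ j * (r ^ I * (2 * \<Gamma>)) \<le> 1 * (\<delta> / 2)"
      using r(2,3) \<Gamma> \<delta> by (intro mult_mono I' power_le_one) auto
    then have "\<bar>r ^ (I + j)\<bar> * (2 * \<Gamma>) \<le> \<delta> / 2"
      using r(2) by (simp add: power_add mult.assoc mult.left_commute)
    then show ?thesis
      using inv[of "I + j"] functional_bound_mono[OF _ functional_bound_scale[OF pb]] by blast
  qed
  have err: "functional_bound V (fst (it (I + j))) (\<lambda>u. r ^ (I + j) * p u + g (fst (it (I + j))) u)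
      ((4 / 9) ^ j / 9 + \<delta> / 20)" for j
  proof (induction j)
    case 0
    have "functional_bound V (fst (it I)) (\<lambda>u. r ^ I * p u + g (fst (it I)) u) (1 / 9)" "fst (it I) \<in> G"
      using inv[of I] by simp_all
    from functional_bound_mono[OF this(2,1), of "1 / 9 + \<delta> / 20"] show ?case
      using \<delta> by simp
  next
    case (Suc j)
    define z e where "z = fst (it (I + j))" and "e = r ^ (I + j)"
    define x where "x = (4 / 9) ^ j / 9 + \<delta> / 20 + \<delta> / 16"
    have z: "z \<in> G" "z \<in> S" and itk: "it (I + j) = (z, e)"
      using inv[of "I + j"] by (auto simp: z_def e_def prod_eq_iff)
    have it: "it (Suc (I + j)) = (z + newton_step \<beta> S p (r * e) z, r * e)"
      using itk by (simp add: it_def path_step_def)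
    have "functional_bound V z (\<lambda>u. (e * p u + g z u) + - (1 - r) * (e * p u))
        (((4 / 9) ^ j / 9 + \<delta> / 20) + \<bar>- (1 - r)\<bar> * (\<delta> / 2))"
      unfolding z_def e_def
      by (rule functional_bound_add[OF Suc functional_bound_scale[OF pbk[of j]]])
    moreover have "((4 / 9) ^ j / 9 + \<delta> / 20) + \<bar>- (1 - r)\<bar> * (\<delta> / 2) \<le> x"
    proof -
      have "\<bar>- (1 - r)\<bar> \<le> 1 / 8" using r path_parameter_bounds by simp
      then have "\<bar>- (1 - r)\<bar> * (\<delta> / 2) \<le> 1 / 8 * (\<delta> / 2)"
        using \<delta> by (intro mult_right_mono) auto
      then show ?thesis by (simp add: x_def)
    qed
    ultimately have "functional_bound V z (\<lambda>u. (e * p u + g z u) + - (1 - r) * (e * p u)) x"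
      by (rule functional_bound_mono[OF z(1)])
    moreover have "(\<lambda>u. (e * p u + g z u) + - (1 - r) * (e * p u)) = (\<lambda>u. r * e * p u + g z u)"
      by (simp add: fun_eq_iff algebra_simps)
    ultimately have bdx: "functional_bound V z (\<lambda>u. r * e * p u + g z u) x"
      by simp
    have x: "0 \<le> x" "x \<le> 1 / 4" "x < 1"
      using \<delta> power_le_one[of "4 / 9 :: real" j] by (auto simp: x_def)
    note nc = newton_contraction[OF z p bdx x(1,3)]
    \<comment> \<open>For \<open>x \<le> 1/4\<close> the quadratic contraction is linear with factor
      \<open>16/9 * 1/4 = 4/9\<close>, and
      \<open>4/9 * (\<delta>/20 + \<delta>/16) = \<delta>/20\<close>.\<close>
    have "x / (1 - x) \<le> x / (3 / 4)"
      using x by (intro divide_left_mono) auto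
    then have "x / (1 - x) \<le> 4 / 3 * x" "0 \<le> x / (1 - x)"
      using x by simp_all
    then have "(x / (1 - x))\<^sup>2 \<le> (4 / 3 * x)\<^sup>2"
      by (intro power_mono)
    also have "\<dots> = 16 / 9 * x * x"
      by (simp add: power2_eq_square)
    also have "\<dots> \<le> 16 / 9 * x * (1 / 4)"
      using x by (intro mult_left_mono) auto
    also have "\<dots> = (4 / 9) ^ Suc j / 9 + \<delta> / 20"
      by (simp add: x_def field_simps)
    finally have le: "(x / (1 - x))\<^sup>2 \<le> (4 / 9) ^ Suc j / 9 + \<delta> / 20" .
    have "functional_bound V (fst (it (Suc (I + j))))
        (\<lambda>u. r * e * p u + g (fst (it (Suc (I + j)))) u) ((4 / 9) ^ Suc j / 9 + \<delta> / 20)"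
      unfolding it fst_conv by (rule functional_bound_mono[OF nc(1,3) le])
    then show ?case by (simp add: e_def)
  qed
  define z where "z = fst (it (I + J))"
  have z: "z \<in> G" using inv[of "I + J"] by (simp add: z_def)
  \<comment> \<open>Dropping the remaining linear term costs \<open>\<delta> / 2\<close>; the total
    \<open>\<delta>/9 + \<delta>/20 + \<delta>/2\<close> is below \<delta>.\<close>
  have "functional_bound V z (\<lambda>u. (r ^ (I + J) * p u + g z u) + (- 1) * (r ^ (I + J) * p u))
      (((4 / 9) ^ J / 9 + \<delta> / 20) + \<bar>- 1\<bar> * (\<delta> / 2))"
    unfolding z_def by (rule functional_bound_add[OF err[of J] functional_bound_scale[OF pbk[of J]]])
  then have "functional_bound V z (g z) (((4 / 9) ^ J / 9 + \<delta> / 20) + \<delta> / 2)"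
    by simp
  from functional_bound_mono[OF z this, of \<delta>] have "functional_bound V z (g z) \<delta>"
    using J \<delta> by simp
  then show "near_center \<beta> S \<delta> (phase1 \<beta> S \<theta> w (I + J))"
    unfolding ph z_def[symmetric] using \<delta> by (intro near_centerI z) auto
qed

text \<open>The initial \<eta> gives the linear term local norm exactly \<kappa>, so
  \<open>\<delta> + \<kappa> \<le> 1/9\<close> starts the invariant. As
  \<open>h \<le> 2 * M\<close>, this \<eta> is at least \<open>\<kappa> / (2 * M)\<close>, and the
  gap \<open>2 * \<theta> / \<eta>\<close> falls to \<epsilon> once the power reaches
  \<open>4 * \<theta> * M / (\<kappa> * \<epsilon>)\<close>.\<close>

lemma phase2_converges:
  assumes y: "y \<in> G" "y \<in> S" and nc: "near_center \<beta> S \<delta> y"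
    and c: "linear c" and e: "e \<in> V" "c e \<noteq> 0"
    and range: "\<And>u v. u \<in> G \<inter> S \<Longrightarrow> v \<in> G \<inter> S \<Longrightarrow> \<bar>c (u - v)\<bar> \<le> M"
    and \<kappa>: "0 < \<kappa>" "\<delta> + \<kappa> \<le> 1 / 9" and \<epsilon>: "0 < \<epsilon>"
    and K: "4 * \<theta> * M / (\<kappa> * \<epsilon>) \<le> (1 + 1 / (8 * sqrt \<theta>)) ^ K"
  shows "phase2 \<beta> S \<theta> c \<kappa> y i \<in> G \<inter> S"
    and "v \<in> G \<inter> S \<Longrightarrow> c (phase2 \<beta> S \<theta> c \<kappa> y K) \<le> c v + \<epsilon>"
proof -
  define h where "h = nrm y (inv_hess \<beta> S y c)"
  define \<eta> r where "\<eta> = \<kappa> / h" and "r = 1 + 1 / (8 * sqrt \<theta>)"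
  define it where "it k = (path_step \<beta> S c r ^^ k) (y, \<eta>)" for k
  have ph: "phase2 \<beta> S \<theta> c \<kappa> y k = fst (it k)" for k
    unfolding phase2_def it_def r_def \<eta>_def h_def by (simp add: local_norm_eq[OF y(1)])
  have r: "\<bar>1 - r\<bar> = 1 / (8 * sqrt \<theta>)" "0 < r" "1 \<le> r"
    using path_parameter_bounds unfolding r_def by linarith+
  \<comment> \<open>If \<open>h\<close> were 0, the initial \<eta> would take the default value of a
    division by zero, namely 0, and stay there; the direction \<open>e\<close> excludes
    this.\<close>
  have h0: "0 < h"
  proof -
    have "h \<noteq> 0"
    proof
      assume "h = 0"
      then have "inv_hess \<beta> S y c = 0"
        using H_pos_def[OF y(1) inv_hess_props(1)[OF y(1) c]] by (simp add: h_def)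
      then have "H y 0 e = c e"
        using inv_hess_props(2)[OF y(1) c e(1)] by simp
      then show False
        using e(2) by (simp add: bilinear_lzero[OF psd_form_bilinear[OF psd_H[OF y(1)]]])
    qed
    then show ?thesis using nrm_nonneg[OF y(1)] by (simp add: h_def less_le)
  qed
  have M: "0 \<le> M" using range[of y y] y by auto
  have hM: "h \<le> 2 * M"
    unfolding h_def using M
    by (intro nrm_inv_hess_le[OF y(1) c functional_bound_of_range[OF y c range]]) auto
  have "functional_bound V y (\<lambda>u. \<eta> * c u + g y u) (\<bar>\<eta>\<bar> * h + \<delta>)"
    unfolding h_def
    by (intro functional_bound_add functional_bound_scale inv_hess_bound near_centerD y c nc)
  moreover have "\<bar>\<eta>\<bar> * h + \<delta> \<le> 1 / 9"
    using h0 \<kappa> by (simp add: \<eta>_def)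
  ultimately have "functional_bound V y (\<lambda>u. \<eta> * c u + g y u) (1 / 9)"
    by (rule functional_bound_mono[OF y(1)])
  note inv = path_iterates[OF y c this r(1,2), folded it_def]
  show "phase2 \<beta> S \<theta> c \<kappa> y i \<in> G \<inter> S" using inv by (simp add: ph)
  assume v: "v \<in> G \<inter> S"
  define E where "E = r ^ K * \<eta>"
  have "2 * \<theta> * (2 * M) \<le> r ^ K * \<kappa> * \<epsilon>"
  proof -
    have "4 * \<theta> * M \<le> r ^ K * (\<kappa> * \<epsilon>)"
      using K[folded r_def] \<kappa> \<epsilon> by (simp only: pos_divide_le_eq mult_pos_pos)
    then show ?thesis by (simp add: mult.assoc)
  qed
  moreover have "2 * \<theta> * h \<le> 2 * \<theta> * (2 * M)"
    using hM param_nonneg by (intro mult_left_mono) auto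
  ultimately have "2 * \<theta> * h \<le> r ^ K * \<kappa> * \<epsilon>"
    by linarith
  then have E: "2 * \<theta> \<le> E * \<epsilon>"
    using h0 by (simp add: E_def \<eta>_def field_simps)
  have "0 < \<eta>" using h0 \<kappa> by (simp add: \<eta>_def)
  then have E0: "0 < E" unfolding E_def using r(2) by simp
  have "E * (c (fst (it K)) - c v) \<le> 2 * \<theta>"
    unfolding E_def using inv[of K] v by (intro objective_gap c) auto
  then have "E * (c (fst (it K)) - c v) \<le> E * \<epsilon>" using E by linarith
  then have "c (fst (it K)) - c v \<le> \<epsilon>" using E0 by simp
  then show "c (phase2 \<beta> S \<theta> c \<kappa> y K) \<le> c v + \<epsilon>" by (simp add: ph)
qed

end

text \<open>Uses \<open>1 - \<tau> \<le> exp (- \<tau>)\<close>. The maximum with 1 keeps the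
  logarithm nonnegative for every real \<open>A\<close>.\<close>

lemma power_decrease_steps:
  fixes \<tau> A :: real
  assumes "0 < \<tau>" "\<tau> \<le> 1"
  obtains I :: nat where "(1 - \<tau>) ^ I * A \<le> 1" "real I \<le> ln (max 1 A) / \<tau> + 1"
proof
  define L where "L = ln (max 1 A)"
  define I where "I = nat \<lceil>L / \<tau>\<rceil>"
  have L: "0 \<le> L" "exp L = max 1 A" by (auto simp: L_def)
  have I: "L / \<tau> \<le> real I" "real I \<le> L / \<tau> + 1"
    using L(1) assms by (auto simp: I_def of_nat_nat ceiling_le_iff le_of_int_ceiling)
  show "real (nat \<lceil>ln (max 1 A) / \<tau>\<rceil>) \<le> ln (max 1 A) / \<tau> + 1"
    using I(2) by (simp add: I_def L_def)
  have "(1 - \<tau>) ^ I \<le> exp (- \<tau>) ^ I"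
    using assms exp_ge_add_one_self[of "- \<tau>"] by (intro power_mono) auto
  also have "\<dots> = exp (- (real I * \<tau>))"
    by (simp add: exp_of_nat_mult[symmetric])
  also have "\<dots> \<le> exp (- L)"
    using I(1) assms by (simp add: field_simps)
  finally have "(1 - \<tau>) ^ I * max 1 A \<le> exp (- L) * exp L"
    unfolding L(2) by (intro mult_right_mono) auto
  then have "(1 - \<tau>) ^ I * max 1 A \<le> 1" by (simp add: exp_minus)
  moreover have "(1 - \<tau>) ^ I * A \<le> (1 - \<tau>) ^ I * max 1 A"
    using assms by (intro mult_left_mono) auto
  ultimately show "(1 - \<tau>) ^ nat \<lceil>ln (max 1 A) / \<tau>\<rceil> * A \<le> 1"
    by (simp add: I_def L_def)
qed

text \<open>For \<open>\<tau> \<le> 1\<close> the bound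
  \<open>exp (\<tau> / 2) \<le> 1 + \<tau>\<close> holds, whence the factor 2 in the count.\<close>

lemma power_increase_steps:
  fixes \<tau> A :: real
  assumes "0 < \<tau>" "\<tau> \<le> 1"
  obtains K :: nat where "A \<le> (1 + \<tau>) ^ K" "real K \<le> 2 * ln (max 1 A) / \<tau> + 1"
proof
  define L where "L = 2 * ln (max 1 A)"
  define K where "K = nat \<lceil>L / \<tau>\<rceil>"
  have L: "0 \<le> L" "exp (L / 2) = max 1 A" by (auto simp: L_def)
  have K: "L / \<tau> \<le> real K" "real K \<le> L / \<tau> + 1"
    using L(1) assms by (auto simp: K_def of_nat_nat ceiling_le_iff le_of_int_ceiling)
  show "real (nat \<lceil>2 * ln (max 1 A) / \<tau>\<rceil>) \<le> 2 * ln (max 1 A) / \<tau> + 1"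
    using K(2) by (simp add: K_def L_def)
  have "exp (\<tau> / 2) \<le> 1 + \<tau> / 2 + (\<tau> / 2)\<^sup>2"
    using assms by (intro exp_bound) auto
  also have "\<dots> \<le> 1 + \<tau>"
    using assms mult_left_mono[of \<tau> 1 \<tau>] by (simp add: power2_eq_square field_simps)
  finally have step: "exp (\<tau> / 2) \<le> 1 + \<tau>" .
  have "A \<le> exp (L / 2)" unfolding L(2) by simp
  also have "\<dots> \<le> exp (real K * (\<tau> / 2))"
    using K(1) assms by (simp add: field_simps)
  also have "\<dots> = exp (\<tau> / 2) ^ K"
    by (rule exp_of_nat_mult)
  also have "\<dots> \<le> (1 + \<tau>) ^ K"
    using step by (intro power_mono) auto
  finally show "A \<le> (1 + \<tau>) ^ nat \<lceil>2 * ln (max 1 A) / \<tau>\<rceil>"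
    by (simp add: K_def L_def)
qed

text \<open>The stopping indices are least indices satisfying each criterion; the two phase lemmas
  supply some such index with an explicit bound. Assumption \<open>dense\<close> ties the infimum
  over \<open>closure D\<close> to points where the barrier estimates apply.\<close>

theorem (in sc_barrier_affine) short_step_ipm_complexity:
  assumes w: "w \<in> G" "w \<in> S"
    and range_w: "\<And>u v. u \<in> G \<inter> S \<Longrightarrow> v \<in> G \<inter> S \<Longrightarrow> \<bar>g w (u - v)\<bar> \<le> \<Gamma>"
    and c: "linear c" and e: "e \<in> V" "c e \<noteq> 0"
    and range_c: "\<And>u v. u \<in> G \<inter> S \<Longrightarrow> v \<in> G \<inter> S \<Longrightarrow> \<bar>c (u - v)\<bar> \<le> M"
    and D: "G \<inter> S \<subseteq> D"
    and dense: "\<And>b. 0 < b \<Longrightarrow> \<exists>v\<in>G \<inter> S. c v < (INF v\<in>closure D. c v) + b"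
    and \<delta>: "0 < \<delta>" and \<kappa>: "0 < \<kappa>" "\<delta> + \<kappa> \<le> 1 / 9" and \<epsilon>: "0 < \<epsilon>" and J: "(4 / 9) ^ J \<le> \<delta>"
  obtains k y where "short_step_ipm D S \<beta> \<theta> c \<delta> \<kappa> \<epsilon> w k y" "y \<in> G \<inter> S"
    "real k \<le> 8 * sqrt \<theta> * ln (max 1 (4 * \<Gamma> / \<delta>))
      + 16 * sqrt \<theta> * ln (max 1 (4 * \<theta> * M / (\<kappa> * \<epsilon>))) + real J + 2"
proof -
  define \<tau> where "\<tau> = 1 / (8 * sqrt \<theta>)"
  have \<tau>: "0 < \<tau>" "\<tau> \<le> 1" using path_parameter_bounds unfolding \<tau>_def by linarith+
  obtain I where I: "(1 - \<tau>) ^ I * (4 * \<Gamma> / \<delta>) \<le> 1" "real I \<le> ln (max 1 (4 * \<Gamma> / \<delta>)) / \<tau> + 1"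
    using power_decrease_steps[OF \<tau>] .
  obtain K where K: "4 * \<theta> * M / (\<kappa> * \<epsilon>) \<le> (1 + \<tau>) ^ K"
    "real K \<le> 2 * ln (max 1 (4 * \<theta> * M / (\<kappa> * \<epsilon>))) / \<tau> + 1"
    using power_increase_steps[OF \<tau>] .
  have "\<delta> \<le> 1 / 9" using \<kappa> by simp
  note p1 = phase1_reaches_center[OF w range_w \<delta> this I(1)[unfolded \<tau>_def] J]
  define nc where "nc i \<longleftrightarrow> near_center \<beta> S \<delta> (phase1 \<beta> S \<theta> w i)" for i
  define k1 where "k1 = (LEAST i. nc i)"
  have "nc (I + J)" unfolding nc_def by (rule p1(2))
  then have k1: "nc k1" "k1 \<le> I + J"
    unfolding k1_def by (rule LeastI, rule Least_le)
  have k1_min: "\<not> nc i" if "i < k1" for i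
    using that unfolding k1_def by (rule not_less_Least)
  define y1 where "y1 = phase1 \<beta> S \<theta> w k1"
  have y1: "y1 \<in> G" "y1 \<in> S" "near_center \<beta> S \<delta> y1"
    using p1(1)[of k1] k1(1) by (auto simp: y1_def nc_def)
  note p2 = phase2_converges[OF y1 c e range_c \<kappa> \<epsilon> K(1)[unfolded \<tau>_def]]
  define opt where "opt = (INF v\<in>closure D. c v)"
  define good where "good i \<longleftrightarrow> c (phase2 \<beta> S \<theta> c \<kappa> y1 i) \<le> opt + \<epsilon>" for i
  define k2 where "k2 = (LEAST i. good i)"
  \<comment> \<open>The infimum may fail to be attained in the domain, so the iterate is compared
    with points of arbitrarily small excess \<open>b\<close>.\<close>
  have "good K"
    unfolding good_def
  proof (rule field_le_epsilon)
    fix b :: real assume "0 < b"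
    then obtain v where "v \<in> G \<inter> S" "c v < opt + b" using dense unfolding opt_def by blast
    then show "c (phase2 \<beta> S \<theta> c \<kappa> y1 K) \<le> opt + \<epsilon> + b"
      using p2(2)[of v] by simp
  qed
  then have k2: "good k2" "k2 \<le> K"
    unfolding k2_def by (rule LeastI, rule Least_le)
  have k2_min: "\<not> good i" if "i < k2" for i
    using that unfolding k2_def by (rule not_less_Least)
  define y where "y = phase2 \<beta> S \<theta> c \<kappa> y1 k2"
  have "short_step_ipm D S \<beta> \<theta> c \<delta> \<kappa> \<epsilon> w (k1 + k2) y"
    unfolding short_step_ipm_def
  proof (intro exI conjI allI impI)
    show "phase1 \<beta> S \<theta> w i \<in> D" for i using p1(1) D by blast
    show "phase2 \<beta> S \<theta> c \<kappa> y1 i \<in> D" for i using p2(1) D by blast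
    show "\<not> near_center \<beta> S \<delta> (phase1 \<beta> S \<theta> w i)" if "i < k1" for i
      using k1_min[OF that] by (simp add: nc_def)
    show "(INF v\<in>closure D. c v) + \<epsilon> < c (phase2 \<beta> S \<theta> c \<kappa> y1 i)" if "i < k2" for i
      using k2_min[OF that] by (simp add: good_def opt_def)
    show "c y \<le> (INF v\<in>closure D. c v) + \<epsilon>"
      using k2(1) by (simp add: good_def opt_def y_def)
  qed (rule y1_def y1(3) y_def refl)+
  moreover have "y \<in> G \<inter> S" using p2(1) by (simp add: y_def)
  moreover have "real (k1 + k2) \<le> 8 * sqrt \<theta> * ln (max 1 (4 * \<Gamma> / \<delta>))
      + 16 * sqrt \<theta> * ln (max 1 (4 * \<theta> * M / (\<kappa> * \<epsilon>))) + real J + 2"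
  proof -
    have "real (k1 + k2) \<le> real I + real J + real K" using k1(2) k2(2) by simp
    then show ?thesis using I(2) K(2) by (simp add: \<tau>_def algebra_simps)
  qed
  ultimately show thesis by (rule that)
qed

section \<open>Closure properties and elementary barriers\<close>

lemma sc_barrier_cong:
  assumes "sc_barrier G \<beta> g H \<theta>" and eq: "\<And>y. y \<in> G \<Longrightarrow> \<beta>' y = \<beta> y"
  shows "sc_barrier G \<beta>' g H \<theta>"
proof -
  interpret sc_barrier G \<beta> g H \<theta> by fact
  have "((\<lambda>s. \<beta>' (y + s *\<^sub>R v)) has_real_derivative g y v) (at 0)" if y: "y \<in> G" for y v
  proof -
    have "\<forall>\<^sub>F s in nhds 0. \<beta>' (y + s *\<^sub>R v) = \<beta> (y + s *\<^sub>R v)"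
      using eventually_in_dom[OF y, of v] by eventually_elim (rule eq)
    then show ?thesis
      using deriv_\<beta>[OF y, of v] by (subst DERIV_cong_ev[OF refl _ refl])
  qed
  then show ?thesis
    by (intro sc_barrier.intro)
      (rule convex_dom param_nonneg linear_g psd_H deriv_g g_square_le dikin H_lower H_upper
        | assumption)+
qed

text \<open>Lets the parameter be sharpened after an application of the sum rule, as for the
  interval.\<close>

lemma sc_barrier_param:
  assumes "sc_barrier G \<beta> g H \<theta>" and "0 \<le> \<theta>'"
    and "\<And>y v. y \<in> G \<Longrightarrow> (g y v)\<^sup>2 \<le> \<theta>' * H y v v"
  shows "sc_barrier G \<beta> g H \<theta>'"
proof -
  interpret sc_barrier G \<beta> g H \<theta> by fact
  show ?thesis
    by (intro sc_barrier.intro)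
      (rule convex_dom assms(2,3) linear_g psd_H deriv_\<beta> deriv_g dikin H_lower H_upper | assumption)+
qed

lemma sc_barrier_zero:
  "sc_barrier UNIV (\<lambda>_::'a::real_normed_vector. 0) (\<lambda>_ _. 0) (\<lambda>_ _ _. 0) 0"
  unfolding sc_barrier_def by (auto intro: linearI psd_formI)

text \<open>The Dikin ellipsoid of a sum lies in that of each summand, where the distortion factors
  are closer to 1. Parameters add by the Cauchy-Schwarz inequality in the plane.\<close>

lemma sc_barrier_add:
  assumes "sc_barrier G1 \<beta>1 g1 H1 \<theta>1" "sc_barrier G2 \<beta>2 g2 H2 \<theta>2"
  shows "sc_barrier (G1 \<inter> G2) (\<lambda>y. \<beta>1 y + \<beta>2 y) (\<lambda>y v. g1 y v + g2 y v)
    (\<lambda>y u v. H1 y u v + H2 y u v) (\<theta>1 + \<theta>2)"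
proof -
  interpret b1: sc_barrier G1 \<beta>1 g1 H1 \<theta>1 by fact
  interpret b2: sc_barrier G2 \<beta>2 g2 H2 \<theta>2 by fact
  show ?thesis
  proof (rule sc_barrier.intro)
    show "convex (G1 \<inter> G2)" by (intro convex_Int b1.convex_dom b2.convex_dom)
    show "0 \<le> \<theta>1 + \<theta>2" using b1.param_nonneg b2.param_nonneg by simp
    fix y assume y: "y \<in> G1 \<inter> G2"
    then have y1: "y \<in> G1" and y2: "y \<in> G2" by auto
    note p1 = b1.psd_H[OF y1] and p2 = b2.psd_H[OF y2]
    note n1 = psd_form_nonneg[OF p1] and n2 = psd_form_nonneg[OF p2]
    show "linear (\<lambda>v. g1 y v + g2 y v)"
      by (intro linear_compose_add b1.linear_g b2.linear_g y1 y2)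
    show "psd_form (\<lambda>u v. H1 y u v + H2 y u v)"
      using n1 n2 psd_form_sym[OF p1] psd_form_sym[OF p2]
      by (intro psd_formI) (simp_all add: psd_form_simps[OF p1] psd_form_simps[OF p2] algebra_simps)
    show "((\<lambda>s. \<beta>1 (y + s *\<^sub>R v) + \<beta>2 (y + s *\<^sub>R v)) has_real_derivative g1 y v + g2 y v) (at 0)" for v
      by (intro DERIV_add b1.deriv_\<beta> b2.deriv_\<beta> y1 y2)
    show "((\<lambda>s. g1 (y + s *\<^sub>R u) v + g2 (y + s *\<^sub>R u) v) has_real_derivative H1 y u v + H2 y u v) (at 0)"
      for u v
      by (intro DERIV_add b1.deriv_g b2.deriv_g y1 y2)
    show "(g1 y v + g2 y v)\<^sup>2 \<le> (\<theta>1 + \<theta>2) * (H1 y v v + H2 y v v)" for v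
    proof -
      define a b where "a = b1.nrm y v" and "b = b2.nrm y v"
      have ab: "a\<^sup>2 = H1 y v v" "b\<^sup>2 = H2 y v v"
        unfolding a_def b_def by (rule b1.nrm_square[OF y1], rule b2.nrm_square[OF y2])
      have t: "(sqrt \<theta>1)\<^sup>2 = \<theta>1" "(sqrt \<theta>2)\<^sup>2 = \<theta>2"
        using b1.param_nonneg b2.param_nonneg by auto
      have "\<bar>g1 y v + g2 y v\<bar> \<le> sqrt \<theta>1 * a + sqrt \<theta>2 * b"
        using b1.abs_g_le[OF y1, of v] b2.abs_g_le[OF y2, of v] unfolding a_def b_def by linarith
      from power_mono[OF this abs_ge_zero, of 2]
      have "(g1 y v + g2 y v)\<^sup>2 \<le> (sqrt \<theta>1 * a + sqrt \<theta>2 * b)\<^sup>2"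
        by simp
      also have "\<dots> \<le> ((sqrt \<theta>1)\<^sup>2 + (sqrt \<theta>2)\<^sup>2) * (a\<^sup>2 + b\<^sup>2)"
      proof -
        have "0 \<le> (sqrt \<theta>1 * b - sqrt \<theta>2 * a)\<^sup>2" by simp
        then show ?thesis by (simp add: power2_eq_square algebra_simps)
      qed
      finally show ?thesis unfolding ab t .
    qed
    fix d assume d: "H1 y d d + H2 y d d < 1"
    have d1: "H1 y d d < 1" "sqrt (H1 y d d) \<le> sqrt (H1 y d d + H2 y d d)"
      and d2: "H2 y d d < 1" "sqrt (H2 y d d) \<le> sqrt (H1 y d d + H2 y d d)"
      using d n1[of d] n2[of d] by auto
    define r where "r = 1 - sqrt (H1 y d d + H2 y d d)"
    have r: "0 \<le> r" "r \<le> 1 - sqrt (H1 y d d)" "r \<le> 1 - sqrt (H2 y d d)"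
      using d d1 d2 real_sqrt_le_mono[of _ 1] by (auto simp: r_def)
    show "y + d \<in> G1 \<inter> G2"
      using b1.dikin[OF y1 d1(1)] b2.dikin[OF y2 d2(1)] by simp
    then have yd: "y + d \<in> G1" "y + d \<in> G2" by auto
    fix h
    have r1: "r\<^sup>2 * H1 x h h \<le> (1 - sqrt (H1 y d d))\<^sup>2 * H1 x h h" if "x \<in> G1" for x
      using r psd_form_nonneg[OF b1.psd_H[OF that]] by (intro mult_right_mono power_mono) auto
    have r2: "r\<^sup>2 * H2 x h h \<le> (1 - sqrt (H2 y d d))\<^sup>2 * H2 x h h" if "x \<in> G2" for x
      using r psd_form_nonneg[OF b2.psd_H[OF that]] by (intro mult_right_mono power_mono) auto
    show "(1 - sqrt (H1 y d d + H2 y d d))\<^sup>2 * (H1 y h h + H2 y h h) \<le> H1 (y + d) h h + H2 (y + d) h h"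
      using order_trans[OF r1[OF y1] b1.H_lower[OF y1 d1(1)]]
        order_trans[OF r2[OF y2] b2.H_lower[OF y2 d2(1)]]
      by (simp add: r_def[symmetric] distrib_left add_mono)
    show "(1 - sqrt (H1 y d d + H2 y d d))\<^sup>2 * (H1 (y + d) h h + H2 (y + d) h h) \<le> H1 y h h + H2 y h h"
      using order_trans[OF r1[OF yd(1)] b1.H_upper[OF y1 d1(1)]]
        order_trans[OF r2[OF yd(2)] b2.H_upper[OF y2 d2(1)]]
      by (simp add: r_def[symmetric] distrib_left add_mono)
  qed
qed

lemma sc_barrier_sum:
  assumes "finite I" "\<And>i. i \<in> I \<Longrightarrow> sc_barrier (G i) (\<beta> i) (g i) (H i) (\<theta> i)"
  shows "sc_barrier (\<Inter>i\<in>I. G i) (\<lambda>y. \<Sum>i\<in>I. \<beta> i y) (\<lambda>y v. \<Sum>i\<in>I. g i y v)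
    (\<lambda>y u v. \<Sum>i\<in>I. H i y u v) (\<Sum>i\<in>I. \<theta> i)"
  using assms
proof (induction I rule: finite_induct)
  case empty
  then show ?case by (simp add: sc_barrier_zero)
next
  case (insert i I)
  then show ?case
    using sc_barrier_add[of "G i" "\<beta> i" "g i" "H i" "\<theta> i"] by simp
qed

lemma sc_barrier_affine_comp:
  assumes "sc_barrier G \<beta> g H \<theta>" and L: "linear L"
  shows "sc_barrier {y. L y + b \<in> G} (\<lambda>y. \<beta> (L y + b)) (\<lambda>y v. g (L y + b) (L v))
    (\<lambda>y u v. H (L y + b) (L u) (L v)) \<theta>"
proof -
  interpret sc_barrier G \<beta> g H \<theta> by fact
  have shift: "L (y + d) + b = L y + b + L d" for y d
    by (simp add: linear_add[OF L])
  show ?thesis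
  proof (rule sc_barrier.intro)
    show "convex {y. L y + b \<in> G}"
    proof (rule convexI)
      fix x y and u v :: real
      assume "x \<in> {y. L y + b \<in> G}" "y \<in> {y. L y + b \<in> G}" and uv: "0 \<le> u" "0 \<le> v" "u + v = 1"
      then have "u *\<^sub>R (L x + b) + v *\<^sub>R (L y + b) \<in> G"
        by (intro convexD[OF convex_dom]) auto
      moreover have "u *\<^sub>R (L x + b) + v *\<^sub>R (L y + b) = L (u *\<^sub>R x + v *\<^sub>R y) + (u + v) *\<^sub>R b"
        by (simp add: linear_add[OF L] linear_scale[OF L] algebra_simps)
      ultimately show "u *\<^sub>R x + v *\<^sub>R y \<in> {y. L y + b \<in> G}" using uv by simp
    qed
    show "0 \<le> \<theta>" by (rule param_nonneg)
    fix y assume "y \<in> {y. L y + b \<in> G}"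
    then have y: "L y + b \<in> G" by simp
    show "linear (\<lambda>v. g (L y + b) (L v))"
      using linear_compose[OF L linear_g[OF y]] by (simp add: o_def)
    show "psd_form (\<lambda>u v. H (L y + b) (L u) (L v))"
      using psd_form_nonneg[OF psd_H[OF y]] psd_form_sym[OF psd_H[OF y]]
      by (intro psd_formI)
        (simp_all add: psd_form_simps[OF psd_H[OF y]] linear_add[OF L] linear_scale[OF L])
    show "((\<lambda>s. \<beta> (L (y + s *\<^sub>R v) + b)) has_real_derivative g (L y + b) (L v)) (at 0)" for v
      using deriv_\<beta>[OF y, of "L v"] unfolding shift linear_scale[OF L] .
    show "((\<lambda>s. g (L (y + s *\<^sub>R u) + b) (L v)) has_real_derivative H (L y + b) (L u) (L v)) (at 0)" for u v
      using deriv_g[OF y, of "L u" "L v"] unfolding shift linear_scale[OF L] .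
    show "(g (L y + b) (L v))\<^sup>2 \<le> \<theta> * H (L y + b) (L v) (L v)" for v
      by (rule g_square_le[OF y])
    fix d assume d: "H (L y + b) (L d) (L d) < 1"
    show "y + d \<in> {y. L y + b \<in> G}" using dikin[OF y d] by (simp add: shift)
    show "(1 - sqrt (H (L y + b) (L d) (L d)))\<^sup>2 * H (L y + b) (L h) (L h) \<le> H (L (y + d) + b) (L h) (L h)" for h
      unfolding shift by (rule H_lower[OF y d])
    show "(1 - sqrt (H (L y + b) (L d) (L d)))\<^sup>2 * H (L (y + d) + b) (L h) (L h) \<le> H (L y + b) (L h) (L h)" for h
      unfolding shift by (rule H_upper[OF y d])
  qed
qed

lemma sc_barrier_ln: "sc_barrier {0<..} (\<lambda>s::real. - ln s) (\<lambda>s v. - (v / s)) (\<lambda>s u v. u * v / s\<^sup>2) 1"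
proof (rule sc_barrier.intro)
  fix s :: real assume "s \<in> {0<..}"
  then have s: "0 < s" by simp
  show "linear (\<lambda>v. - (v / s))" by (intro linearI) (auto simp: add_divide_distrib)
  show "psd_form (\<lambda>u v. u * v / s\<^sup>2)"
    by (intro psd_formI) (auto simp: add_divide_distrib algebra_simps)
  show "((\<lambda>x. - ln (s + x *\<^sub>R v)) has_real_derivative - (v / s)) (at 0)" for v
    using s by (auto intro!: derivative_eq_intros)
  show "((\<lambda>x. - (v / (s + x *\<^sub>R u))) has_real_derivative u * v / s\<^sup>2) (at 0)" for u v
    using s by (auto intro!: derivative_eq_intros simp: power2_eq_square)
  show "(- (v / s))\<^sup>2 \<le> 1 * (v * v / s\<^sup>2)" for v
    by (simp add: power2_eq_square)
  fix d assume "d * d / s\<^sup>2 < 1"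
  then have "(d / s)\<^sup>2 < 1" by (simp add: power2_eq_square)
  then have d: "\<bar>d\<bar> < s" using s by (simp add: abs_square_less_1)
  then show "s + d \<in> {0<..}" by auto
  have r: "sqrt (d * d / s\<^sup>2) = \<bar>d\<bar> / s"
    using s by (simp add: real_sqrt_divide)
  fix h
  have pos: "0 < s + d" using d by auto
  define q where "q = (s - \<bar>d\<bar>) / s"
  have q: "1 - sqrt (d * d / s\<^sup>2) = q" using s by (simp add: r q_def field_simps)
  have q0: "0 \<le> q" using d s by (simp add: q_def)
  \<comment> \<open>The two Hessian comparisons amount to
    \<open>(s - \<bar>d\<bar>) * (s + d) \<le> s * s\<close> and
    \<open>s - \<bar>d\<bar> \<le> s + d\<close>.\<close>
  have "0 \<le> \<bar>d\<bar> * \<bar>d\<bar>" "(s - \<bar>d\<bar>) * (s + \<bar>d\<bar>) = s * s - \<bar>d\<bar> * \<bar>d\<bar>"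
    by (simp, simp only: ring_distribs mult.commute)
  moreover have "(s - \<bar>d\<bar>) * (s + d) \<le> (s - \<bar>d\<bar>) * (s + \<bar>d\<bar>)"
    using d by (intro mult_left_mono) auto
  ultimately have "(s - \<bar>d\<bar>) * (s + d) \<le> s * s" by linarith
  then have "q / s \<le> 1 / (s + d)" using s pos by (simp add: q_def divide_simps mult.commute)
  then have "(q / s)\<^sup>2 \<le> (1 / (s + d))\<^sup>2" using q0 s by (intro power_mono) auto
  then have "(q / s)\<^sup>2 * (h * h) \<le> (1 / (s + d))\<^sup>2 * (h * h)" by (rule mult_right_mono) simp
  then show "(1 - sqrt (d * d / s\<^sup>2))\<^sup>2 * (h * h / s\<^sup>2) \<le> h * h / (s + d)\<^sup>2"
    unfolding q by (simp add: power_divide)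
  have "q / (s + d) \<le> 1 / s" using s pos d by (auto simp: q_def divide_simps)
  then have "(q / (s + d))\<^sup>2 \<le> (1 / s)\<^sup>2" using q0 pos by (intro power_mono) auto
  then have "(q / (s + d))\<^sup>2 * (h * h) \<le> (1 / s)\<^sup>2 * (h * h)" by (rule mult_right_mono) simp
  then show "(1 - sqrt (d * d / s\<^sup>2))\<^sup>2 * (h * h / (s + d)\<^sup>2) \<le> h * h / s\<^sup>2"
    unfolding q by (simp add: power_divide)
qed auto


text \<open>Factoring \<open>R^2 - x^2\<close> and adding two logarithmic barriers yields parameter
  2. It improves to 1 because the two gradient contributions have opposite signs, so the cross term
  in the square is negative or zero.\<close>

lemma sc_barrier_interval:
  "sc_barrier {x. \<bar>x\<bar> < R} (\<lambda>x::real. - ln (R\<^sup>2 - x\<^sup>2)) (\<lambda>x v. v / (R - x) - v / (R + x))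
    (\<lambda>x u v. u * v / (R - x)\<^sup>2 + u * v / (R + x)\<^sup>2) 1"
proof -
  note b1 = sc_barrier_affine_comp[OF sc_barrier_ln, of "\<lambda>x. - x" R]
  note b2 = sc_barrier_affine_comp[OF sc_barrier_ln, of "\<lambda>x. x" R]
  have "sc_barrier ({x. - x + R \<in> {0<..}} \<inter> {x. x + R \<in> {0<..}}) (\<lambda>x. - ln (- x + R) + - ln (x + R))
    (\<lambda>x v. - (- v / (- x + R)) + - (v / (x + R)))
    (\<lambda>x u v. - u * - v / (- x + R)\<^sup>2 + u * v / (x + R)\<^sup>2) (1 + 1)"
    by (intro sc_barrier_add b1 b2) (auto intro: linearI)
  moreover have "{x. - x + R \<in> {0<..}} \<inter> {x. x + R \<in> {0<..}} = {x. \<bar>x\<bar> < R}" by auto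
  moreover have "(\<lambda>x v. - (- v / (- x + R)) + - (v / (x + R))) = (\<lambda>x v. v / (R - x) - v / (R + x))"
    by (simp add: fun_eq_iff add.commute)
  moreover have "(\<lambda>x u v. - u * - v / (- x + R)\<^sup>2 + u * v / (x + R)\<^sup>2)
      = (\<lambda>x u v. u * v / (R - x)\<^sup>2 + u * v / (R + x)\<^sup>2)"
    by (simp add: fun_eq_iff add.commute)
  ultimately have b: "sc_barrier {x. \<bar>x\<bar> < R} (\<lambda>x. - ln (- x + R) + - ln (x + R))
    (\<lambda>x v. v / (R - x) - v / (R + x)) (\<lambda>x u v. u * v / (R - x)\<^sup>2 + u * v / (R + x)\<^sup>2) (1 + 1)"
    by simp
  show ?thesis
  proof (rule sc_barrier_param[OF sc_barrier_cong[OF b]])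
    fix x :: real assume "x \<in> {x. \<bar>x\<bar> < R}"
    then have x: "0 < R - x" "0 < R + x" by auto
    have "R\<^sup>2 - x\<^sup>2 = (R - x) * (R + x)" by (simp add: power2_eq_square algebra_simps)
    then show "- ln (R\<^sup>2 - x\<^sup>2) = - ln (- x + R) + - ln (x + R)"
      using x by (simp add: ln_mult add.commute)
    fix v :: real
    have "0 \<le> (v / (R - x)) * (v / (R + x))" using x by simp
    then have "(v / (R - x) - v / (R + x))\<^sup>2 \<le> (v / (R - x))\<^sup>2 + (v / (R + x))\<^sup>2"
      unfolding power2_diff by linarith
    then show "(v / (R - x) - v / (R + x))\<^sup>2 \<le> 1 * (v * v / (R - x)\<^sup>2 + v * v / (R + x)\<^sup>2)"
      by (simp add: power_divide power2_eq_square[of v])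
  qed simp
qed

section \<open>The barrier of the hypograph of the logarithm\<close>

text \<open>\<open>X\<close> and \<open>Y\<close> are the squared local norms, along a segment, of its direction and of a fixed vector:
  \<open>x = sqrt X\<close> obeys the Riccati inequality \<open>x' \<le> x\<^sup>2\<close>, so \<open>x s \<le> r / (1 - r s)\<close> for \<open>r = x 0\<close>.\<close>

lemma sc_ode_comparison:
  fixes X Y X' Y' :: "real \<Rightarrow> real"
  assumes X: "\<And>s. 0 \<le> s \<Longrightarrow> s \<le> 1 \<Longrightarrow> (X has_real_derivative X' s) (at s)"
    and Y: "\<And>s. 0 \<le> s \<Longrightarrow> s \<le> 1 \<Longrightarrow> (Y has_real_derivative Y' s) (at s)"
    and pos: "\<And>s. 0 \<le> s \<Longrightarrow> s \<le> 1 \<Longrightarrow> 0 < X s" "\<And>s. 0 \<le> s \<Longrightarrow> s \<le> 1 \<Longrightarrow> 0 \<le> Y s"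
    and X'_le: "\<And>s. 0 \<le> s \<Longrightarrow> s \<le> 1 \<Longrightarrow> \<bar>X' s\<bar> \<le> 2 * sqrt (X s) * X s"
    and Y'_le: "\<And>s. 0 \<le> s \<Longrightarrow> s \<le> 1 \<Longrightarrow> \<bar>Y' s\<bar> \<le> 2 * sqrt (X s) * Y s"
    and "X 0 < 1"
  shows "(1 - sqrt (X 0))\<^sup>2 * Y 0 \<le> Y 1" and "(1 - sqrt (X 0))\<^sup>2 * Y 1 \<le> Y 0"
proof -
  define r where "r = sqrt (X 0)"
  have r: "0 < r" "r < 1" using pos(1)[of 0] assms(7) by (auto simp: r_def)
  have rs: "0 < 1 - r * s" if "0 \<le> s" "s \<le> 1" for s
  proof -
    have "r * s \<le> r * 1" using that r by (intro mult_left_mono) auto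
    then show ?thesis using r by linarith
  qed
  have riccati: "sqrt (X s) * (1 - r * s) \<le> r" if s: "0 \<le> s" "s \<le> 1" for s
  proof -
    \<comment> \<open>The substitution \<open>1 / sqrt X\<close> linearizes the Riccati inequality:
      its slope is at most 1 in absolute value.\<close>
    have "\<bar>inverse (sqrt (X s)) - inverse (sqrt (X 0))\<bar> \<le> s - 0"
    proof (rule abs_deriv_bound[where f = "\<lambda>x. inverse (sqrt (X x))" and W' = "\<lambda>_. 1"
          and f' = "\<lambda>x. - (X' x / (2 * sqrt (X x) * X x))"])
      fix x assume "0 \<le> x" "x \<le> s"
      then have x: "0 \<le> x" "x \<le> 1" using s by auto
      have p: "0 < X x" "0 < sqrt (X x)" "sqrt (X x) * sqrt (X x) = X x" using pos(1)[OF x] by auto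
      have "((\<lambda>x. sqrt (X x)) has_real_derivative X' x * (inverse (sqrt (X x)) / 2)) (at x)"
        using DERIV_chain2[OF DERIV_real_sqrt[OF p(1)] X[OF x]] by (simp add: mult.commute)
      from DERIV_inverse'[OF this] p
      show "((\<lambda>x. inverse (sqrt (X x))) has_real_derivative - (X' x / (2 * sqrt (X x) * X x))) (at x)"
        by (auto elim!: DERIV_cong simp: field_simps)
      show "\<bar>- (X' x / (2 * sqrt (X x) * X x))\<bar> \<le> 1"
        using X'_le[OF x] p by (simp add: abs_mult)
    qed (use s in auto)
    then have "inverse r - s \<le> inverse (sqrt (X s))" by (simp add: r_def)
    then have "(inverse r - s) * (sqrt (X s) * r) \<le> inverse (sqrt (X s)) * (sqrt (X s) * r)"
      using r pos(1)[OF s] by (intro mult_right_mono) auto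
    moreover have "(inverse r - s) * (sqrt (X s) * r) = sqrt (X s) * (1 - r * s)"
      "inverse (sqrt (X s)) * (sqrt (X s) * r) = r"
      using r pos(1)[OF s] by (simp_all add: algebra_simps)
    ultimately show ?thesis by simp
  qed
  have Y'_bound: "\<bar>Y' s\<bar> * (1 - r * s) \<le> 2 * r * Y s" if s: "0 \<le> s" "s \<le> 1" for s
  proof -
    have "\<bar>Y' s\<bar> * (1 - r * s) \<le> 2 * sqrt (X s) * Y s * (1 - r * s)"
      using rs[OF s] Y'_le[OF s] by (intro mult_right_mono) auto
    also have "\<dots> = 2 * Y s * (sqrt (X s) * (1 - r * s))" by simp
    also have "\<dots> \<le> 2 * Y s * r"
      using riccati[OF s] pos(2)[OF s] by (intro mult_left_mono) auto
    finally show ?thesis by (simp add: mult.commute mult.left_commute)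
  qed
  \<comment> \<open>The extremal solutions are multiples of \<open>(1 - r * s)^2\<close> and its
    inverse; \<open>Y\<close> times the former does not increase, and \<open>Y\<close> divided by it
    does not decrease.\<close>
  have "- (Y 0 * (1 - r * 0)\<^sup>2) \<le> - (Y 1 * (1 - r * 1)\<^sup>2)"
  proof (rule DERIV_nonneg_imp_nondecreasing[where f = "\<lambda>s. - (Y s * (1 - r * s)\<^sup>2)"])
    fix s :: real assume s: "0 \<le> s" "s \<le> 1"
    have "((\<lambda>s. - (Y s * (1 - r * s)\<^sup>2)) has_real_derivative
        - (Y' s * (1 - r * s) - 2 * r * Y s) * (1 - r * s)) (at s)"
      by (auto intro!: derivative_eq_intros Y s simp: power2_eq_square algebra_simps)
    moreover have "Y' s * (1 - r * s) \<le> \<bar>Y' s\<bar> * (1 - r * s)"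
      using rs[OF s] by (intro mult_right_mono) auto
    then have "0 \<le> - (Y' s * (1 - r * s) - 2 * r * Y s)"
      using Y'_bound[OF s] by linarith
    then have "0 \<le> - (Y' s * (1 - r * s) - 2 * r * Y s) * (1 - r * s)"
      using rs[OF s] by (intro mult_nonneg_nonneg) auto
    ultimately show "\<exists>y. ((\<lambda>s. - (Y s * (1 - r * s)\<^sup>2)) has_real_derivative y) (at s) \<and> 0 \<le> y" by blast
  qed simp
  then show "(1 - sqrt (X 0))\<^sup>2 * Y 1 \<le> Y 0" by (simp add: r_def mult.commute)
  have "Y 0 * inverse ((1 - r * 0)\<^sup>2) \<le> Y 1 * inverse ((1 - r * 1)\<^sup>2)"
  proof (rule DERIV_nonneg_imp_nondecreasing[where f = "\<lambda>s. Y s * inverse ((1 - r * s)\<^sup>2)"])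
    fix s :: real assume s: "0 \<le> s" "s \<le> 1"
    have "((\<lambda>s. Y s * inverse ((1 - r * s)\<^sup>2)) has_real_derivative
        (Y' s * (1 - r * s) + 2 * r * Y s) / (1 - r * s) ^ 3) (at s)"
    proof -
      define w where "w = 1 - r * s"
      have w: "0 < w" using rs[OF s] by (simp add: w_def)
      have "((\<lambda>s. (1 - r * s)\<^sup>2) has_real_derivative - (2 * r * w)) (at s)"
        by (auto intro!: derivative_eq_intros simp: w_def algebra_simps)
      from DERIV_mult[OF Y[OF s] DERIV_inverse'[OF this]] w show ?thesis
        unfolding w_def[symmetric]
        by (auto elim!: DERIV_cong simp: field_simps power2_eq_square power3_eq_cube)
    qed
    moreover have "- \<bar>Y' s\<bar> * (1 - r * s) \<le> Y' s * (1 - r * s)"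
      using rs[OF s] by (intro mult_right_mono) auto
    then have "0 \<le> Y' s * (1 - r * s) + 2 * r * Y s"
      using Y'_bound[OF s] by linarith
    then have "0 \<le> (Y' s * (1 - r * s) + 2 * r * Y s) / (1 - r * s) ^ 3"
      using rs[OF s] by (intro divide_nonneg_nonneg) auto
    ultimately show "\<exists>y. ((\<lambda>s. Y s * inverse ((1 - r * s)\<^sup>2)) has_real_derivative y) (at s) \<and> 0 \<le> y" by blast
  qed simp
  then show "(1 - sqrt (X 0))\<^sup>2 * Y 0 \<le> Y 1"
    using r by (simp add: r_def[symmetric] field_simps)
qed

text \<open>For \<open>\<phi> (z, s) = - ln z - ln u\<close> with \<open>u = ln z + s\<close> and \<open>k = 1 / u\<close>, let \<open>p = d\<^sub>z / z\<close>, \<open>q = (d\<^sub>z / z + d\<^sub>s) / u\<close>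
  and likewise \<open>P, Q\<close> for \<open>h\<close>.  The inequality says \<open>\<bar>D\<^sup>3\<phi>[d, h, h]\<bar> \<le> 2 \<parallel>d\<parallel> \<parallel>h\<parallel>\<^sup>2\<close>.\<close>

lemma log_barrier_third_derivative:
  fixes k p q P Q :: real
  assumes "0 < k"
  shows "(p * (2 * P\<^sup>2 * (1 + k) + 2 * k * P * Q) + q * (k * P\<^sup>2 + 2 * Q\<^sup>2))\<^sup>2
    \<le> 4 * (p\<^sup>2 * (1 + k) + q\<^sup>2) * (P\<^sup>2 * (1 + k) + Q\<^sup>2)\<^sup>2"
proof -
  define A X Y where "A = 1 + k" and "X = 2 * P\<^sup>2 * A + 2 * k * P * Q" and "Y = k * P\<^sup>2 + 2 * Q\<^sup>2"
  have A: "0 < A" using assms by (simp add: A_def)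
  \<comment> \<open>Lagrange's identity for the Cauchy-Schwarz inequality with weights
    \<open>A\<close> and 1.\<close>
  have "(p\<^sup>2 * A + q\<^sup>2) * (X\<^sup>2 / A + Y\<^sup>2) - (p * X + q * Y)\<^sup>2 = A * (p * Y - q * X / A)\<^sup>2"
    using A by (simp add: field_simps power2_eq_square)
  then have "(p * X + q * Y)\<^sup>2 \<le> (p\<^sup>2 * A + q\<^sup>2) * (X\<^sup>2 / A + Y\<^sup>2)"
    using A by (metis diff_ge_0_iff_ge mult_nonneg_nonneg less_imp_le zero_le_power2)
  also have "\<dots> \<le> (p\<^sup>2 * A + q\<^sup>2) * (4 * (P\<^sup>2 * A + Q\<^sup>2)\<^sup>2)"
  proof (rule mult_left_mono)
    have "X\<^sup>2 / A = 4 * P ^ 4 * A + 8 * k * P ^ 3 * Q + 4 * P\<^sup>2 * Q\<^sup>2 * (k\<^sup>2 / A)"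
      using A by (simp add: X_def field_simps power2_eq_square power3_eq_cube power4_eq_xxxx)
    \<comment> \<open>This removes the denominator; what remains is a polynomial gap, exhibited
      below as a product of nonnegative terms.\<close>
    moreover have "k\<^sup>2 / A \<le> k"
      using A assms by (simp add: A_def field_simps power2_eq_square)
    then have "P\<^sup>2 * Q\<^sup>2 * (k\<^sup>2 / A) \<le> P\<^sup>2 * Q\<^sup>2 * k"
      by (rule mult_left_mono) simp
    moreover have "4 * (P\<^sup>2 * A + Q\<^sup>2)\<^sup>2 - (4 * P ^ 4 * A + 8 * k * P ^ 3 * Q + 4 * (P\<^sup>2 * Q\<^sup>2 * k)) - Y\<^sup>2
        = P\<^sup>2 * (8 * (Q - k * P / 2)\<^sup>2 + (4 * k + k\<^sup>2) * P\<^sup>2)"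
      by (simp add: A_def Y_def field_simps power2_eq_square power3_eq_cube power4_eq_xxxx)
    moreover have "0 \<le> P\<^sup>2 * (8 * (Q - k * P / 2)\<^sup>2 + (4 * k + k\<^sup>2) * P\<^sup>2)"
      using assms by (intro mult_nonneg_nonneg add_nonneg_nonneg) auto
    ultimately show "X\<^sup>2 / A + Y\<^sup>2 \<le> 4 * (P\<^sup>2 * A + Q\<^sup>2)\<^sup>2" by linarith
  qed (use A in auto)
  finally show ?thesis unfolding A_def X_def Y_def by (simp only: mult_ac)
qed

text \<open>For \<open>x \<ge> 0\<close> even the error \<open>x^2 / 2\<close> suffices. For
  negative \<open>x\<close> the difference of the two sides vanishes at 0 and, in
  \<open>t = - x\<close>, has derivative \<open>t^2 / (2 * (1 - t)^2)\<close>.\<close>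

lemma ln_one_plus_lower_bound:
  fixes x :: real
  assumes "\<bar>x\<bar> < 1"
  shows "x - x\<^sup>2 / (2 * (1 - \<bar>x\<bar>)) \<le> ln (1 + x)"
proof (cases "0 \<le> x")
  case True
  have "ln (1 + 0) - (0 - 0\<^sup>2 / 2) \<le> ln (1 + x) - (x - x\<^sup>2 / 2)"
  proof (rule DERIV_nonneg_imp_nondecreasing[where f = "\<lambda>t. ln (1 + t) - (t - t\<^sup>2 / 2)"])
    fix t assume "0 \<le> t" "t \<le> x"
    then have "((\<lambda>t. ln (1 + t) - (t - t\<^sup>2 / 2)) has_real_derivative t\<^sup>2 / (1 + t)) (at t)"
      by (auto intro!: derivative_eq_intros simp: field_simps power2_eq_square)
    moreover have "0 \<le> t\<^sup>2 / (1 + t)" using \<open>0 \<le> t\<close> by simp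
    ultimately show "\<exists>y. ((\<lambda>t. ln (1 + t) - (t - t\<^sup>2 / 2)) has_real_derivative y) (at t) \<and> 0 \<le> y" by blast
  qed (use True in auto)
  moreover have "x\<^sup>2 / 2 \<le> x\<^sup>2 / (2 * (1 - \<bar>x\<bar>))"
    using assms by (intro divide_left_mono) auto
  ultimately show ?thesis by simp
next
  case False
  define z where "z = - x"
  have z: "0 < z" "z < 1" using False assms by (auto simp: z_def)
  have "ln (1 - 0) + 0 + 0\<^sup>2 / (2 * (1 - 0)) \<le> ln (1 - z) + z + z\<^sup>2 / (2 * (1 - z))"
  proof (rule DERIV_nonneg_imp_nondecreasing[where f = "\<lambda>t. ln (1 - t) + t + t\<^sup>2 / (2 * (1 - t))"])
    fix t assume "0 \<le> t" "t \<le> z"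
    then have t: "0 < 1 - t" using z by simp
    have "((\<lambda>t. ln (1 - t) + t + t\<^sup>2 / (2 * (1 - t))) has_real_derivative t\<^sup>2 / (2 * (1 - t)\<^sup>2)) (at t)"
    proof -
      have "((\<lambda>t. ln (1 - t) + t) has_real_derivative - 1 / (1 - t) + 1) (at t)"
        using t by (auto intro!: derivative_eq_intros)
      moreover have "((\<lambda>t::real. t\<^sup>2) has_real_derivative 2 * t) (at t)"
        "((\<lambda>t. 2 * (1 - t)) has_real_derivative - 2) (at t)"
        by (auto intro!: derivative_eq_intros)
      then have "((\<lambda>t. t\<^sup>2 / (2 * (1 - t))) has_real_derivative
          (2 * t * (2 * (1 - t)) - t\<^sup>2 * - 2) / (2 * (1 - t) * (2 * (1 - t)))) (at t)"
        using t by (intro DERIV_divide) auto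
      ultimately show ?thesis
      proof (rule DERIV_cong[OF DERIV_add])
        define q where "q = 1 - t"
        have q: "0 < q" and tq: "t = 1 - q" using t by (auto simp: q_def)
        show "- 1 / (1 - t) + 1 + (2 * t * (2 * (1 - t)) - t\<^sup>2 * - 2) / (2 * (1 - t) * (2 * (1 - t)))
            = t\<^sup>2 / (2 * (1 - t)\<^sup>2)"
          unfolding tq using q by (simp add: field_simps power2_eq_square)
      qed
    qed
    moreover have "0 \<le> t\<^sup>2 / (2 * (1 - t)\<^sup>2)" by simp
    ultimately show "\<exists>y. ((\<lambda>t. ln (1 - t) + t + t\<^sup>2 / (2 * (1 - t))) has_real_derivative y) (at t) \<and> 0 \<le> y"
      by blast
  qed (use z in auto)
  then show ?thesis using False by (simp add: z_def)
qed

text \<open>The hypograph of the logarithm with the sign of \<open>s\<close> reversed.\<close>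

definition log_hypo :: "(real \<times> real) set" where
  "log_hypo = {y. 0 < fst y \<and> 0 < ln (fst y) + snd y}"

definition log_hypo_grad :: "real \<times> real \<Rightarrow> real \<times> real \<Rightarrow> real" where
  "log_hypo_grad y v = - (fst v / fst y) - (fst v / fst y + snd v) / (ln (fst y) + snd y)"

definition log_hypo_hess :: "real \<times> real \<Rightarrow> real \<times> real \<Rightarrow> real \<times> real \<Rightarrow> real" where
  "log_hypo_hess y v w =
     (fst v / fst y) * (fst w / fst y) * (1 + 1 / (ln (fst y) + snd y)) +
     ((fst v / fst y + snd v) / (ln (fst y) + snd y)) * ((fst w / fst y + snd w) / (ln (fst y) + snd y))"

lemma log_hypo_hess_diag:
  "log_hypo_hess y v v = (fst v / fst y)\<^sup>2 * (1 + 1 / (ln (fst y) + snd y)) +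
     ((fst v / fst y + snd v) / (ln (fst y) + snd y))\<^sup>2"
  by (simp add: log_hypo_hess_def power2_eq_square)

lemma convex_log_hypo: "convex log_hypo"
proof (rule convexI)
  fix x y :: "real \<times> real" and u v :: real
  assume x: "x \<in> log_hypo" and y: "y \<in> log_hypo" and uv: "0 \<le> u" "0 \<le> v" "u + v = 1"
  have 1: "u * ln (fst x) + v * ln (fst y) \<le> ln (u * fst x + v * fst y)"
    using ln_concave uv x y unfolding concave_on_iff by (auto simp: log_hypo_def)
  have "0 < u * a + v * b" if "0 < a" "0 < b" for a b :: real
    using convexD[of "{0<..}" a b u v] that uv by simp
  then have 2: "0 < u * (ln (fst x) + snd x) + v * (ln (fst y) + snd y)" "0 < u * fst x + v * fst y"
    using x y by (auto simp: log_hypo_def)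
  then show "u *\<^sub>R x + v *\<^sub>R y \<in> log_hypo"
    using 1 by (simp add: log_hypo_def algebra_simps)
qed

text \<open>At the shifted point \<open>ln z + s\<close> equals
  \<open>u * (1 + Q) - p + ln (1 + p)\<close>, so \<open>u * (1 + Q)\<close> has to outweigh the
  second-order loss \<open>p^2 / (2 * (1 - \<bar>p\<bar>))\<close> of the logarithm.\<close>

lemma log_hypo_dikin:
  assumes y: "y \<in> log_hypo" and d: "log_hypo_hess y d d < 1"
  shows "y + d \<in> log_hypo"
proof -
  define z u p Q where "z = fst y" and "u = ln (fst y) + snd y" and "p = fst d / fst y"
    and "Q = (fst d / fst y + snd d) / (ln (fst y) + snd y)"
  have z: "0 < z" and u: "0 < u" using y by (auto simp: log_hypo_def z_def u_def)
  have lt: "p\<^sup>2 * (1 + 1 / u) + Q\<^sup>2 < 1"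
    using d by (simp add: log_hypo_hess_diag p_def Q_def u_def)
  have "0 \<le> p\<^sup>2 / u" using u by simp
  then have "p\<^sup>2 < 1" "p\<^sup>2 / u < 1 - Q\<^sup>2 - p\<^sup>2"
    using lt by (auto simp: algebra_simps intro: le_less_trans[rotated])
  then have p: "\<bar>p\<bar> < 1" by (simp add: abs_square_less_1)
  \<comment> \<open>This square is exactly the excess of
    \<open>2 * (1 - \<bar>p\<bar>) * (1 + Q)\<close> over \<open>1 - Q^2 - p^2\<close>.\<close>
  have "0 \<le> (1 + Q - \<bar>p\<bar>)\<^sup>2" by simp
  then have "1 - Q\<^sup>2 - p\<^sup>2 \<le> 2 * (1 - \<bar>p\<bar>) * (1 + Q)"
    by (simp add: power2_eq_square algebra_simps abs_mult_self_eq)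
  then have "p\<^sup>2 / u < 2 * (1 - \<bar>p\<bar>) * (1 + Q)" using \<open>p\<^sup>2 / u < 1 - Q\<^sup>2 - p\<^sup>2\<close> by simp
  then have "p\<^sup>2 / (2 * (1 - \<bar>p\<bar>)) < (1 + Q) * u"
    using p u by (simp add: field_simps)
  then have "0 < u + u * Q - p + ln (1 + p)"
    using ln_one_plus_lower_bound[OF p] by (simp add: algebra_simps)
  moreover have "u * Q = p + snd d" using u by (simp add: Q_def p_def u_def)
  moreover have "fst y + fst d = z * (1 + p)" using z by (simp add: p_def z_def field_simps)
  moreover have "0 < 1 + p" using p by auto
  ultimately show ?thesis
    using z by (simp add: log_hypo_def ln_mult u_def z_def)
qed

text \<open>In the normalized quantities differentiation closes up: \<open>P' = - p * P\<close>,
  \<open>k' = - k * q\<close> and \<open>Q' = - k * p * P - Q * q\<close>. The third derivative is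
  therefore a polynomial in them.\<close>

lemma log_hypo_hess_deriv:
  fixes y d h :: "real \<times> real"
  defines "p \<equiv> fst d / fst y" and "k \<equiv> 1 / (ln (fst y) + snd y)"
    and "q \<equiv> (fst d / fst y + snd d) / (ln (fst y) + snd y)"
    and "P \<equiv> fst h / fst y" and "Q \<equiv> (fst h / fst y + snd h) / (ln (fst y) + snd y)"
  assumes y: "y \<in> log_hypo"
  shows "((\<lambda>s. log_hypo_hess (y + s *\<^sub>R d) h h) has_real_derivative
    - (p * (2 * P\<^sup>2 * (1 + k) + 2 * k * P * Q) + q * (k * P\<^sup>2 + 2 * Q\<^sup>2))) (at 0)"
proof -
  define Pf where "Pf s = fst h / (fst y + s * fst d)" for s
  define Kf where "Kf s = 1 / (ln (fst y + s * fst d) + (snd y + s * snd d))" for s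
  define Qf where "Qf s = (Pf s + snd h) * Kf s" for s
  have y0: "0 < fst y" "0 < ln (fst y) + snd y" using y by (auto simp: log_hypo_def)
  have dP: "(Pf has_real_derivative - p * P) (at 0)"
    unfolding Pf_def p_def P_def using y0
    by (auto intro!: derivative_eq_intros simp: field_simps power2_eq_square)
  have dK: "(Kf has_real_derivative - k * q) (at 0)"
    unfolding Kf_def k_def q_def using y0
    by (auto intro!: derivative_eq_intros simp: divide_simps)
  have at0: "Pf 0 = P" "Kf 0 = k" "Qf 0 = Q"
    by (simp_all add: Pf_def Kf_def Qf_def P_def Q_def k_def)
  have dQ: "(Qf has_real_derivative - k * p * P - Q * q) (at 0)"
  proof -
    have Q: "Q = (P + snd h) * k" by (simp add: P_def Q_def k_def)
    have "(- p * P + 0) * Kf 0 + - k * q * (Pf 0 + snd h) = - k * p * P - Q * q"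
      unfolding at0 Q by (simp add: algebra_simps)
    then show ?thesis
      using DERIV_mult[OF DERIV_add[OF dP DERIV_const[of "snd h"]] dK] unfolding Qf_def by simp
  qed
  have "(\<lambda>s. log_hypo_hess (y + s *\<^sub>R d) h h) = (\<lambda>s. (Pf s)\<^sup>2 * (1 + Kf s) + (Qf s)\<^sup>2)"
    by (simp add: fun_eq_iff log_hypo_hess_diag Pf_def Kf_def Qf_def)
  then show ?thesis
    by (auto intro!: derivative_eq_intros dP dK dQ simp: at0 power2_eq_square algebra_simps)
qed

lemma log_hypo_hess_deriv_bound:
  assumes y: "y \<in> log_hypo"
  obtains D where "((\<lambda>s. log_hypo_hess (y + s *\<^sub>R d) h h) has_real_derivative D) (at 0)"
    "\<bar>D\<bar> \<le> 2 * sqrt (log_hypo_hess y d d) * log_hypo_hess y h h"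
proof
  define p k q P Q where "p = fst d / fst y" and "k = 1 / (ln (fst y) + snd y)"
    and "q = (fst d / fst y + snd d) / (ln (fst y) + snd y)"
    and "P = fst h / fst y" and "Q = (fst h / fst y + snd h) / (ln (fst y) + snd y)"
  note defs = p_def k_def q_def P_def Q_def
  show "((\<lambda>s. log_hypo_hess (y + s *\<^sub>R d) h h) has_real_derivative
    - (p * (2 * P\<^sup>2 * (1 + k) + 2 * k * P * Q) + q * (k * P\<^sup>2 + 2 * Q\<^sup>2))) (at 0)"
    unfolding defs by (rule log_hypo_hess_deriv[OF y])
  have k: "0 < k" using y by (simp add: k_def log_hypo_def)
  have H: "log_hypo_hess y d d = p\<^sup>2 * (1 + k) + q\<^sup>2" "log_hypo_hess y h h = P\<^sup>2 * (1 + k) + Q\<^sup>2"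
    by (simp_all add: log_hypo_hess_diag defs)
  have nn: "0 \<le> P\<^sup>2 * (1 + k) + Q\<^sup>2" using k by simp
  from real_sqrt_le_mono[OF log_barrier_third_derivative[OF k, of p P Q q]]
  show "\<bar>- (p * (2 * P\<^sup>2 * (1 + k) + 2 * k * P * Q) + q * (k * P\<^sup>2 + 2 * Q\<^sup>2))\<bar>
      \<le> 2 * sqrt (log_hypo_hess y d d) * log_hypo_hess y h h"
    unfolding H real_sqrt_mult real_sqrt_abs abs_minus_cancel abs_of_nonneg[OF nn] real_sqrt_four .
qed

lemma psd_form_log_hypo_hess:
  assumes "y \<in> log_hypo"
  shows "psd_form (log_hypo_hess y)"
proof (rule psd_formI)
  have u: "0 < ln (fst y) + snd y" using assms by (simp add: log_hypo_def)
  show "0 \<le> log_hypo_hess y v v" for v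
    using u unfolding log_hypo_hess_diag by (intro add_nonneg_nonneg mult_nonneg_nonneg) auto
qed (auto simp: log_hypo_hess_def add_divide_distrib algebra_simps)

lemma log_hypo_hess_pos_def:
  assumes "y \<in> log_hypo" "log_hypo_hess y v v = 0"
  shows "v = 0"
proof -
  have y: "0 < fst y" "0 < ln (fst y) + snd y" using assms(1) by (auto simp: log_hypo_def)
  then have "0 \<le> (fst v / fst y)\<^sup>2 * (1 + 1 / (ln (fst y) + snd y))" by simp
  then have "(fst v / fst y)\<^sup>2 * (1 + 1 / (ln (fst y) + snd y)) = 0"
    "((fst v / fst y + snd v) / (ln (fst y) + snd y))\<^sup>2 = 0"
    using assms(2) zero_le_power2[of "(fst v / fst y + snd v) / (ln (fst y) + snd y)"]
    unfolding log_hypo_hess_diag by linarith+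
  moreover have "0 < 1 / (ln (fst y) + snd y)" using y by simp
  then have "1 + 1 / (ln (fst y) + snd y) \<noteq> 0" by linarith
  ultimately show ?thesis using y by (simp add: prod_eq_iff)
qed

lemma log_hypo_hess_comparison:
  assumes y: "y \<in> log_hypo" and d: "log_hypo_hess y d d < 1"
  shows "(1 - sqrt (log_hypo_hess y d d))\<^sup>2 * log_hypo_hess y h h \<le> log_hypo_hess (y + d) h h"
    and "(1 - sqrt (log_hypo_hess y d d))\<^sup>2 * log_hypo_hess (y + d) h h \<le> log_hypo_hess y h h"
proof -
  have nn: "0 \<le> log_hypo_hess x v v" if "x \<in> log_hypo" for x v
    using psd_form_nonneg[OF psd_form_log_hypo_hess[OF that]] .
  have "(1 - sqrt (log_hypo_hess y d d))\<^sup>2 * log_hypo_hess y h h \<le> log_hypo_hess (y + d) h h \<and>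
    (1 - sqrt (log_hypo_hess y d d))\<^sup>2 * log_hypo_hess (y + d) h h \<le> log_hypo_hess y h h"
  proof (cases "d = 0")
    case True
    have "log_hypo_hess y 0 0 = 0" by (simp add: log_hypo_hess_def)
    then show ?thesis using True by simp
  next
    case False
    have seg: "y + s *\<^sub>R d \<in> log_hypo" if "0 \<le> s" "s \<le> 1" for s
    proof -
      have "log_hypo_hess y (s *\<^sub>R d) (s *\<^sub>R d) = s\<^sup>2 * log_hypo_hess y d d"
        by (simp add: psd_form_simps[OF psd_form_log_hypo_hess[OF y]] power2_eq_square)
      also have "\<dots> \<le> 1 * log_hypo_hess y d d"
        using that nn[OF y] by (intro mult_right_mono) (auto simp: power_le_one)
      finally show ?thesis using d by (intro log_hypo_dikin[OF y]) simp
    qed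
    have ex: "\<exists>D. ((\<lambda>s. log_hypo_hess (y + s *\<^sub>R d) v v) has_real_derivative D) (at s) \<and>
        \<bar>D\<bar> \<le> 2 * sqrt (log_hypo_hess (y + s *\<^sub>R d) d d) * log_hypo_hess (y + s *\<^sub>R d) v v"
      if s: "0 \<le> s" "s \<le> 1" for s v
    proof -
      obtain D where D: "((\<lambda>t. log_hypo_hess (y + s *\<^sub>R d + t *\<^sub>R d) v v) has_real_derivative D) (at 0)"
        "\<bar>D\<bar> \<le> 2 * sqrt (log_hypo_hess (y + s *\<^sub>R d) d d) * log_hypo_hess (y + s *\<^sub>R d) v v"
        using log_hypo_hess_deriv_bound[OF seg[OF s]] .
      have "((\<lambda>t. log_hypo_hess (y + (t + s) *\<^sub>R d) v v) has_real_derivative D) (at 0)"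
        using D(1) by (simp add: algebra_simps)
      then show ?thesis
        using D(2) DERIV_shift[of "\<lambda>t. log_hypo_hess (y + t *\<^sub>R d) v v" D 0 s] by auto
    qed
    define E where "E v s = log_hypo_hess (y + s *\<^sub>R d) v v" for v s
    have E_eq: "E v = (\<lambda>s. log_hypo_hess (y + s *\<^sub>R d) v v)" for v
      by (simp add: E_def fun_eq_iff)
    \<comment> \<open>Derivatives are known to exist at each point separately; choice collects them
      into the functions that \<open>sc_ode_comparison\<close> takes.\<close>
    define D where "D v s = (SOME D. (E v has_real_derivative D) (at s) \<and>
        \<bar>D\<bar> \<le> 2 * sqrt (E d s) * E v s)" for v s
    have "(E v has_real_derivative D v s) (at s) \<and> \<bar>D v s\<bar> \<le> 2 * sqrt (E d s) * E v s"
      if "0 \<le> s" "s \<le> 1" for v s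
      unfolding D_def E_eq by (rule someI_ex[OF ex[OF that, of v]])
    then have D: "\<And>v s. 0 \<le> s \<Longrightarrow> s \<le> 1 \<Longrightarrow> (E v has_real_derivative D v s) (at s)"
      "\<And>v s. 0 \<le> s \<Longrightarrow> s \<le> 1 \<Longrightarrow> \<bar>D v s\<bar> \<le> 2 * sqrt (E d s) * E v s" by auto
    have E: "0 < E d s" "0 \<le> E h s" if "0 \<le> s" "s \<le> 1" for s
    proof -
      have "E d s \<noteq> 0" using log_hypo_hess_pos_def[OF seg[OF that], of d] False by (auto simp: E_def)
      then show "0 < E d s" using nn[OF seg[OF that], of d] by (simp add: E_def)
      show "0 \<le> E h s" using nn[OF seg[OF that]] by (simp add: E_def)
    qed
    have "E d 0 < 1" using d by (simp add: E_def)
    have "(1 - sqrt (E d 0))\<^sup>2 * E h 0 \<le> E h 1" "(1 - sqrt (E d 0))\<^sup>2 * E h 1 \<le> E h 0"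
      by (rule sc_ode_comparison[where X = "E d" and Y = "E h" and X' = "D d" and Y' = "D h"];
          use D E \<open>E d 0 < 1\<close> in blast)+
    then show ?thesis by (simp add: E_def)
  qed
  then show "(1 - sqrt (log_hypo_hess y d d))\<^sup>2 * log_hypo_hess y h h \<le> log_hypo_hess (y + d) h h"
    "(1 - sqrt (log_hypo_hess y d d))\<^sup>2 * log_hypo_hess (y + d) h h \<le> log_hypo_hess y h h" by auto
qed

lemma sc_barrier_log_hypo:
  "sc_barrier log_hypo (\<lambda>y. - (ln (fst y) + ln (ln (fst y) + snd y))) log_hypo_grad log_hypo_hess 2"
proof (rule sc_barrier.intro)
  show "convex log_hypo" by (rule convex_log_hypo)
  fix y :: "real \<times> real" assume y: "y \<in> log_hypo"
  then have y0: "0 < fst y" "0 < ln (fst y) + snd y" by (auto simp: log_hypo_def)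
  show "linear (log_hypo_grad y)"
    by (intro linearI) (auto simp: log_hypo_grad_def add_divide_distrib algebra_simps)
  show "psd_form (log_hypo_hess y)" by (rule psd_form_log_hypo_hess[OF y])
  show "((\<lambda>s. - (ln (fst (y + s *\<^sub>R v)) + ln (ln (fst (y + s *\<^sub>R v)) + snd (y + s *\<^sub>R v))))
      has_real_derivative log_hypo_grad y v) (at 0)" for v
    using y0 by (auto intro!: derivative_eq_intros simp: log_hypo_grad_def)
  show "((\<lambda>s. log_hypo_grad (y + s *\<^sub>R u) v) has_real_derivative log_hypo_hess y u v) (at 0)" for u v
  proof -
    define P where "P s = fst v / (fst y + s * fst u)" for s
    define U where "U s = ln (fst y + s * fst u) + (snd y + s * snd u)" for s
    have P: "(P has_real_derivative - (fst u / fst y) * (fst v / fst y)) (at 0)"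
      unfolding P_def using y0
      by (auto intro!: derivative_eq_intros simp: field_simps power2_eq_square)
    have U: "(U has_real_derivative fst u / fst y + snd u) (at 0)"
      unfolding U_def using y0 by (auto intro!: derivative_eq_intros)
    have at0: "P 0 = fst v / fst y" "U 0 = ln (fst y) + snd y" by (simp_all add: P_def U_def)
    have "(\<lambda>s. log_hypo_grad (y + s *\<^sub>R u) v) = (\<lambda>s. - P s - (P s + snd v) / U s)"
      by (simp add: fun_eq_iff log_hypo_grad_def P_def U_def)
    moreover have "((\<lambda>s. - P s - (P s + snd v) / U s) has_real_derivative
        - (- (fst u / fst y) * (fst v / fst y)) - ((- (fst u / fst y) * (fst v / fst y) + 0) * U 0
          - (P 0 + snd v) * (fst u / fst y + snd u)) / (U 0 * U 0)) (at 0)"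
      using y0(2) by (intro DERIV_diff DERIV_minus DERIV_divide DERIV_add P U DERIV_const) (simp add: at0)
    moreover have "- (- (fst u / fst y) * (fst v / fst y)) - ((- (fst u / fst y) * (fst v / fst y) + 0) * U 0
          - (P 0 + snd v) * (fst u / fst y + snd u)) / (U 0 * U 0) = log_hypo_hess y u v"
    proof -
      have eq: "- (- a * b) - ((- a * b + 0) * w - (b + d) * (a + c)) / (w * w)
          = a * b * (1 + 1 / w) + ((a + c) / w) * ((b + d) / w)" if "w \<noteq> 0" for a b c d w :: real
        using that by (simp add: field_simps)
      show ?thesis unfolding log_hypo_hess_def at0 by (rule eq) (use y0(2) in simp)
    qed
    ultimately show ?thesis by simp
  qed
  show "(log_hypo_grad y v)\<^sup>2 \<le> 2 * log_hypo_hess y v v" for v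
  proof -
    define p q where "p = fst v / fst y" and "q = (fst v / fst y + snd v) / (ln (fst y) + snd y)"
    \<comment> \<open>The parameter 2 is the constant in
      \<open>(p + q)^2 \<le> 2 * (p^2 + q^2)\<close>.\<close>
    have "0 \<le> (p - q)\<^sup>2" by simp
    then have "(- p - q)\<^sup>2 \<le> 2 * (p\<^sup>2 + q\<^sup>2)" by (simp add: power2_eq_square algebra_simps)
    also have "\<dots> \<le> 2 * (p\<^sup>2 * (1 + 1 / (ln (fst y) + snd y)) + q\<^sup>2)"
      using y0 by (simp add: distrib_left)
    finally show ?thesis
      by (simp add: log_hypo_grad_def log_hypo_hess_diag p_def q_def)
  qed
  fix d h assume d: "log_hypo_hess y d d < 1"
  show "y + d \<in> log_hypo" by (rule log_hypo_dikin[OF y d])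
  show "(1 - sqrt (log_hypo_hess y d d))\<^sup>2 * log_hypo_hess y h h \<le> log_hypo_hess (y + d) h h"
    "(1 - sqrt (log_hypo_hess y d d))\<^sup>2 * log_hypo_hess (y + d) h h \<le> log_hypo_hess y h h"
    by (rule log_hypo_hess_comparison[OF y d])+
qed simp

section \<open>Hadamard's inequality and Cramer's rule\<close>

text \<open>Matrices are plain functions of which the indices below \<open>n\<close> count; this
  confines the carrier conditions of the matrix library to the next few lemmas.\<close>

definition fdet :: "nat \<Rightarrow> (nat \<Rightarrow> nat \<Rightarrow> real) \<Rightarrow> real" where
  "fdet n a = Determinant.det (Matrix.mat n n (\<lambda>(i, j). a i j))"

definition ip :: "nat \<Rightarrow> (nat \<Rightarrow> real) \<Rightarrow> (nat \<Rightarrow> real) \<Rightarrow> real" where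
  "ip n u v = (\<Sum>k<n. u k * v k)"

lemma ip_commute: "ip n u v = ip n v u"
  by (simp add: ip_def mult.commute)

lemma ip_self_nonneg: "0 \<le> ip n u u"
  unfolding ip_def by (intro sum_nonneg) simp

lemma ip_zero_right: "ip n v v = 0 \<Longrightarrow> ip n u v = 0"
  unfolding ip_def by (subst (asm) sum_nonneg_eq_0_iff) auto

lemma fdet_mult: "fdet n a * fdet n b = fdet n (\<lambda>i j. \<Sum>k<n. a i k * b k j)"
proof -
  have "fdet n a * fdet n b
      = Determinant.det (Matrix.mat n n (\<lambda>(i, j). a i j) * Matrix.mat n n (\<lambda>(i, j). b i j))"
    unfolding fdet_def by (rule Determinant.det_mult[symmetric, of _ n]) auto
  also have "Matrix.mat n n (\<lambda>(i, j). a i j) * Matrix.mat n n (\<lambda>(i, j). b i j)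
      = Matrix.mat n n (\<lambda>(i, j). \<Sum>k<n. a i k * b k j)"
    by (rule eq_matI) (auto simp: scalar_prod_def atLeast0LessThan)
  finally show ?thesis by (simp add: fdet_def)
qed

lemma fdet_transpose: "fdet n (\<lambda>i j. a j i) = fdet n a"
proof -
  have "Matrix.mat n n (\<lambda>(i, j). a j i) = transpose_mat (Matrix.mat n n (\<lambda>(i, j). a i j))"
    by (rule eq_matI) auto
  then show ?thesis unfolding fdet_def using Determinant.det_transpose[of "Matrix.mat n n (\<lambda>(i, j). a i j)" n] by simp
qed

lemma fdet_cong: "(\<And>i j. i < n \<Longrightarrow> j < n \<Longrightarrow> a i j = b i j) \<Longrightarrow> fdet n a = fdet n b"
  unfolding fdet_def by (intro arg_cong[of _ _ Determinant.det] eq_matI) auto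

lemma fdet_lower_triangular:
  assumes "\<And>i j. i < j \<Longrightarrow> j < n \<Longrightarrow> a i j = 0"
  shows "fdet n a = (\<Prod>i<n. a i i)"
proof -
  have "fdet n a = prod_list (diag_mat (Matrix.mat n n (\<lambda>(i, j). a i j)))"
    unfolding fdet_def by (rule det_lower_triangular[of n]) (auto simp: assms)
  also have "diag_mat (Matrix.mat n n (\<lambda>(i, j). a i j)) = map (\<lambda>i. a i i) [0..<n]"
    by (auto simp: diag_mat_def)
  finally show ?thesis
    by (simp add: prod.distinct_set_conv_list[symmetric] atLeast0LessThan)
qed

function gram_schmidt :: "nat \<Rightarrow> (nat \<Rightarrow> nat \<Rightarrow> real) \<Rightarrow> nat \<Rightarrow> nat \<Rightarrow> real" where
  "gram_schmidt n a i = (\<lambda>k. a i k - (\<Sum>j<i.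
     ip n (a i) (gram_schmidt n a j) / ip n (gram_schmidt n a j) (gram_schmidt n a j) * gram_schmidt n a j k))"
  by pat_completeness auto
termination by (relation "Wellfounded.measure (\<lambda>(n, a, i). i)") auto

declare gram_schmidt.simps [simp del]

text \<open>Gram--Schmidt writes the rows as a unit lower triangular matrix times orthogonal rows of no
  larger norm.\<close>

lemma hadamard_inequality: "(fdet n a)\<^sup>2 \<le> (\<Prod>i<n. ip n (a i) (a i))"
proof -
  define g where "g = gram_schmidt n a"
  define c where "c i j = ip n (a i) (g j) / ip n (g j) (g j)" for i j
  have g: "g i = (\<lambda>k. a i k - (\<Sum>j<i. c i j * g j k))" for i
    unfolding g_def c_def by (subst gram_schmidt.simps) simp
  have ip_g: "ip n (g i) v = ip n (a i) v - (\<Sum>j<i. c i j * ip n (g j) v)" for i v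
    unfolding ip_def
    by (subst g) (simp add: left_diff_distrib sum_subtractf sum_distrib_right sum_distrib_left
        sum.swap[of _ "{..<i}"] mult.assoc)
  have orth: "ip n (g i) (g j) = 0" if "j < i" for i j
    using that
  proof (induction i arbitrary: j rule: less_induct)
    case (less i)
    have "ip n (g l) (g j) = 0" if "l < i" "l \<noteq> j" for l
    proof (cases "l < j")
      case True
      then show ?thesis using less.IH[OF less.prems True] by (simp add: ip_commute)
    next
      case False
      then show ?thesis using less.IH[OF that(1), of j] that(2) by simp
    qed
    then have "(\<Sum>l<i. c i l * ip n (g l) (g j)) = c i j * ip n (g j) (g j)"
      using less.prems by (subst sum.remove[of _ j]) auto
    \<comment> \<open>If \<open>g j\<close> is null, the coefficient is 0 by the convention for
      division, and the inner product with \<open>g j\<close> vanishes as well.\<close>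
    also have "\<dots> = ip n (a i) (g j)"
      using ip_zero_right[of n "g j" "a i"] by (simp add: c_def)
    finally show ?case by (simp add: ip_g[of i])
  qed
  have orth': "ip n (g i) (g j) = 0" if "i \<noteq> j" for i j
    using orth[of i j] orth[of j i] that by (cases "i < j") (auto simp: ip_commute[of n "g i"])
  define L where "L i j = (if j < i then c i j else if j = i then 1 else 0)" for i j :: nat
  have a_eq: "a i k = (\<Sum>j<n. L i j * g j k)" if "i < n" for i k
  proof -
    have "(\<Sum>j<n. L i j * g j k) = (\<Sum>j\<in>{..<Suc i}. L i j * g j k)"
      using that by (intro sum.mono_neutral_right) (auto simp: L_def)
    also have "\<dots> = a i k"
      by (simp add: L_def g[of i])
    finally show ?thesis ..
  qed
  have "fdet n L = 1"
    by (subst fdet_lower_triangular) (auto simp: L_def)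
  moreover have "fdet n a = fdet n (\<lambda>i j. \<Sum>k<n. L i k * g k j)"
    by (rule fdet_cong) (rule a_eq)
  ultimately have "fdet n a = fdet n g"
    using fdet_mult[of n L g] by simp
  \<comment> \<open>The square is the determinant of \<open>g\<close> times its transpose, the Gram
    matrix, which is diagonal by orthogonality.\<close>
  then have "(fdet n a)\<^sup>2 = fdet n g * fdet n (\<lambda>i j. g j i)"
    using \<open>fdet n a = fdet n g\<close> fdet_transpose[of n g] by (simp add: power2_eq_square)
  also have "\<dots> = fdet n (\<lambda>i j. ip n (g i) (g j))"
    by (simp only: fdet_mult ip_def)
  also have "\<dots> = (\<Prod>i<n. ip n (g i) (g i))"
    by (rule fdet_lower_triangular) (simp add: orth')
  also have "\<dots> \<le> (\<Prod>i<n. ip n (a i) (a i))"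
  proof (rule prod_mono, safe)
    fix i
    show "0 \<le> ip n (g i) (g i)" by (rule ip_self_nonneg)
    have "ip n (g i) (g i) = ip n (g i) (a i)"
    proof -
      have "(\<Sum>j<i. c i j * ip n (g j) (g i)) = 0" by (intro sum.neutral) (auto simp: orth')
      then show ?thesis using ip_g[of i "g i"] by (simp add: ip_commute[of n "a i"])
    qed
    also have "\<dots> = ip n (a i) (a i) - (\<Sum>j<i. c i j * ip n (g j) (a i))"
      by (rule ip_g)
    also have "\<dots> \<le> ip n (a i) (a i)"
    proof -
      have "0 \<le> c i j * ip n (g j) (a i)" for j
        using ip_self_nonneg[of n "g j"]
        by (simp add: c_def ip_commute[of n "g j" "a i"])
      then show ?thesis by (simp add: sum_nonneg)
    qed
    finally show "ip n (g i) (g i) \<le> ip n (a i) (a i)" .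
  qed
  finally show ?thesis .
qed

lemma fdet_Ints:
  assumes "\<And>i j. i < n \<Longrightarrow> j < n \<Longrightarrow> a i j \<in> \<int>"
  shows "fdet n a \<in> \<int>"
  unfolding fdet_def
proof (subst det_def'[of _ n])
  show "(\<Sum>p\<in>{p. p permutes {0..<n}}.
      signof p * (\<Prod>i=0..<n. Matrix.mat n n (\<lambda>(i, j). a i j) $$ (i, p i))) \<in> \<int>"
  proof (intro Ints_sum Ints_mult Ints_prod)
    fix p i assume "p \<in> {p. p permutes {0..<n}}" "i \<in> {0..<n}"
    then have "i < n" "p i < n" using permutes_in_image[of p "{0..<n}" i] by auto
    then show "Matrix.mat n n (\<lambda>(i, j). a i j) $$ (i, p i) \<in> \<int>" using assms by simp
  qed (simp add: sign_def)
qed simp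

lemma fdet_0_kernel:
  "fdet n a = 0 \<longleftrightarrow> (\<exists>v. (\<exists>j<n. v j \<noteq> 0) \<and> (\<forall>i<n. (\<Sum>j<n. a i j * v j) = 0))"
proof -
  define A where "A = Matrix.mat n n (\<lambda>(i, j). a i j)"
  have A: "A \<in> carrier_mat n n" by (simp add: A_def)
  have mult: "vec_index (A *\<^sub>v v) i = (\<Sum>j<n. a i j * vec_index v j)"
    if "v \<in> carrier_vec n" "i < n" for v i
    using that by (simp add: A_def scalar_prod_def atLeast0LessThan)
  have "fdet n a = 0 \<longleftrightarrow> (\<exists>v. v \<in> carrier_vec n \<and> v \<noteq> 0\<^sub>v n \<and> A *\<^sub>v v = 0\<^sub>v n)"
    unfolding fdet_def A_def[symmetric] by (rule det_0_iff_vec_prod_zero[OF A])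
  also have "\<dots> \<longleftrightarrow> (\<exists>v. (\<exists>j<n. v j \<noteq> 0) \<and> (\<forall>i<n. (\<Sum>j<n. a i j * v j) = 0))"
  proof (intro iffI; (elim exE conjE)?)
    fix v assume v: "v \<in> carrier_vec n" "v \<noteq> 0\<^sub>v n" "A *\<^sub>v v = 0\<^sub>v n"
    have "\<exists>j<n. vec_index v j \<noteq> 0"
    proof (rule ccontr)
      assume "\<not> (\<exists>j<n. vec_index v j \<noteq> 0)"
      then have "v = 0\<^sub>v n" using v(1) by (intro eq_vecI) auto
      then show False using v(2) by simp
    qed
    moreover have "(\<Sum>j<n. a i j * vec_index v j) = 0" if "i < n" for i
      using mult[OF v(1) that] v(3) that by simp
    ultimately show "\<exists>v. (\<exists>j<n. v j \<noteq> 0) \<and> (\<forall>i<n. (\<Sum>j<n. a i j * v j) = 0)" by blast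
  next
    fix v :: "nat \<Rightarrow> real" and j
    assume v: "\<forall>i<n. (\<Sum>j<n. a i j * v j) = 0" "j < n" "v j \<noteq> 0"
    define w where "w = Matrix.vec n v"
    have w: "w \<in> carrier_vec n" by (simp add: w_def)
    have "vec_index w j = v j" using v(2) by (simp add: w_def)
    then have "w \<noteq> 0\<^sub>v n" using v(2,3) by auto
    moreover have "A *\<^sub>v w = 0\<^sub>v n"
      using v(1) A mult[OF w] by (intro eq_vecI) (auto simp: w_def)
    ultimately show "\<exists>v. v \<in> carrier_vec n \<and> v \<noteq> 0\<^sub>v n \<and> A *\<^sub>v v = 0\<^sub>v n" using w by blast
  qed
  finally show ?thesis .
qed

lemma fdet_cramer:
  assumes "\<And>i. i < n \<Longrightarrow> (\<Sum>j<n. a i j * x j) = b i" and k: "k < n"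
  shows "fdet n (\<lambda>i j. if j = k then b i else a i j) = x k * fdet n a"
proof -
  define A where "A = Matrix.mat n n (\<lambda>(i, j). a i j)"
  have A: "A \<in> carrier_mat n n" by (simp add: A_def)
  have "Determinant.det (replace_col A (A *\<^sub>v Matrix.vec n x) k) = x k * Determinant.det A"
    using cramer_lemma_mat[OF A, of "Matrix.vec n x" k] k by simp
  moreover have "replace_col A (A *\<^sub>v Matrix.vec n x) k
      = Matrix.mat n n (\<lambda>(i, j). if j = k then b i else a i j)"
    using assms(1) by (intro eq_matI)
      (auto simp: replace_col_def A_def scalar_prod_def atLeast0LessThan)
  ultimately show ?thesis by (simp add: fdet_def A_def)
qed

section \<open>Vertices of the sublevel polytope\<close>

lemma lookup_scaleR: "lookup (r *\<^sub>R x) k = r * lookup x k"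
  for x :: "'a \<Rightarrow>\<^sub>0 real"
proof -
  have "finite {i. r *\<^sub>R lookup x i \<noteq> 0}"
    by (rule finite_subset[OF _ finite_keys[of x]]) (auto simp: in_keys_iff)
  then show ?thesis
    unfolding scaleR_poly_mapping_def by (simp add: lookup_Abs_poly_mapping)
qed

lemma subspace_Rn: "subspace (Rn n)"
proof (rule subspaceI)
  show "x + y \<in> Rn n" if "x \<in> Rn n" "y \<in> Rn n" for x y
    using that keys_add[of x y] by (auto simp: Rn_def)
  show "r *\<^sub>R x \<in> Rn n" if "x \<in> Rn n" for r x
    using that by (auto simp: Rn_def in_keys_iff lookup_scaleR)
qed (simp add: Rn_def)

lemma linear_dot: "linear (dot n v)"
  by (intro linearI)
    (auto simp: dot_def lookup_add lookup_scaleR distrib_left sum.distrib sum_distrib_left mult_ac)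

lemma dot_shift: "dot n v x = (\<Sum>j<n. lookup v (Suc j) * lookup x (Suc j))"
  unfolding dot_def by (rule sum.reindex_bij_witness[of _ Suc "\<lambda>k. k - 1"]) auto

lemma Rn_of_coords:
  obtains d where "d \<in> Rn n" "\<And>j. j < n \<Longrightarrow> lookup d (Suc j) = (v :: nat \<Rightarrow> real) j"
proof
  define d where "d = (\<Sum>j<n. single (Suc j) (v j))"
  have lk: "lookup d k = (\<Sum>j<n. if Suc j = k then v j else 0)" for k
    by (simp add: d_def lookup_sum lookup_single when_def)
  show "d \<in> Rn n"
  proof -
    have "k \<in> {1..n}" if "k \<in> keys d" for k
    proof (rule ccontr)
      assume "k \<notin> {1..n}"
      then have "lookup d k = 0" unfolding lk by (intro sum.neutral) auto
      then show False using that by (simp add: in_keys_iff)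
    qed
    then show ?thesis by (auto simp: Rn_def)
  qed
  show "lookup d (Suc j) = v j" if "j < n" for j
    using that unfolding lk by simp
qed

text \<open>Matrix columns are numbered from 0 and coordinates of \<open>Rn n\<close> from 1, hence
  \<open>Suc j\<close>.\<close>

definition rows_independent :: "nat \<Rightarrow> nat \<Rightarrow> (nat \<Rightarrow> rvec) \<Rightarrow> bool" where
  "rows_independent n r a \<longleftrightarrow>
     (\<forall>v. (\<forall>j<n. (\<Sum>i<r. v i * lookup (a i) (Suc j)) = 0) \<longrightarrow> (\<forall>i<r. v i = 0))"

text \<open>Moving along a direction orthogonal to the active constraints until a new one becomes active
  adds an independent active constraint; the cone condition makes sure that one is met.\<close>

lemma vertex_exists:
  fixes \<A> :: "rvec set" and \<sigma> :: real
  assumes "finite \<A>" and cone: "{x \<in> Rn n. \<forall>v\<in>\<A>. dot n v x \<le> 0} = {0}"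
    and x: "x \<in> Rn n" "\<And>v. v \<in> \<A> \<Longrightarrow> dot n v x \<le> c" and "r \<le> n"
  shows "\<exists>y a. y \<in> Rn n \<and> (\<forall>v\<in>\<A>. dot n v y \<le> c) \<and> (\<forall>i<r. a i \<in> \<A> \<and> dot n (a i) y = c) \<and>
    rows_independent n r a \<and> \<sigma> * lookup x k \<le> \<sigma> * lookup y k"
  using \<open>r \<le> n\<close>
proof (induction r)
  case 0
  then show ?case using x by (intro exI[of _ x]) (auto simp: rows_independent_def)
next
  case (Suc r)
  from Suc.IH[OF Suc_leD[OF Suc.prems]]
  obtain y a where y: "y \<in> Rn n" "\<And>v. v \<in> \<A> \<Longrightarrow> dot n v y \<le> c"
    and a: "\<And>i. i < r \<Longrightarrow> a i \<in> \<A> \<and> dot n (a i) y = c" "rows_independent n r a"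
    and le: "\<sigma> * lookup x k \<le> \<sigma> * lookup y k"
    by blast
  \<comment> \<open>The active rows are padded by zero rows to a square matrix. As
    \<open>r < n\<close>, it is singular, and a kernel vector is a direction that keeps all active
    constraints tight.\<close>
  define M where "M i j = (if i < r then lookup (a i) (Suc j) else 0)" for i j
  have "fdet n (\<lambda>i j. M j i) = 0"
    unfolding fdet_0_kernel using Suc.prems
    by (intro exI[of _ "\<lambda>j. if j = r then 1 else 0"]) (auto simp: M_def intro!: sum.neutral)
  then have "fdet n M = 0" using fdet_transpose[of n M] by simp
  then obtain w where w: "\<exists>j<n. w j \<noteq> 0" "\<And>i. i < n \<Longrightarrow> (\<Sum>j<n. M i j * w j) = 0"
    unfolding fdet_0_kernel by blast
  obtain d0 where d0: "d0 \<in> Rn n" "\<And>j. j < n \<Longrightarrow> lookup d0 (Suc j) = w j"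
    using Rn_of_coords[of n w] by blast
  \<comment> \<open>The sign is chosen so that moving along \<open>d\<close> does not decrease the
    objective \<sigma> times coordinate \<open>k\<close>.\<close>
  define d where "d = (if 0 \<le> \<sigma> * lookup d0 k then d0 else - 1 *\<^sub>R d0)"
  have "d0 \<noteq> 0" using w(1) d0(2) by auto
  then have d: "d \<in> Rn n" "d \<noteq> 0" "0 \<le> \<sigma> * lookup d k"
    using d0(1) subspace_scale[OF subspace_Rn d0(1), of "- 1"] by (auto simp: d_def lookup_scaleR)
  have "dot n (a i) d0 = 0" if "i < r" for i
    using w(2)[of i] that Suc.prems d0(2) by (simp add: dot_shift M_def)
  then have ad: "dot n (a i) d = 0" if "i < r" for i
    using that linear_scale[OF linear_dot, of n "a i" "- 1" d0] by (auto simp: d_def)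
  define P where "P = {v \<in> \<A>. 0 < dot n v d}"
  have "finite P" using assms(1) by (simp add: P_def)
  moreover have "P \<noteq> {}"
  proof
    assume "P = {}"
    then have "d \<in> {x \<in> Rn n. \<forall>v\<in>\<A>. dot n v x \<le> 0}" using d(1) by (auto simp: P_def not_less)
    then show False using d(2) unfolding cone by simp
  qed
  define \<tau> where "\<tau> v = (c - dot n v y) / dot n v d" for v
  \<comment> \<open>Ratio test: among the constraints that tighten along \<open>d\<close>, the one
    met first.\<close>
  define e where "e = arg_min_on \<tau> P"
  note arg_min_if_finite[OF \<open>finite P\<close> \<open>P \<noteq> {}\<close>, of \<tau>, folded e_def]
  then have e: "e \<in> P" "\<And>v. v \<in> P \<Longrightarrow> \<tau> e \<le> \<tau> v"
    by (auto simp: not_less)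
  define z where "z = y + \<tau> e *\<^sub>R d"
  have dz: "dot n v z = dot n v y + \<tau> e * dot n v d" for v
    by (simp add: z_def linear_add[OF linear_dot] linear_scale[OF linear_dot])
  have \<tau>0: "0 \<le> \<tau> e" using e(1) y(2) by (auto simp: \<tau>_def P_def)
  have feas: "dot n v z \<le> c" if "v \<in> \<A>" for v
  proof (cases "v \<in> P")
    case True
    then have p: "0 < dot n v d" by (simp add: P_def)
    have "\<tau> e * dot n v d \<le> \<tau> v * dot n v d"
      using e(2)[OF True] p by (intro mult_right_mono) auto
    also have "\<tau> v * dot n v d = c - dot n v y" using p by (simp add: \<tau>_def)
    finally show ?thesis by (simp add: dz)
  next
    case False
    then have "\<tau> e * dot n v d \<le> 0" using that \<tau>0 by (intro mult_nonneg_nonpos) (auto simp: P_def)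
    then show ?thesis using y(2)[OF that] by (simp add: dz)
  qed
  define a' where "a' = a(r := e)"
  have e0: "0 < dot n e d" "e \<in> \<A>" using e(1) by (auto simp: P_def)
  have "dot n e z = c" using e0 by (simp add: dz \<tau>_def)
  then have act: "a' i \<in> \<A> \<and> dot n (a' i) z = c" if "i < Suc r" for i
    using that a(1) ad e0 by (cases "i = r") (auto simp: a'_def dz)
  have "rows_independent n (Suc r) a'"
    unfolding rows_independent_def
  proof (intro allI impI)
    fix v i assume v: "\<forall>j<n. (\<Sum>i<Suc r. v i * lookup (a' i) (Suc j)) = 0" and i: "i < Suc r"
    \<comment> \<open>Pairing a linear relation with \<open>d\<close> annihilates all old rows and
      isolates the coefficient of the new one.\<close>
    have "0 = (\<Sum>j<n. (\<Sum>i<Suc r. v i * lookup (a' i) (Suc j)) * lookup d (Suc j))"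
      using v by simp
    also have "\<dots> = (\<Sum>i<Suc r. v i * dot n (a' i) d)"
      unfolding dot_shift sum_distrib_left sum_distrib_right
      by (subst sum.swap) (simp add: mult.assoc)
    also have "\<dots> = v r * dot n e d"
      using ad by (simp add: a'_def)
    finally have vr: "v r = 0" using e0 by simp
    have "\<forall>j<n. (\<Sum>i<r. v i * lookup (a i) (Suc j)) = 0"
      using v vr by (simp add: a'_def)
    then have "\<forall>i<r. v i = 0" using a(2) unfolding rows_independent_def by blast
    then show "v i = 0" using vr i by (auto simp: less_Suc_eq)
  qed
  moreover have "z \<in> Rn n"
    unfolding z_def by (intro subspace_add subspace_scale subspace_Rn y d)
  moreover have "\<sigma> * lookup x k \<le> \<sigma> * lookup z k"
  proof -
    have "0 \<le> \<tau> e * (\<sigma> * lookup d k)" using \<tau>0 d(3) by simp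
    then show ?thesis using le by (simp add: z_def lookup_add lookup_scaleR algebra_simps)
  qed
  ultimately show ?case using feas act by blast
qed

text \<open>The largest index in a set of \<open>Suc n\<close> positive indices is at least
  \<open>Suc n\<close>, so its factor is at most \<open>G (Suc n)\<close>; remove it and
  induct.\<close>

lemma prod_le_prod_initial:
  fixes G :: "nat \<Rightarrow> real"
  assumes "J \<subseteq> {1..M}" "card J = n" and pos: "\<And>j. 0 \<le> G j"
    and anti: "\<And>i j. 1 \<le> i \<Longrightarrow> i \<le> j \<Longrightarrow> j \<le> M \<Longrightarrow> G j \<le> G i"
  shows "(\<Prod>j\<in>J. G j) \<le> (\<Prod>k=1..n. G k)"
  using assms(1,2)
proof (induction n arbitrary: J)
  case 0
  then have "J = {}" using finite_subset[of J "{1..M}"] by auto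
  then show ?case by simp
next
  case (Suc n)
  have fin: "finite J" using Suc.prems(1) finite_subset by blast
  have ne: "J \<noteq> {}" using Suc.prems(2) by auto
  define m where "m = Max J"
  have m: "m \<in> J" "\<And>j. j \<in> J \<Longrightarrow> j \<le> m" using fin ne by (auto simp: m_def)
  have "J \<subseteq> {1..m}" using m(2) Suc.prems(1) by auto
  then have "Suc n \<le> m" using Suc.prems(2) card_mono[of "{1..m}" J] by simp
  then have "G m \<le> G (Suc n)" using anti[of "Suc n" m] m(1) Suc.prems(1) by auto
  moreover have "(\<Prod>j\<in>J - {m}. G j) \<le> (\<Prod>k=1..n. G k)"
    using Suc m(1) fin by (intro Suc.IH) auto
  ultimately have "G m * (\<Prod>j\<in>J - {m}. G j) \<le> G (Suc n) * (\<Prod>k=1..n. G k)"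
    using pos by (intro mult_mono prod_nonneg) auto
  then show ?case
    using prod.remove[OF fin m(1), of G] by (simp add: mult.commute)
qed

text \<open>Cramer's rule for \<open>y / c\<close> has the all-ones right-hand side, and the
  integral nonzero denominator has absolute value at least 1. Replacing a column by ones adds at
  most 1 to each squared row norm; this is the origin of the \<open>+ 1\<close> in the radius. For
  \<open>c = 0\<close> the system is homogeneous.\<close>

lemma lookup_bound_of_tight:
  assumes a: "\<And>i. i < n \<Longrightarrow> a i \<in> Zn n" "rows_independent n n a"
    and y: "\<And>i. i < n \<Longrightarrow> dot n (a i) y = c" and c: "0 \<le> c" and k: "k < n"
  shows "\<bar>lookup y (Suc k)\<bar> \<le> c * sqrt (\<Prod>i<n. (norm2 n (a i))\<^sup>2 + 1)"
proof -
  define A where "A i j = lookup (a i) (Suc j)" for i j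
  define z where "z j = lookup y (Suc j)" for j
  have Az: "(\<Sum>j<n. A i j * z j) = c" if "i < n" for i
    using y[OF that] by (simp add: A_def z_def dot_shift)
  have nz: "fdet n A \<noteq> 0"
  proof
    assume "fdet n A = 0"
    then have "fdet n (\<lambda>i j. A j i) = 0" using fdet_transpose[of n A] by simp
    then obtain v where v: "\<exists>j<n. v j \<noteq> 0" "\<forall>i<n. (\<Sum>j<n. A j i * v j) = 0"
      unfolding fdet_0_kernel by blast
    then show False using a(2) unfolding rows_independent_def A_def by (auto simp: mult.commute)
  qed
  have "A i j \<in> \<int>" if "i < n" "j < n" for i j
    using a(1)[OF that(1)] that(2) by (auto simp: A_def Zn_def)
  then have "fdet n A \<in> \<int>" by (rule fdet_Ints)
  then have ge1: "1 \<le> \<bar>fdet n A\<bar>" using nz by (rule Ints_nonzero_abs_ge1)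
  show ?thesis
  proof (cases "c = 0")
    case True
    then have "\<forall>i<n. (\<Sum>j<n. A i j * z j) = 0" using Az by simp
    then have "z k = 0" using nz k unfolding fdet_0_kernel by blast
    then show ?thesis using True by (simp add: z_def)
  next
    case False
    define M where "M i j = (if j = k then 1 else A i j)" for i j
    have "(\<Sum>j<n. A i j * (z j / c)) = 1" if "i < n" for i
      using Az[OF that] False by (simp add: sum_divide_distrib[symmetric])
    from fdet_cramer[of n A "\<lambda>j. z j / c" "\<lambda>_. 1" k, OF this k]
    have "z k / c * fdet n A = fdet n (\<lambda>i j. if j = k then 1 else A i j)" by simp
    also have "(\<lambda>i j. if j = k then 1 else A i j) = M" by (simp add: M_def fun_eq_iff)
    finally have "z k / c * fdet n A = fdet n M" .
    then have eq: "\<bar>z k / c\<bar> * \<bar>fdet n A\<bar> = \<bar>fdet n M\<bar>"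
      by (metis abs_mult)
    have "(fdet n M)\<^sup>2 \<le> (\<Prod>i<n. ip n (M i) (M i))" by (rule hadamard_inequality)
    also have "\<dots> \<le> (\<Prod>i<n. (norm2 n (a i))\<^sup>2 + 1)"
    proof (rule prod_mono, safe)
      fix i
      show "0 \<le> ip n (M i) (M i)" by (rule ip_self_nonneg)
      have "(norm2 n (a i))\<^sup>2 = dot n (a i) (a i)"
        unfolding norm2_def dot_def by (simp add: power2_eq_square sum_nonneg)
      also have "\<dots> = (\<Sum>j<n. A i j * A i j)" by (simp add: dot_shift A_def)
      finally have "(norm2 n (a i))\<^sup>2 = A i k * A i k + (\<Sum>j\<in>{..<n} - {k}. A i j * A i j)"
        using k by (simp add: sum.remove[of "{..<n}" k])
      moreover have "ip n (M i) (M i) = 1 + (\<Sum>j\<in>{..<n} - {k}. A i j * A i j)"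
        using k by (simp add: ip_def M_def sum.remove[of "{..<n}" k])
      ultimately show "ip n (M i) (M i) \<le> (norm2 n (a i))\<^sup>2 + 1" by simp
    qed
    finally have "\<bar>fdet n M\<bar> \<le> sqrt (\<Prod>i<n. (norm2 n (a i))\<^sup>2 + 1)"
      using real_sqrt_le_mono[of "(fdet n M)\<^sup>2"] by simp
    moreover have "\<bar>z k / c\<bar> * 1 \<le> \<bar>z k / c\<bar> * \<bar>fdet n A\<bar>"
      using ge1 by (intro mult_left_mono) auto
    ultimately have "\<bar>z k / c\<bar> \<le> sqrt (\<Prod>i<n. (norm2 n (a i))\<^sup>2 + 1)" using eq by linarith
    then show ?thesis using False c by (simp add: z_def field_simps abs_divide)
  qed
qed

text \<open>Each signed coordinate is dominated at a vertex with \<open>n\<close> independent tight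
  exponents; the product over these is at most that over the \<open>n\<close> longest
  exponents.\<close>

theorem polytope_coordinate_bound:
  assumes "finite \<A>" and Z: "\<A> \<subseteq> Zn n" and cone: "{x \<in> Rn n. \<forall>v\<in>\<A>. dot n v x \<le> 0} = {0}"
    and b: "bij_betw b {1..card \<A>} \<A>"
    and sorted: "\<And>k l. 1 \<le> k \<Longrightarrow> k \<le> l \<Longrightarrow> l \<le> card \<A> \<Longrightarrow> norm2 n (b l) \<le> norm2 n (b k)"
    and x: "x \<in> Rn n" "\<And>v. v \<in> \<A> \<Longrightarrow> dot n v x \<le> c" and c: "0 \<le> c" and k: "k \<in> {1..n}"
  shows "\<bar>lookup x k\<bar> \<le> c * sqrt (\<Prod>k=1..n. (norm2 n (b k))\<^sup>2 + 1)"
proof -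
  define B where "B = c * sqrt (\<Prod>k=1..n. (norm2 n (b k))\<^sup>2 + 1)"
  have main: "\<sigma> * lookup x k \<le> B" if \<sigma>: "\<bar>\<sigma>\<bar> = 1" for \<sigma> :: real
  proof -
    obtain y a where y: "y \<in> Rn n" and a: "\<And>i. i < n \<Longrightarrow> a i \<in> \<A> \<and> dot n (a i) y = c"
      "rows_independent n n a" and le: "\<sigma> * lookup x k \<le> \<sigma> * lookup y k"
      using vertex_exists[OF assms(1) cone x order_refl, of \<sigma> k] by blast
    \<comment> \<open>A repeated row would satisfy the relation with coefficients 1 and -1.
      Distinctness turns the product over rows into one over a set of exponents.\<close>
    have inj: "inj_on a {..<n}"
    proof (rule inj_onI, rule ccontr)
      fix i j assume ij: "i \<in> {..<n}" "j \<in> {..<n}" "a i = a j" "i \<noteq> j"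
      define v :: "nat \<Rightarrow> real" where "v l = (if l = i then 1 else if l = j then - 1 else 0)" for l
      have "(\<Sum>l<n. v l * lookup (a l) (Suc m)) = 0" for m
      proof -
        have "(\<Sum>l<n. v l * lookup (a l) (Suc m))
            = (\<Sum>l\<in>{i, j}. v l * lookup (a l) (Suc m))"
          using ij by (intro sum.mono_neutral_right) (auto simp: v_def)
        then show ?thesis using ij by (simp add: v_def)
      qed
      then have "v i = 0" using a(2) ij(1) unfolding rows_independent_def by blast
      then show False by (simp add: v_def)
    qed
    define J where "J = {j \<in> {1..card \<A>}. b j \<in> a ` {..<n}}"
    have bJ: "bij_betw b J (a ` {..<n})"
    proof (rule bij_betwI')
      show "b i = b j \<longleftrightarrow> i = j" if "i \<in> J" "j \<in> J" for i j
        using that by (intro inj_on_eq_iff[OF bij_betw_imp_inj_on[OF b]]) (simp_all add: J_def)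
      show "b j \<in> a ` {..<n}" if "j \<in> J" for j using that by (simp add: J_def)
      show "\<exists>j\<in>J. v = b j" if "v \<in> a ` {..<n}" for v
      proof -
        have "v \<in> b ` {1..card \<A>}" using that a(1) bij_betw_imp_surj_on[OF b] by auto
        then obtain j where "j \<in> {1..card \<A>}" "v = b j" by blast
        then show ?thesis using that by (auto simp: J_def)
      qed
    qed
    have "(\<Prod>i<n. (norm2 n (a i))\<^sup>2 + 1) = (\<Prod>v\<in>a ` {..<n}. (norm2 n v)\<^sup>2 + 1)"
      by (simp add: prod.reindex[OF inj])
    also have "\<dots> = (\<Prod>j\<in>J. (norm2 n (b j))\<^sup>2 + 1)"
      by (rule prod.reindex_bij_betw[OF bJ, symmetric])
    also have "\<dots> \<le> (\<Prod>k=1..n. (norm2 n (b k))\<^sup>2 + 1)"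
    proof (rule prod_le_prod_initial)
      show "J \<subseteq> {1..card \<A>}" by (auto simp: J_def)
      show "card J = n" using bij_betw_same_card[OF bJ] card_image[OF inj] by simp
      show "(norm2 n (b j))\<^sup>2 + 1 \<le> (norm2 n (b i))\<^sup>2 + 1" if "1 \<le> i" "i \<le> j" "j \<le> card \<A>" for i j
        using sorted[OF that] by (auto intro!: power_mono simp: norm2_def sum_nonneg)
    qed simp
    finally have prod_le: "(\<Prod>i<n. (norm2 n (a i))\<^sup>2 + 1) \<le> (\<Prod>k=1..n. (norm2 n (b k))\<^sup>2 + 1)" .
    obtain k' where k': "k = Suc k'" "k' < n" using k by (cases k) auto
    have "\<sigma> * lookup y k \<le> \<bar>lookup y k\<bar>"
      using \<sigma> abs_ge_self[of "\<sigma> * lookup y k"] by (simp add: abs_mult)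
    also have "\<dots> \<le> c * sqrt (\<Prod>i<n. (norm2 n (a i))\<^sup>2 + 1)"
      unfolding k'(1) using a Z by (intro lookup_bound_of_tight c k'(2)) auto
    also have "\<dots> \<le> B"
      unfolding B_def using prod_le c by (intro mult_left_mono) auto
    finally show ?thesis using le by simp
  qed
  show ?thesis
    using main[of 1] main[of "- 1"] by (simp add: B_def abs_le_iff)
qed

section \<open>Coordinates of finitely supported families\<close>

lemma abs_lookup_le_norm:
  fixes x :: "'a \<Rightarrow>\<^sub>0 real"
  shows "\<bar>lookup x k\<bar> \<le> norm x"
proof (cases "k \<in> keys x")
  case True
  then have "\<bar>lookup x k\<bar> \<le> (\<Sum>k\<in>keys x. \<bar>lookup x k\<bar>)"
    by (intro member_le_sum) auto
  then show ?thesis by (simp add: norm_poly_mapping_def dist_poly_mapping_def)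
qed (simp add: in_keys_iff)

lemma bounded_linear_lookup: "bounded_linear (\<lambda>x :: 'a \<Rightarrow>\<^sub>0 real. lookup x k)"
proof (rule bounded_linear_intro)
  show "norm (lookup x k) \<le> norm x * 1" for x :: "'a \<Rightarrow>\<^sub>0 real"
    using abs_lookup_le_norm[of x k] by simp
qed (simp_all add: lookup_add lookup_scaleR)

lemmas continuous_on_lookup [continuous_intros] =
  bounded_linear.continuous_on[OF bounded_linear_lookup]
lemmas linear_lookup = bounded_linear.linear[OF bounded_linear_lookup]

lemma continuous_on_dot [continuous_intros]:
  "continuous_on A f \<Longrightarrow> continuous_on A (\<lambda>x. dot n v (f x))"
  unfolding dot_def by (intro continuous_intros)

lemma sum_lookup_single:
  fixes x :: "'a \<Rightarrow>\<^sub>0 real"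
  assumes "finite I" "keys x \<subseteq> I"
  shows "x = (\<Sum>k\<in>I. lookup x k *\<^sub>R single k 1)"
proof (rule poly_mapping_eqI)
  fix k
  have "lookup x k = (\<Sum>l\<in>I. if l = k then lookup x l else 0)"
    using assms by (auto simp: in_keys_iff)
  then show "lookup x k
      = lookup (\<Sum>l\<in>I. lookup x l *\<^sub>R single l 1) k"
    by (simp add: lookup_sum lookup_scaleR lookup_single when_def if_distrib cong: if_cong)
qed

lemma linear_fst_snd:
  "linear (fst :: point \<Rightarrow> _)" "linear (\<lambda>y :: point. fst (snd y))"
  by (auto intro!: linearI)

lemma finite_index_set: "finite (index_set N m)"
proof -
  have "index_set N m = (\<lambda>(j, i). (i, j)) ` (SIGMA j:{1..N}. {1..m j})"
    by (auto simp: index_set_def image_iff)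
  then show ?thesis by simp
qed

definition point_basis :: "nat \<Rightarrow> nat \<Rightarrow> (nat \<Rightarrow> nat) \<Rightarrow> point set" where
  "point_basis n N m = (\<lambda>k. (single k 1, 0, 0)) ` {1..n} \<union> {(0, 1, 0)}
     \<union> (\<lambda>p. (0, 0, single p 1)) ` index_set N m"

lemma finite_point_basis: "finite (point_basis n N m)"
  by (simp add: point_basis_def finite_index_set)

lemma in_span_point_basis:
  assumes "x \<in> Rn n" "keys z \<subseteq> index_set N m"
  shows "(x, t, z) \<in> span (point_basis n N m)"
proof -
  have e: "linear (\<lambda>x :: rvec. (x, 0 :: real, 0 :: nat \<times> nat \<Rightarrow>\<^sub>0 real))"
    "linear (\<lambda>z. (0 :: rvec, 0 :: real, z :: nat \<times> nat \<Rightarrow>\<^sub>0 real))"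
    by (auto intro!: linearI)
  have x: "x = (\<Sum>k=1..n. lookup x k *\<^sub>R single k 1)"
    using assms(1) by (intro sum_lookup_single) (auto simp: Rn_def)
  have z: "z = (\<Sum>p\<in>index_set N m. lookup z p *\<^sub>R single p 1)"
    using assms(2) by (intro sum_lookup_single finite_index_set)
  have 1: "(x, 0, 0) = (\<Sum>k=1..n. lookup x k *\<^sub>R
      (single k 1, 0 :: real, 0 :: nat \<times> nat \<Rightarrow>\<^sub>0 real))"
    by (subst x) (simp only: linear_sum[OF e(1)] linear_scale[OF e(1)])
  have 2: "(0, 0, z) = (\<Sum>p\<in>index_set N m. lookup z p *\<^sub>R
      (0 :: rvec, 0 :: real, single p 1))"
    by (subst z) (simp only: linear_sum[OF e(2)] linear_scale[OF e(2)])
  have "(x, 0, 0) \<in> span (point_basis n N m)"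
    unfolding 1 by (intro span_sum span_scale span_base) (auto simp: point_basis_def)
  moreover have "(0, 0, z) \<in> span (point_basis n N m)"
    unfolding 2 by (intro span_sum span_scale span_base) (auto simp: point_basis_def)
  moreover have "t *\<^sub>R (0, 1, 0) \<in> span (point_basis n N m)"
    by (intro span_scale span_base) (simp add: point_basis_def)
  ultimately have "(x, 0, 0) + t *\<^sub>R (0, 1, 0) + (0, 0, z) \<in> span (point_basis n N m)"
    by (intro span_add)
  then show ?thesis by simp
qed

lemma affine_aff_space: "affine (aff_space n N m)"
  unfolding affine_def
proof (safe)
  fix x t z x' t' z' and u v :: real
  assume y: "(x, t, z) \<in> aff_space n N m" "(x', t', z') \<in> aff_space n N m" and uv: "u + v = 1"
  have "u *\<^sub>R x + v *\<^sub>R x' \<in> Rn n"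
    using y by (intro subspace_add subspace_scale subspace_Rn) (auto simp: aff_space_def)
  moreover have "keys (u *\<^sub>R z + v *\<^sub>R z') \<subseteq> index_set N m"
  proof
    fix p assume "p \<in> keys (u *\<^sub>R z + v *\<^sub>R z')"
    then have "p \<in> keys z \<or> p \<in> keys z'"
      by (auto simp: in_keys_iff lookup_add lookup_scaleR)
    then show "p \<in> index_set N m" using y by (auto simp: aff_space_def)
  qed
  moreover have "(\<Sum>i=1..m j. lookup (u *\<^sub>R z + v *\<^sub>R z') (i, j)) = 1"
    if "j \<in> {1..N}" for j
    using y that uv
    by (simp add: lookup_add lookup_scaleR sum.distrib sum_distrib_left[symmetric] aff_space_def)
  ultimately show "u *\<^sub>R (x, t, z) + v *\<^sub>R (x', t', z') \<in> aff_space n N m"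
    by (simp add: aff_space_def)
qed

lemma directions_aff_space_support:
  assumes "(x, t, z) \<in> directions (aff_space n N m)"
  shows "x \<in> Rn n" and "keys z \<subseteq> index_set N m"
proof -
  obtain x1 t1 z1 x2 t2 z2 where y: "(x1, t1, z1) \<in> aff_space n N m" "(x2, t2, z2) \<in> aff_space n N m"
    and eq: "x = x1 - x2" "z = z1 - z2"
    using assms unfolding directions_def by auto
  show "x \<in> Rn n"
    unfolding eq using y by (intro subspace_diff subspace_Rn) (auto simp: aff_space_def)
  show "keys z \<subseteq> index_set N m"
  proof
    fix p assume "p \<in> keys z"
    then have "p \<in> keys z1 \<or> p \<in> keys z2"
      by (auto simp: in_keys_iff lookup_minus eq)
    then show "p \<in> index_set N m" using y by (auto simp: aff_space_def)
  qed
qed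

lemma lookup_sum_single:
  fixes c :: "nat \<Rightarrow> nat \<Rightarrow> real" and N :: nat and m :: "nat \<Rightarrow> nat"
  defines "z \<equiv> \<Sum>j=1..N. \<Sum>i=1..m j. single (i, j) (c i j)"
  shows "lookup z (i, j) = (if (i, j) \<in> index_set N m then c i j else 0)"
proof -
  have "lookup z (i, j)
      = (\<Sum>l=1..N. \<Sum>k=1..m l. if k = i then if l = j then c k l else 0 else 0)"
    unfolding z_def lookup_sum lookup_single when_def by (intro sum.cong refl) auto
  also have "\<dots> = (\<Sum>l=1..N. if l = j then if i \<in> {1..m l} then c i l else 0 else 0)"
    by (intro sum.cong refl) (auto simp: sum.delta)
  also have "\<dots> = (if (i, j) \<in> index_set N m then c i j else 0)"
    by (auto simp: index_set_def sum.delta)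
  finally show ?thesis .
qed

section \<open>The barrier of the extended feasible set\<close>

locale lse_problem =
  fixes n N :: nat and m :: "nat \<Rightarrow> nat" and F :: "nat \<Rightarrow> nat \<Rightarrow> real" and a :: "nat \<Rightarrow> nat \<Rightarrow> rvec"
  assumes N_pos: "1 \<le> N" and m_pos: "j \<in> {1..N} \<Longrightarrow> 1 \<le> m j"
    and F_pos: "j \<in> {1..N} \<Longrightarrow> i \<in> {1..m j} \<Longrightarrow> 0 < F i j"
    and cone: "{x \<in> Rn n. \<forall>v\<in>exponents N m a. dot n v x \<le> 0} = {0}"
begin

abbreviation f :: "rvec \<Rightarrow> real" where "f \<equiv> max_lse n N m F a"
abbreviation S :: "point set" where "S \<equiv> aff_space n N m"

section \<open>Elementary bounds for log-sum-exp functions\<close>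

lemma finite_exponents: "finite (exponents N m a)"
  by (simp add: exponents_def)

lemma exponents_nonempty: "exponents N m a \<noteq> {}"
  using N_pos m_pos[of 1] by (auto simp: exponents_def)

lemma exponentsI: "j \<in> {1..N} \<Longrightarrow> i \<in> {1..m j} \<Longrightarrow> a i j \<in> exponents N m a"
  unfolding exponents_def by blast

lemma lse_le_f: "j \<in> {1..N} \<Longrightarrow> lse n m F a j x \<le> f x"
  unfolding max_lse_def by (intro Max_ge) auto

lemma f_le: "(\<And>j. j \<in> {1..N} \<Longrightarrow> lse n m F a j x \<le> t) \<Longrightarrow> f x \<le> t"
  unfolding max_lse_def using N_pos by (subst Max_le_iff) auto

lemma sum_exp_pos:
  assumes "j \<in> {1..N}"
  shows "0 < (\<Sum>i=1..m j. F i j * exp (dot n (a i j) x))"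
  using assms m_pos[OF assms] F_pos[OF assms] by (intro sum_pos) auto

lemma term_le_lse:
  assumes "j \<in> {1..N}" "i \<in> {1..m j}"
  shows "ln (F i j) + dot n (a i j) x \<le> lse n m F a j x"
proof -
  have "F i j * exp (dot n (a i j) x) \<le> (\<Sum>i=1..m j. F i j * exp (dot n (a i j) x))"
    using assms F_pos[OF assms(1)] by (intro member_le_sum) (auto simp: less_imp_le)
  then have "ln (F i j * exp (dot n (a i j) x)) \<le> lse n m F a j x"
    unfolding lse_def using F_pos[OF assms] sum_exp_pos[OF assms(1)] by (subst ln_le_cancel_iff) auto
  then show ?thesis using F_pos[OF assms] by (simp add: ln_mult)
qed

lemma t_min_le:
  assumes "j \<in> {1..N}" "i \<in> {1..m j}"
  shows "t_min N m F \<le> ln (F i j)"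
proof -
  have "t_min N m F \<le> (MIN i\<in>{1..m j}. ln (F i j))"
    unfolding t_min_def using assms by (intro Min_le) auto
  also have "\<dots> \<le> ln (F i j)" using assms by (intro Min_le) auto
  finally show ?thesis .
qed

text \<open>By the cone condition every \<open>x\<close> has an exponent with nonnegative product,
  and that single term already bounds \<open>f x\<close> from below.\<close>

lemma t_min_le_f:
  assumes x: "x \<in> Rn n"
  shows "t_min N m F \<le> f x"
proof -
  have "\<exists>v\<in>exponents N m a. 0 \<le> dot n v x"
  proof (cases "x = 0")
    case True
    then show ?thesis using exponents_nonempty linear_0[OF linear_dot] by fastforce
  next
    case False
    then have "x \<notin> {x \<in> Rn n. \<forall>v\<in>exponents N m a. dot n v x \<le> 0}" unfolding cone by simp
    then show ?thesis using x by fastforce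
  qed
  then obtain i j where ij: "j \<in> {1..N}" "i \<in> {1..m j}" "0 \<le> dot n (a i j) x"
    by (auto simp: exponents_def)
  then show ?thesis
    using t_min_le[OF ij(1,2)] term_le_lse[OF ij(1,2), of x] lse_le_f[OF ij(1), of x] by linarith
qed

lemma dot_le_of_sublevel:
  assumes "f x \<le> t" "v \<in> exponents N m a"
  shows "dot n v x \<le> t - t_min N m F"
proof -
  obtain i j where ij: "j \<in> {1..N}" "i \<in> {1..m j}" "v = a i j"
    using assms(2) by (auto simp: exponents_def)
  then show ?thesis
    using t_min_le[OF ij(1,2)] term_le_lse[OF ij(1,2), of x] lse_le_f[OF ij(1), of x] assms(1) by simp
qed

lemma norm1_le_a_max: "v \<in> exponents N m a \<Longrightarrow> norm1 n v \<le> a_max n N m a"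
  unfolding a_max_def using finite_exponents by (intro Max_ge) auto

lemma a_max_nonneg: "0 \<le> a_max n N m a"
proof -
  obtain v where "v \<in> exponents N m a" using exponents_nonempty by blast
  moreover have "0 \<le> norm1 n v" by (simp add: norm1_def sum_nonneg)
  ultimately show ?thesis using norm1_le_a_max[of v] by linarith
qed

lemma abs_dot_le:
  assumes v: "v \<in> exponents N m a" and x: "\<And>k. k \<in> {1..n} \<Longrightarrow> \<bar>lookup x k\<bar> \<le> r" and r: "0 \<le> r"
  shows "\<bar>dot n v x\<bar> \<le> a_max n N m a * r"
proof -
  have "\<bar>dot n v x\<bar> \<le> (\<Sum>k=1..n. \<bar>lookup v k * lookup x k\<bar>)"
    unfolding dot_def by (rule sum_abs)
  also have "\<dots> \<le> (\<Sum>k=1..n. \<bar>lookup v k\<bar> * r)"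
    using x by (intro sum_mono) (simp add: abs_mult mult_left_mono)
  also have "\<dots> = norm1 n v * r" by (simp add: norm1_def sum_distrib_right)
  also have "\<dots> \<le> a_max n N m a * r" using norm1_le_a_max[OF v] r by (intro mult_right_mono)
  finally show ?thesis .
qed

definition weight :: "nat \<Rightarrow> nat \<Rightarrow> real" where
  "weight i j = F i j / (\<Sum>l=1..m j. F l j)"

lemma sum_F_pos: "j \<in> {1..N} \<Longrightarrow> 0 < (\<Sum>l=1..m j. F l j)"
  using m_pos F_pos by (intro sum_pos) auto

lemma lse_0: "lse n m F a j 0 = ln (\<Sum>l=1..m j. F l j)"
  by (simp add: lse_def linear_0[OF linear_dot])

lemma weight_props:
  assumes "j \<in> {1..N}"
  shows "(\<Sum>i=1..m j. weight i j) = 1" and "\<And>i. i \<in> {1..m j} \<Longrightarrow> 0 < weight i j"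
    and "\<And>i. i \<in> {1..m j} \<Longrightarrow> mu N m F \<le> weight i j"
proof -
  show "(\<Sum>i=1..m j. weight i j) = 1"
    using sum_F_pos[OF assms] by (simp add: weight_def sum_divide_distrib[symmetric])
  show "0 < weight i j" if "i \<in> {1..m j}" for i
    using sum_F_pos[OF assms] F_pos[OF assms that] by (simp add: weight_def)
  show "mu N m F \<le> weight i j" if i: "i \<in> {1..m j}" for i
  proof -
    have "mu N m F \<le> (MIN i\<in>{1..m j}. weight i j)"
      unfolding mu_def weight_def using assms by (intro Min_le) auto
    also have "\<dots> \<le> weight i j" using i by (intro Min_le) auto
    finally show ?thesis .
  qed
qed

lemma mu_bounds: "0 < mu N m F" "mu N m F \<le> 1"
proof -
  have "0 < (MIN i\<in>{1..m j}. weight i j)" if "j \<in> {1..N}" for j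
    using m_pos[OF that] weight_props(2)[OF that] by (subst Min_gr_iff) auto
  then show "0 < mu N m F"
    unfolding mu_def weight_def[symmetric] using N_pos by (subst Min_gr_iff) auto
  have j: "1 \<in> {1..N}" "1 \<in> {1..m 1}" using N_pos m_pos[of 1] by auto
  have "weight 1 1 \<le> (\<Sum>i=1..m 1. weight i 1)"
    using j weight_props(2)[OF j(1)] by (intro member_le_sum) (auto simp: less_imp_le)
  then show "mu N m F \<le> 1"
    unfolding weight_props(1)[OF j(1)] using weight_props(3)[OF j] by linarith
qed

text \<open>After adding \<open>hypo_shift i j\<close>, membership in \<open>log_hypo\<close> is the
  strict form of the constraint with index \<open>(i, j)\<close>, and the barrier of
  \<open>log_hypo\<close> becomes the summand of \<open>barrier\<close> for that index.\<close>

definition hypo_map :: "nat \<Rightarrow> nat \<Rightarrow> point \<Rightarrow> real \<times> real" where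
  "hypo_map i j y = (lookup (snd (snd y)) (i, j), fst (snd y) - dot n (a i j) (fst y))"

definition hypo_shift :: "nat \<Rightarrow> nat \<Rightarrow> real \<times> real" where
  "hypo_shift i j = (0, - ln (F i j))"

lemma linear_hypo_map: "linear (hypo_map i j)"
  by (intro linearI)
    (auto simp: hypo_map_def linear_add[OF linear_dot] linear_scale[OF linear_dot] lookup_add
      lookup_scaleR algebra_simps)

lemma hypo_map_in_log_hypo:
  assumes "j \<in> {1..N}" "i \<in> {1..m j}"
  shows "hypo_map i j (x, t, z) + hypo_shift i j \<in> log_hypo \<longleftrightarrow>
    0 < lookup z (i, j) \<and>
    F i j * exp (dot n (a i j) x) < lookup z (i, j) * exp t"
proof (cases "0 < lookup z (i, j)")
  case True
  have "F i j * exp (dot n (a i j) x) < lookup z (i, j) * exp t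
      \<longleftrightarrow> ln (F i j * exp (dot n (a i j) x)) < ln (lookup z (i, j) * exp t)"
    using True F_pos[OF assms] by (subst ln_less_cancel_iff) auto
  also have "\<dots> \<longleftrightarrow> 0 < ln (lookup z (i, j)) + (t - dot n (a i j) x + - ln (F i j))"
    using True F_pos[OF assms] by (auto simp: ln_mult)
  finally show ?thesis using True by (simp add: log_hypo_def hypo_map_def hypo_shift_def)
qed (simp add: log_hypo_def hypo_map_def hypo_shift_def)

text \<open>Written as the intersection of affine preimages, with trivial shifts \<open>+ 0\<close>,
  that the closure rules for barriers produce. It is open in the whole space; the simplex equations
  enter by intersection with \<open>S\<close>.\<close>

definition strict_K_hat :: "real \<Rightarrow> real \<Rightarrow> point set" where
  "strict_K_hat R tmax = (\<Inter>j\<in>{1..N}. \<Inter>i\<in>{1..m j}. {y. hypo_map i j y + hypo_shift i j \<in> log_hypo})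
     \<inter> (\<Inter>k\<in>{1..n}. {y. lookup (fst y) k + 0 \<in> {x. \<bar>x\<bar> < R}})
     \<inter> {y. - fst (snd y) + tmax \<in> {0<..}}"

definition barrier_grad :: "real \<Rightarrow> real \<Rightarrow> point \<Rightarrow> point \<Rightarrow> real" where
  "barrier_grad R tmax y v =
     (\<Sum>j=1..N. \<Sum>i=1..m j. log_hypo_grad (hypo_map i j y + hypo_shift i j) (hypo_map i j v))
     + (\<Sum>k=1..n. lookup (fst v) k / (R - (lookup (fst y) k + 0))
         - lookup (fst v) k / (R + (lookup (fst y) k + 0)))
     + - (- fst (snd v) / (- fst (snd y) + tmax))"

definition barrier_hess :: "real \<Rightarrow> real \<Rightarrow> point \<Rightarrow> point \<Rightarrow> point \<Rightarrow> real" where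
  "barrier_hess R tmax y u v =
     (\<Sum>j=1..N. \<Sum>i=1..m j.
        log_hypo_hess (hypo_map i j y + hypo_shift i j) (hypo_map i j u) (hypo_map i j v))
     + (\<Sum>k=1..n. lookup (fst u) k * lookup (fst v) k
           / (R - (lookup (fst y) k + 0))\<^sup>2
         + lookup (fst u) k * lookup (fst v) k
           / (R + (lookup (fst y) k + 0))\<^sup>2)
     + - fst (snd u) * - fst (snd v) / (- fst (snd y) + tmax)\<^sup>2"

abbreviation "\<theta> \<equiv> real (1 + n + 2 * (\<Sum>j=1..N. m j))"

text \<open>The parameter counts 2 for each pair \<open>(i, j)\<close>, 1 for each box coordinate
  and 1 for the bound on \<open>t\<close>.\<close>

lemma sc_barrier_barrier:
  "sc_barrier (strict_K_hat R tmax) (barrier n N m F a R tmax) (barrier_grad R tmax) (barrier_hess R tmax) \<theta>"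
proof -
  have lin_x: "linear (\<lambda>y :: point. lookup (fst y) k)" for k
    using linear_compose[OF linear_fst_snd(1) linear_lookup[of k]] by (simp add: o_def)
  have lin_t: "linear (\<lambda>y :: point. - fst (snd y))"
    by (intro linear_compose_neg linear_fst_snd)
  have b: "sc_barrier (strict_K_hat R tmax)
    (\<lambda>y. (\<Sum>j=1..N. \<Sum>i=1..m j. - (ln (fst (hypo_map i j y + hypo_shift i j)) +
        ln (ln (fst (hypo_map i j y + hypo_shift i j)) + snd (hypo_map i j y + hypo_shift i j))))
      + (\<Sum>k=1..n. - ln (R\<^sup>2 - (lookup (fst y) k + 0)\<^sup>2))
      + - ln (- fst (snd y) + tmax))
    (barrier_grad R tmax) (barrier_hess R tmax) ((\<Sum>j=1..N. \<Sum>i=1..m j. 2) + (\<Sum>k=1..n. 1) + 1)"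
    unfolding strict_K_hat_def barrier_grad_def[abs_def] barrier_hess_def[abs_def]
    by (intro sc_barrier_add sc_barrier_sum finite_atLeastAtMost
        sc_barrier_affine_comp[OF sc_barrier_log_hypo linear_hypo_map]
        sc_barrier_affine_comp[OF sc_barrier_interval lin_x]
        sc_barrier_affine_comp[OF sc_barrier_ln lin_t])
  have \<theta>: "(\<Sum>j=1..N. \<Sum>i=1..m j. 2) + (\<Sum>k=1..n. 1) + 1 = \<theta>"
    by (simp add: sum_distrib_left mult.commute)
  show ?thesis
  proof (rule sc_barrier_cong[OF b[unfolded \<theta>]])
    fix y :: point
    obtain x t z where y: "y = (x, t, z)" by (cases y)
    have arg: "ln (lookup z (i, j)) - dot n (a i j) x + t - ln (F i j)
        = ln (lookup z (i, j)) + (t - dot n (a i j) x + - ln (F i j))" for i j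
      by simp
    show "barrier n N m F a R tmax y =
      (\<Sum>j=1..N. \<Sum>i=1..m j. - (ln (fst (hypo_map i j y + hypo_shift i j)) +
        ln (ln (fst (hypo_map i j y + hypo_shift i j)) + snd (hypo_map i j y + hypo_shift i j))))
      + (\<Sum>k=1..n. - ln (R\<^sup>2 - (lookup (fst y) k + 0)\<^sup>2))
      + - ln (- fst (snd y) + tmax)"
      unfolding y barrier_def prod.case arg sum_negf
      by (simp add: hypo_map_def hypo_shift_def)
  qed
qed

lemma strict_K_hat_iff:
  "(x, t, z) \<in> strict_K_hat R tmax \<longleftrightarrow>
    (\<forall>j\<in>{1..N}. \<forall>i\<in>{1..m j}. 0 < lookup z (i, j) \<and>
      F i j * exp (dot n (a i j) x) < lookup z (i, j) * exp t) \<and>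
    (\<forall>k\<in>{1..n}. \<bar>lookup x k\<bar> < R) \<and> t < tmax"
  unfolding strict_K_hat_def using hypo_map_in_log_hypo by auto

lemma open_strict_K_hat: "open (strict_K_hat R tmax)"
proof -
  have "strict_K_hat R tmax = (\<Inter>j\<in>{1..N}. \<Inter>i\<in>{1..m j}. {y. 0 < lookup (snd (snd y)) (i, j)} \<inter>
      {y. F i j * exp (dot n (a i j) (fst y)) < lookup (snd (snd y)) (i, j) * exp (fst (snd y))})
    \<inter> (\<Inter>k\<in>{1..n}. {y. \<bar>lookup (fst y) k\<bar> < R}) \<inter> {y. fst (snd y) < tmax}"
    by (auto simp: strict_K_hat_iff)
  also have "open \<dots>"
    by (intro open_Int open_INT ballI finite_atLeastAtMost open_Collect_less continuous_intros)
  finally show ?thesis .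
qed

text \<open>Summing the constraints of a block over \<open>i\<close> eliminates \<open>z\<close>,
  whose entries add up to 1.\<close>

lemma f_le_of_simplex:
  assumes z: "\<And>j. j \<in> {1..N} \<Longrightarrow> (\<Sum>i=1..m j. lookup z (i, j)) = 1"
    and le: "\<And>i j. j \<in> {1..N} \<Longrightarrow> i \<in> {1..m j} \<Longrightarrow>
      F i j * exp (dot n (a i j) x) \<le> lookup z (i, j) * exp t"
  shows "f x \<le> t"
proof (rule f_le)
  fix j assume j: "j \<in> {1..N}"
  have "(\<Sum>i=1..m j. F i j * exp (dot n (a i j) x)) \<le> (\<Sum>i=1..m j. lookup z (i, j) * exp t)"
    using le[OF j] by (intro sum_mono) auto
  also have "\<dots> = exp t" using z[OF j] by (simp add: sum_distrib_right[symmetric])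
  finally show "lse n m F a j x \<le> t"
    unfolding lse_def using sum_exp_pos[OF j] ln_mono by fastforce
qed

lemma strict_K_hat_subset_K_hat: "strict_K_hat R tmax \<inter> S \<subseteq> K_hat n N m F a R tmax"
proof
  fix y assume y: "y \<in> strict_K_hat R tmax \<inter> S"
  obtain x t z where xyz: "y = (x, t, z)" by (cases y)
  have "f x \<le> t"
    using y unfolding xyz by (intro f_le_of_simplex[of z]) (auto simp: strict_K_hat_iff aff_space_def less_imp_le)
  then show "y \<in> K_hat n N m F a R tmax"
    using y unfolding xyz by (auto simp: strict_K_hat_iff aff_space_def K_hat_def K_set_def less_imp_le)
qed

lemma strict_K_hat_subset_interior:
  "strict_K_hat R tmax \<inter> S \<subseteq> (top_of_set S) interior_of (K_hat n N m F a R tmax)"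
  by (rule interior_of_maximal[OF strict_K_hat_subset_K_hat]) (simp add: openin_open_Int open_strict_K_hat Int_commute)

lemma strict_K_hatD:
  assumes "y \<in> strict_K_hat R tmax"
  shows "\<And>i j. j \<in> {1..N} \<Longrightarrow> i \<in> {1..m j} \<Longrightarrow> hypo_map i j y + hypo_shift i j \<in> log_hypo"
    and "\<And>k. k \<in> {1..n} \<Longrightarrow> \<bar>lookup (fst y) k\<bar> < R" and "fst (snd y) < tmax"
  using assms unfolding strict_K_hat_def by auto

text \<open>The logarithmic terms control \<open>z\<close>, the box terms \<open>x\<close> and the
  last term \<open>t\<close>; the support of a direction of \<open>S\<close> rules out all further
  coordinates.\<close>

lemma barrier_hess_pos_def:
  assumes y: "y \<in> strict_K_hat R tmax" and v: "v \<in> directions S" and 0: "barrier_hess R tmax y v v = 0"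
  shows "v = 0"
proof -
  obtain x t z where xtz: "v = (x, t, z)" by (cases v)
  define A where "A i j = log_hypo_hess (hypo_map i j y + hypo_shift i j) (hypo_map i j v) (hypo_map i j v)" for i j
  define X where "X k = lookup x k * lookup x k
      / (R - (lookup (fst y) k + 0))\<^sup>2
    + lookup x k * lookup x k / (R + (lookup (fst y) k + 0))\<^sup>2" for k
  define T where "T = - t * - t / (- fst (snd y) + tmax)\<^sup>2"
  have A0: "0 \<le> A i j" if "j \<in> {1..N}" "i \<in> {1..m j}" for i j
    unfolding A_def by (rule psd_form_nonneg[OF psd_form_log_hypo_hess[OF strict_K_hatD(1)[OF y that]]])
  have X0: "0 \<le> X k" for k by (simp add: X_def)
  have T0: "0 \<le> T" by (simp add: T_def)
  have sum0: "(\<Sum>j=1..N. \<Sum>i=1..m j. A i j) + (\<Sum>k=1..n. X k) + T = 0"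
    using 0 by (simp add: barrier_hess_def A_def X_def T_def xtz)
  have AA: "0 \<le> (\<Sum>i=1..m j. A i j)" if "j \<in> {1..N}" for j
    using A0[OF that] by (intro sum_nonneg)
  have "0 \<le> (\<Sum>j=1..N. \<Sum>i=1..m j. A i j)" by (rule sum_nonneg) (rule AA)
  moreover have "0 \<le> (\<Sum>k=1..n. X k)" by (rule sum_nonneg) (rule X0)
  ultimately have eq0: "(\<Sum>j=1..N. \<Sum>i=1..m j. A i j) = 0" "(\<Sum>k=1..n. X k) = 0" "T = 0"
    using sum0 T0 by linarith+
  have "(\<Sum>i=1..m j. A i j) = 0" if "j \<in> {1..N}" for j
    using eq0(1) AA that by (subst (asm) sum_nonneg_eq_0_iff) auto
  then have "A i j = 0" if "j \<in> {1..N}" "i \<in> {1..m j}" for i j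
    using that A0[OF that(1)] sum_nonneg_eq_0_iff[of "{1..m j}" "\<lambda>i. A i j"] by auto
  then have "hypo_map i j v = 0" if "j \<in> {1..N}" "i \<in> {1..m j}" for i j
    using log_hypo_hess_pos_def[OF strict_K_hatD(1)[OF y that]] that unfolding A_def by blast
  then have z: "lookup z (i, j) = 0" if "j \<in> {1..N}" "i \<in> {1..m j}" for i j
    using that by (fastforce simp: hypo_map_def xtz zero_prod_def)
  have "X k = 0" if "k \<in> {1..n}" for k
    using eq0(2) X0 that by (subst (asm) sum_nonneg_eq_0_iff) auto
  then have x: "lookup x k = 0" if "k \<in> {1..n}" for k
  proof -
    have p: "0 < R - lookup (fst y) k" "0 < R + lookup (fst y) k"
      using strict_K_hatD(2)[OF y that] by auto
    have "0 \<le> lookup x k * lookup x k / (R - lookup (fst y) k)\<^sup>2"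
      "0 \<le> lookup x k * lookup x k / (R + lookup (fst y) k)\<^sup>2"
      by simp_all
    then have "lookup x k * lookup x k / (R - lookup (fst y) k)\<^sup>2 = 0"
      using \<open>\<And>k. k \<in> {1..n} \<Longrightarrow> X k = 0\<close>[OF that] unfolding X_def add_0_right by linarith
    then show ?thesis using p by simp
  qed
  have t: "t = 0" using eq0(3) strict_K_hatD(3)[OF y] by (simp add: T_def)
  note sup = directions_aff_space_support[OF v[unfolded xtz]]
  have "x = 0"
  proof (rule poly_mapping_eqI)
    fix k show "lookup x k = lookup 0 k"
      using x[of k] sup(1) by (cases "k \<in> {1..n}") (auto simp: Rn_def in_keys_iff)
  qed
  moreover have "z = 0"
  proof (rule poly_mapping_eqI)
    fix p :: "nat \<times> nat"
    obtain i j where p: "p = (i, j)" by (cases p)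
    show "lookup z p = lookup 0 p"
      using z[of j i] sup(2) unfolding p
      by (cases "(i, j) \<in> index_set N m") (auto simp: index_set_def in_keys_iff)
  qed
  ultimately show ?thesis using t by (simp add: xtz zero_prod_def)
qed

lemma sc_barrier_affine_barrier:
  assumes "S \<noteq> {}"
  shows "sc_barrier_affine (strict_K_hat R tmax) (barrier n N m F a R tmax) (barrier_grad R tmax) (barrier_hess R tmax) \<theta> S
    (point_basis n N m)"
proof -
  interpret sc_barrier "strict_K_hat R tmax" "barrier n N m F a R tmax" "barrier_grad R tmax" "barrier_hess R tmax" \<theta>
    by (rule sc_barrier_barrier)
  show ?thesis
  proof
    show "affine S" by (rule affine_aff_space)
    show "S \<noteq> {}" by (rule assms)
    show "finite (point_basis n N m)" by (rule finite_point_basis)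
    show "directions S \<subseteq> span (point_basis n N m)"
    proof
      fix v assume v: "v \<in> directions S"
      obtain x t z where xtz: "v = (x, t, z)" by (cases v)
      show "v \<in> span (point_basis n N m)"
        using directions_aff_space_support[OF v[unfolded xtz]] unfolding xtz
        by (rule in_span_point_basis)
    qed
    show "v = 0" if "y \<in> strict_K_hat R tmax" "v \<in> directions S" "barrier_hess R tmax y v v = 0" for y v
      by (rule barrier_hess_pos_def[OF that])
    show "1 \<le> \<theta>" by (auto intro!: add_nonneg_nonneg sum_nonneg)
  qed
qed

section \<open>Feasible points and their objective values\<close>

lemma K_hat_t_ge:
  assumes "(x, t, z) \<in> K_hat n N m F a R tmax"
  shows "x \<in> Rn n" "f x \<le> t" "t \<le> tmax"
  using assms by (auto simp: K_hat_def K_set_def)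

lemma bdd_below_f: "bdd_below (f ` Rn n)"
  using t_min_le_f by (intro bdd_belowI2[of _ "t_min N m F"])

lemma Inf_f_le: "x \<in> Rn n \<Longrightarrow> (INF x\<in>Rn n. f x) \<le> f x"
  by (rule cINF_lower[OF bdd_below_f])

lemma zero_in_Rn: "0 \<in> Rn n"
  by (simp add: Rn_def)

lemma t_min_le_Inf_f: "t_min N m F \<le> (INF x\<in>Rn n. f x)"
  using t_min_le_f zero_in_Rn by (intro cINF_greatest) auto

text \<open>The witness for \<open>z\<close> takes the shares of the terms in their exponential sum
  \<open>s j\<close>; all constraints of block \<open>j\<close> then reduce to
  \<open>s j < exp t\<close>.\<close>

lemma strict_K_hat_point:
  assumes x: "x \<in> Rn n" "\<And>k. k \<in> {1..n} \<Longrightarrow> \<bar>lookup x k\<bar> < R" and t: "f x < t" "t < tmax"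
  defines "s \<equiv> \<lambda>j. \<Sum>l=1..m j. F l j * exp (dot n (a l j) x)"
  shows "(x, t, \<Sum>j=1..N. \<Sum>i=1..m j. single (i, j) (F i j * exp (dot n (a i j) x) / s j))
    \<in> strict_K_hat R tmax \<inter> S"
proof -
  define z where "z = (\<Sum>j=1..N. \<Sum>i=1..m j. single (i, j) (F i j * exp (dot n (a i j) x) / s j))"
  have lk: "lookup z (i, j) = (if (i, j) \<in> index_set N m then F i j * exp (dot n (a i j) x) / s j else 0)" for i j
    unfolding z_def by (rule lookup_sum_single)
  have sp: "0 < s j" if "j \<in> {1..N}" for j using sum_exp_pos[OF that] by (simp add: s_def)
  have se: "s j < exp t" if "j \<in> {1..N}" for j
  proof -
    have "ln (s j) < t" using lse_le_f[OF that, of x] t(1) by (simp add: lse_def s_def)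
    then show ?thesis using sp[OF that] by (metis exp_less_mono exp_ln)
  qed
  have "(x, t, z) \<in> strict_K_hat R tmax"
    unfolding strict_K_hat_iff
  proof (intro conjI ballI)
    fix i j assume ij: "j \<in> {1..N}" "i \<in> {1..m j}"
    then have l: "lookup z (i, j) = F i j * exp (dot n (a i j) x) / s j"
      by (simp add: lk index_set_def)
    show "0 < lookup z (i, j)" using F_pos[OF ij] sp[OF ij(1)] by (simp add: l)
    have "F i j * exp (dot n (a i j) x) * s j < F i j * exp (dot n (a i j) x) * exp t"
      using F_pos[OF ij] se[OF ij(1)] by (intro mult_strict_left_mono) auto
    then show "F i j * exp (dot n (a i j) x) < lookup z (i, j) * exp t"
      using sp[OF ij(1)] by (simp add: l field_simps)
  qed (use x t in auto)
  moreover have "(x, t, z) \<in> S"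
  proof -
    have "keys z \<subseteq> index_set N m" by (auto simp: in_keys_iff lk split: if_splits)
    moreover have "(\<Sum>i=1..m j. lookup z (i, j)) = 1" if j: "j \<in> {1..N}" for j
    proof -
      have "(\<Sum>i=1..m j. lookup z (i, j)) = (\<Sum>i=1..m j. F i j * exp (dot n (a i j) x) / s j)"
        using j by (intro sum.cong) (auto simp: lk index_set_def)
      also have "\<dots> = s j / s j" by (simp add: s_def sum_divide_distrib[symmetric])
      finally show ?thesis using sp[OF j] by simp
    qed
    ultimately show ?thesis using x(1) by (simp add: aff_space_def)
  qed
  ultimately show ?thesis unfolding z_def by simp
qed

section \<open>The starting point and the gradient there\<close>

lemma start_point_eq:
  "start_point N m F tbar = (0, tbar, \<Sum>j=1..N. \<Sum>i=1..m j. single (i, j)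
     (F i j * exp (dot n (a i j) 0) / (\<Sum>l=1..m j. F l j * exp (dot n (a l j) 0))))"
  by (simp add: start_point_def linear_0[OF linear_dot])

lemma start_point_strict_K_hat:
  assumes "0 < R" "f 0 < tbar" "tbar < tmax"
  shows "start_point N m F tbar \<in> strict_K_hat R tmax \<inter> S"
  unfolding start_point_eq using assms zero_in_Rn by (intro strict_K_hat_point) auto

text \<open>At the start all constraints of a block have the same slack, since the simplex weights
  cancel the coefficients \<open>F i j\<close>.\<close>

lemma hypo_map_start_point:
  assumes "j \<in> {1..N}" "i \<in> {1..m j}"
  shows "fst (hypo_map i j (start_point N m F tbar) + hypo_shift i j) = weight i j"
    and "ln (fst (hypo_map i j (start_point N m F tbar) + hypo_shift i j))
      + snd (hypo_map i j (start_point N m F tbar) + hypo_shift i j) = tbar - lse n m F a j 0"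
proof -
  have "lookup (\<Sum>j=1..N. \<Sum>i=1..m j. single (i, j) (weight i j)) (i, j) = weight i j"
    using assms by (subst lookup_sum_single) (simp add: index_set_def)
  then show 1: "fst (hypo_map i j (start_point N m F tbar) + hypo_shift i j) = weight i j"
    by (simp add: hypo_map_def hypo_shift_def start_point_def weight_def)
  have "ln (weight i j) = ln (F i j) - lse n m F a j 0"
    unfolding weight_def lse_0 using F_pos[OF assms] sum_F_pos[OF assms(1)] by (simp add: ln_div)
  then show "ln (fst (hypo_map i j (start_point N m F tbar) + hypo_shift i j))
      + snd (hypo_map i j (start_point N m F tbar) + hypo_shift i j) = tbar - lse n m F a j 0"
    unfolding 1 by (simp add: hypo_map_def hypo_shift_def start_point_def linear_0[OF linear_dot])
qed

lemma strict_K_hat_bounds: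
  assumes "(x, t, z) \<in> strict_K_hat R tmax \<inter> S"
  shows "t_min N m F \<le> t" "t \<le> tmax" "\<And>k. k \<in> {1..n} \<Longrightarrow> \<bar>lookup x k\<bar> \<le> R"
    "\<And>i j. j \<in> {1..N} \<Longrightarrow> i \<in> {1..m j} \<Longrightarrow> lookup z (i, j) \<in> {0..1}"
proof -
  have K: "(x, t, z) \<in> K_hat n N m F a R tmax" using strict_K_hat_subset_K_hat assms by blast
  show "t_min N m F \<le> t" "t \<le> tmax" using K_hat_t_ge[OF K] t_min_le_f[of x] by auto
  show "\<bar>lookup x k\<bar> \<le> R" if "k \<in> {1..n}" for k
    using assms that by (force simp: strict_K_hat_iff)
  show "lookup z (i, j) \<in> {0..1}" if ij: "j \<in> {1..N}" "i \<in> {1..m j}" for i j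
  proof -
    have pos: "0 < lookup z (l, j)" if "l \<in> {1..m j}" for l
      using assms ij(1) that by (simp add: strict_K_hat_iff)
    have "lookup z (i, j) \<le> (\<Sum>l=1..m j. lookup z (l, j))"
      using ij(2) pos by (intro member_le_sum) (auto simp: less_imp_le)
    also have "\<dots> = 1" using assms ij(1) by (simp add: aff_space_def)
    finally show ?thesis using pos[OF ij(2)] by simp
  qed
qed

text \<open>The slacks at the start are at least half of \<open>(a_max n N m a + 1) * R\<close>, and
  both \<open>t\<close> and the products with exponents vary by multiples of that quantity; dividing
  by the simplex weights brings in \<mu>.\<close>

lemma barrier_grad_start_point_bound:
  assumes R: "1 \<le> R" and tbar: "f 0 + (a_max n N m a + 1) * R / 2 \<le> tbar"
    and tmax: "tmax = tbar + (a_max n N m a + 1) * R / 2"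
    and tr: "tmax - t_min N m F \<le> 2 * ((a_max n N m a + 1) * R)"
    and uv: "u \<in> strict_K_hat R tmax \<inter> S" "v \<in> strict_K_hat R tmax \<inter> S"
  shows "\<bar>barrier_grad R tmax (start_point N m F tbar) (u - v)\<bar> \<le> 6 * \<theta> / mu N m F"
proof -
  define w where "w = start_point N m F tbar"
  define B where "B = (a_max n N m a + 1) * R"
  define M where "M = real (\<Sum>j=1..N. m j)"
  define \<mu> where "\<mu> = mu N m F"
  have \<mu>: "0 < \<mu>" "\<mu> \<le> 1" using mu_bounds by (auto simp: \<mu>_def)
  have "1 * 1 \<le> B" unfolding B_def using R a_max_nonneg by (intro mult_mono) auto
  then have B: "1 \<le> B" by simp
  have aR: "a_max n N m a * (2 * R) \<le> 2 * B" using R by (simp add: B_def algebra_simps)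
  obtain x t z where u: "u = (x, t, z)" by (cases u)
  obtain x' t' z' where v: "v = (x', t', z')" by (cases v)
  note bu = strict_K_hat_bounds[OF uv(1)[unfolded u]] and bv = strict_K_hat_bounds[OF uv(2)[unfolded v]]
  have dt: "\<bar>t - t'\<bar> \<le> 2 * B" using bu(1,2) bv(1,2) tr by (auto simp: B_def)
  have term_bound: "\<bar>log_hypo_grad (hypo_map i j w + hypo_shift i j) (hypo_map i j (u - v))\<bar> \<le> 11 / \<mu>"
    if ij: "j \<in> {1..N}" "i \<in> {1..m j}" for i j
  proof -
    define U where "U = tbar - lse n m F a j 0"
    have U: "B / 2 \<le> U" using lse_le_f[OF ij(1), of 0] tbar by (simp add: U_def B_def)
    define p where "p = lookup (z - z') (i, j) / weight i j"
    define q where "q = (t - t') - dot n (a i j) (x - x')"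
    have "\<bar>lookup (z - z') (i, j)\<bar> \<le> 1"
      using bu(4)[OF ij] bv(4)[OF ij] by (auto simp: lookup_minus)
    moreover have wt: "0 < weight i j" "\<mu> \<le> weight i j"
      using weight_props[OF ij(1)] ij(2) by (auto simp: \<mu>_def)
    ultimately have p: "\<bar>p\<bar> \<le> 1 / \<mu>"
      unfolding p_def abs_divide using \<mu> by (intro frac_le) auto
    have "\<bar>dot n (a i j) (x - x')\<bar> \<le> a_max n N m a * (2 * R)"
    proof (rule abs_dot_le[OF exponentsI[OF ij]])
      show "\<bar>lookup (x - x') k\<bar> \<le> 2 * R" if "k \<in> {1..n}" for k
        using bu(3)[OF that] bv(3)[OF that] by (simp add: lookup_minus)
    qed (use R in simp)
    then have q: "\<bar>q\<bar> \<le> 4 * B" using dt aR by (simp add: q_def)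
    have "log_hypo_grad (hypo_map i j w + hypo_shift i j) (hypo_map i j (u - v)) = - p - (p + q) / U"
      unfolding log_hypo_grad_def w_def hypo_map_start_point(2)[OF ij]
      unfolding hypo_map_start_point(1)[OF ij] U_def p_def q_def
      by (simp add: hypo_map_def u v)
    \<comment> \<open>With \<open>1 \<le> B\<close> and \<open>\<mu> \<le> 1\<close> this quotient
      is at most \<open>10 / \<mu>\<close>; the summand \<open>p\<close> contributes the eleventh
      unit.\<close>
    moreover have "\<bar>(p + q) / U\<bar> \<le> (1 / \<mu> + 4 * B) / (B / 2)"
      unfolding abs_divide using p q U B \<mu> by (intro frac_le) auto
    moreover have "(1 / \<mu> + 4 * B) / (B / 2) \<le> 2 / \<mu> + 8"
      using B \<mu> by (simp add: field_simps)
    moreover have "8 \<le> 8 / \<mu>" using \<mu> by (simp add: field_simps)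
    moreover have "11 / \<mu> = 1 / \<mu> + 2 / \<mu> + 8 / \<mu>" by (simp add: add_divide_distrib[symmetric])
    ultimately show ?thesis using p by linarith
  qed
  have box: "(\<Sum>k=1..n. lookup (fst (u - v)) k / (R - (lookup (fst w) k + 0))
      - lookup (fst (u - v)) k / (R + (lookup (fst w) k + 0))) = 0"
    by (simp add: w_def start_point_def)
  have "- fst (snd w) + tmax = B / 2" "fst (snd (u - v)) = t - t'"
    by (simp_all add: u v w_def start_point_def tmax B_def)
  then have "\<bar>- (- fst (snd (u - v)) / (- fst (snd w) + tmax))\<bar> = \<bar>t - t'\<bar> / (B / 2)"
    using B by (simp only: minus_divide_left[symmetric] minus_minus abs_divide abs_of_pos half_gt_zero)
  also have "\<dots> \<le> 2 * B / (B / 2)" using dt B by (intro divide_right_mono) auto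
  also have "\<dots> = 4" using B by simp
  also have "\<dots> \<le> 4 / \<mu>" using \<mu> by (simp add: field_simps)
  finally have tt: "\<bar>- (- fst (snd (u - v)) / (- fst (snd w) + tmax))\<bar> \<le> 4 / \<mu>" .
  have "\<bar>\<Sum>j=1..N. \<Sum>i=1..m j. log_hypo_grad (hypo_map i j w + hypo_shift i j) (hypo_map i j (u - v))\<bar>
      \<le> (\<Sum>j=1..N. \<Sum>i=1..m j. 11 / \<mu>)"
    using term_bound by (intro order_trans[OF sum_abs] sum_mono) auto
  also have "\<dots> = (\<Sum>j=1..N. real (m j) * (11 / \<mu>))" by simp
  also have "\<dots> = M * (11 / \<mu>)" by (simp only: M_def of_nat_sum sum_distrib_right)
  finally have "\<bar>barrier_grad R tmax w (u - v)\<bar> \<le> M * (11 / \<mu>) + 4 / \<mu>"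
    unfolding barrier_grad_def box using tt by linarith
  also have "\<dots> = (11 * M + 4) / \<mu>" by (simp add: add_divide_distrib)
  also have "\<dots> \<le> 6 * (1 + real n + 2 * M) / \<mu>"
    using \<mu> by (intro divide_right_mono) (auto simp: M_def simp del: of_nat_sum)
  also have "1 + real n + 2 * M = \<theta>" by (simp add: M_def)
  finally show ?thesis by (simp add: w_def \<mu>_def)
qed

lemma linear_t_coord: "linear t_coord"
  unfolding t_coord_def by (intro linearI) auto

text \<open>The sublevel set \<open>{f \<le> f 0}\<close> lies in the box, so the box does not change the infimum.\<close>

lemma Inf_t_coord:
  assumes R: "\<And>x k. x \<in> Rn n \<Longrightarrow> f x \<le> f 0 \<Longrightarrow> k \<in> {1..n} \<Longrightarrow> \<bar>lookup x k\<bar> < R"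
    and tmax: "f 0 + 1 < tmax"
  defines "D \<equiv> (top_of_set S) interior_of (K_hat n N m F a R tmax)"
  shows "0 < b \<Longrightarrow> \<exists>v\<in>strict_K_hat R tmax \<inter> S. t_coord v < (INF x\<in>Rn n. f x) + b"
    and "(INF v\<in>closure D. t_coord v) = (INF x\<in>Rn n. f x)"
proof -
  define fmin where "fmin = (INF x\<in>Rn n. f x)"
  have dense: "\<exists>v\<in>strict_K_hat R tmax \<inter> S. t_coord v < fmin + b" if b: "0 < b" for b
  proof -
    have "Inf (f ` Rn n) < fmin + b / 2" using b by (simp add: fmin_def)
    then obtain x0 where x0: "x0 \<in> Rn n" "f x0 < fmin + b / 2"
      using cInf_lessD[of "f ` Rn n" "fmin + b / 2"] zero_in_Rn by blast
    \<comment> \<open>If \<open>x0\<close> lies above level \<open>f 0\<close>, the origin is even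
      better; either way the point is in the sublevel set and so in the box.\<close>
    define x where "x = (if f x0 \<le> f 0 then x0 else 0)"
    have x: "x \<in> Rn n" "f x < fmin + b / 2" "f x \<le> f 0"
      using x0 zero_in_Rn by (auto simp: x_def)
    \<comment> \<open>The cap at 1 keeps \<open>t\<close> below \<open>tmax\<close>.\<close>
    define t where "t = f x + min (b / 2) 1"
    have "f x < t" "t < tmax" "t < fmin + b" using b x tmax by (auto simp: t_def min_def)
    then show ?thesis
      using strict_K_hat_point[OF x(1) R[OF x(1,3)], of t tmax] by (force simp: t_coord_def)
  qed
  then show "0 < b \<Longrightarrow> \<exists>v\<in>strict_K_hat R tmax \<inter> S. t_coord v < (INF x\<in>Rn n. f x) + b"
    by (simp add: fmin_def)
  have GD: "strict_K_hat R tmax \<inter> S \<subseteq> D" unfolding D_def by (rule strict_K_hat_subset_interior)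
  have "D \<subseteq> {y. fmin \<le> fst (snd y)}"
  proof
    fix y assume y: "y \<in> D"
    obtain x t z where xtz: "y = (x, t, z)" by (cases y)
    have "(x, t, z) \<in> K_hat n N m F a R tmax"
      using subsetD[OF interior_of_subset y[unfolded D_def]] unfolding xtz .
    from K_hat_t_ge[OF this] Inf_f_le[of x] show "y \<in> {y. fmin \<le> fst (snd y)}"
      by (simp add: xtz fmin_def)
  qed
  moreover have "closed {y :: point. fmin \<le> fst (snd y)}"
    by (intro closed_Collect_le continuous_intros)
  ultimately have "closure D \<subseteq> {y. fmin \<le> fst (snd y)}" by (rule closure_minimal)
  then have lower: "fmin \<le> t_coord y" if "y \<in> closure D" for y
    using that by (auto simp: t_coord_def case_prod_unfold)
  have "closure D \<noteq> {}" using dense[of 1] GD by auto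
  then have "fmin \<le> (INF v\<in>closure D. t_coord v)" using lower by (intro cINF_greatest)
  moreover have "(INF v\<in>closure D. t_coord v) \<le> fmin"
  proof (rule field_le_epsilon)
    fix e :: real assume "0 < e"
    then obtain v where v: "v \<in> strict_K_hat R tmax \<inter> S" "t_coord v < fmin + e" using dense by blast
    have "(INF v\<in>closure D. t_coord v) \<le> t_coord v"
      using lower v(1) GD closure_subset by (intro cINF_lower bdd_belowI2[of _ fmin]) blast+
    then show "(INF v\<in>closure D. t_coord v) \<le> fmin + e" using v(2) by simp
  qed
  ultimately show "(INF v\<in>closure D. t_coord v) = (INF x\<in>Rn n. f x)" by (simp add: fmin_def)
qed

end

text \<open>Both logarithms have arguments at most a constant times \<open>E\<close>, because
  \<open>min \<epsilon> M\<close> is below \<epsilon> and \<open>M\<close> and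
  \<open>\<mu> \<le> 1\<close>. Here \<open>M\<close> is the range of the objective.\<close>

lemma iteration_bound:
  fixes \<theta> \<mu> \<delta> \<kappa> \<epsilon> M :: real
  assumes \<theta>: "3 \<le> \<theta>" and \<mu>: "0 < \<mu>" "\<mu> \<le> 1" and \<delta>: "0 < \<delta>" "\<delta> \<le> 1" and \<kappa>: "0 < \<kappa>" "\<kappa> \<le> 1"
    and \<epsilon>: "0 < \<epsilon>" and M: "0 < M"
    and k: "k \<le> 8 * sqrt \<theta> * ln (max 1 (4 * (6 * \<theta> / \<mu>) / \<delta>))
      + 16 * sqrt \<theta> * ln (max 1 (4 * \<theta> * M / (\<kappa> * \<epsilon>))) + real J + 2"
  shows "k \<le> (8 * (ln (12 / \<delta>) + 1) + 16 * (ln (2 / \<kappa>) + 1) + real J + 2)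
    * (sqrt \<theta> * ln (2 * \<theta> * M / (min \<epsilon> M * \<mu>)))"
proof -
  define E where "E = 2 * \<theta> * M / (min \<epsilon> M * \<mu>)"
  define L where "L = ln E"
  have min: "0 < min \<epsilon> M" "min \<epsilon> M \<le> \<epsilon>" "min \<epsilon> M \<le> M" using \<epsilon> M by auto
  have E1: "2 * \<theta> / \<mu> \<le> E"
  proof -
    have "2 * \<theta> * M / (M * \<mu>) \<le> E"
      unfolding E_def using \<theta> \<mu> M min by (intro divide_left_mono mult_right_mono) auto
    then show ?thesis using M by simp
  qed
  have E2: "2 * \<theta> * M / \<epsilon> \<le> E"
  proof -
    have "min \<epsilon> M * \<mu> \<le> \<epsilon> * 1" using min \<mu> \<epsilon> by (intro mult_mono) auto
    then show ?thesis
      unfolding E_def using \<theta> \<mu> M min by (intro divide_left_mono) auto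
  qed
  have "2 * \<theta> \<le> 2 * \<theta> / \<mu>" using \<theta> \<mu> by (simp add: field_simps)
  \<comment> \<open>Since 6 exceeds Euler's number, the logarithm of \<open>E\<close> is at least 1,
    so additive constants can be absorbed into a multiple of it.\<close>
  then have E6: "6 \<le> E" using E1 \<theta> by linarith
  then have "exp 1 \<le> E" using exp_le by linarith
  then have L: "1 \<le> L" unfolding L_def using E6 by (subst ln_ge_iff) auto
  have c1: "1 \<le> 12 / \<delta>" and c2: "1 \<le> 2 / \<kappa>" using \<delta> \<kappa> by (auto simp: field_simps)
  have l1: "ln (max 1 (4 * (6 * \<theta> / \<mu>) / \<delta>)) \<le> ln (12 / \<delta>) + L"
  proof -
    have "12 / \<delta> * (2 * \<theta> / \<mu>) \<le> 12 / \<delta> * E" using E1 \<delta> by (intro mult_left_mono) auto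
    moreover have "1 * 1 \<le> 12 / \<delta> * E" using c1 E6 \<delta> by (intro mult_mono) auto
    moreover have "4 * (6 * \<theta> / \<mu>) / \<delta> = 12 / \<delta> * (2 * \<theta> / \<mu>)" by simp
    ultimately have "max 1 (4 * (6 * \<theta> / \<mu>) / \<delta>) \<le> 12 / \<delta> * E" by linarith
    then have "ln (max 1 (4 * (6 * \<theta> / \<mu>) / \<delta>)) \<le> ln (12 / \<delta> * E)"
      by (intro ln_mono) auto
    also have "\<dots> = ln (12 / \<delta>) + L" unfolding L_def using \<delta> E6 by (intro ln_mult_pos) auto
    finally show ?thesis .
  qed
  have l2: "ln (max 1 (4 * \<theta> * M / (\<kappa> * \<epsilon>))) \<le> ln (2 / \<kappa>) + L"
  proof -
    have "2 / \<kappa> * (2 * \<theta> * M / \<epsilon>) \<le> 2 / \<kappa> * E" using E2 \<kappa> by (intro mult_left_mono) auto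
    moreover have "1 * 1 \<le> 2 / \<kappa> * E" using c2 E6 \<kappa> by (intro mult_mono) auto
    moreover have "4 * \<theta> * M / (\<kappa> * \<epsilon>) = 2 / \<kappa> * (2 * \<theta> * M / \<epsilon>)" by simp
    ultimately have "max 1 (4 * \<theta> * M / (\<kappa> * \<epsilon>)) \<le> 2 / \<kappa> * E" by linarith
    then have "ln (max 1 (4 * \<theta> * M / (\<kappa> * \<epsilon>))) \<le> ln (2 / \<kappa> * E)"
      by (intro ln_mono) auto
    also have "\<dots> = ln (2 / \<kappa>) + L" unfolding L_def using \<kappa> E6 by (intro ln_mult_pos) auto
    finally show ?thesis .
  qed
  have d: "0 \<le> ln (12 / \<delta>)" "0 \<le> ln (2 / \<kappa>)" using c1 c2 by auto
  have absorb: "c + L \<le> (c + 1) * L" if "0 \<le> c" for c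
    using mult_left_mono[OF L that] by (simp add: algebra_simps)
  have s: "1 \<le> sqrt \<theta>" using \<theta> by simp
  have "1 * 1 \<le> sqrt \<theta> * L" using s L by (intro mult_mono) auto
  then have J: "real J + 2 \<le> (real J + 2) * (sqrt \<theta> * L)"
    using mult_left_mono[of 1 "sqrt \<theta> * L" "real J + 2"] by simp
  have "sqrt \<theta> * ln (max 1 (4 * (6 * \<theta> / \<mu>) / \<delta>)) \<le> sqrt \<theta> * ((ln (12 / \<delta>) + 1) * L)"
    using l1 absorb[OF d(1)] s by (intro mult_left_mono) auto
  moreover have "sqrt \<theta> * ln (max 1 (4 * \<theta> * M / (\<kappa> * \<epsilon>))) \<le> sqrt \<theta> * ((ln (2 / \<kappa>) + 1) * L)"
    using l2 absorb[OF d(2)] s by (intro mult_left_mono) auto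
  ultimately have "k \<le> 8 * (sqrt \<theta> * ((ln (12 / \<delta>) + 1) * L)) + 16 * (sqrt \<theta> * ((ln (2 / \<kappa>) + 1) * L))
      + (real J + 2) * (sqrt \<theta> * L)"
    using k J by linarith
  also have "\<dots> = (8 * (ln (12 / \<delta>) + 1) + 16 * (ln (2 / \<kappa>) + 1) + real J + 2) * (sqrt \<theta> * L)"
    by (simp add: algebra_simps)
  finally show ?thesis by (simp add: L_def E_def)
qed

lemma (in lse_problem) short_step_ipm_lse:
  fixes \<delta> \<kappa> \<epsilon> R tmax tbar Rmax :: real and b :: "nat \<Rightarrow> rvec"
  assumes Z: "exponents N m a \<subseteq> Zn n"
    and b: "bij_betw b {1..card (exponents N m a)} (exponents N m a)"
    and sorted: "\<forall>k\<in>{1..card (exponents N m a)}. \<forall>l\<in>{k..card (exponents N m a)}.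
        norm2 n (b l) \<le> norm2 n (b k)"
    and \<delta>: "0 < \<delta>" and \<kappa>: "0 < \<kappa>" "\<delta> + \<kappa> \<le> 1 / 9" and \<epsilon>: "0 < \<epsilon>" and J: "(4 / 9) ^ J \<le> \<delta>"
    and R: "R = real_of_int ((\<lceil>f 0\<rceil> - \<lfloor>t_min N m F\<rfloor>) * \<lceil>sqrt (\<Prod>k=1..n. ((norm2 n (b k))\<^sup>2 + 1))\<rceil>
                + 1 + \<lceil>ln 4 :: real\<rceil>)"
    and tmax: "tmax = \<lceil>f 0\<rceil> + (a_max n N m a + 1) * R"
    and tbar: "tbar = \<lceil>f 0\<rceil> + (a_max n N m a + 1) * R / 2"
    and Rmax: "Rmax = (a_max n N m a + 1) * R + \<lceil>f 0\<rceil> - \<lfloor>t_min N m F\<rfloor>"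
  shows "(\<exists>k y. short_step_ipm ((top_of_set S) interior_of (K_hat n N m F a R tmax)) S
            (barrier n N m F a R tmax) \<theta> t_coord \<delta> \<kappa> \<epsilon> (start_point N m F tbar) k y \<and>
            y \<in> K_hat n N m F a R tmax \<and> \<bar>t_coord y - (INF x\<in>Rn n. f x)\<bar> \<le> \<epsilon> \<and>
            real k \<le> (8 * (ln (12 / \<delta>) + 1) + 16 * (ln (2 / \<kappa>) + 1) + real J + 2)
              * (sqrt \<theta> * ln (2 * \<theta> * Rmax / (min \<epsilon> Rmax * mu N m F)))) \<and>
         (Rmax < \<epsilon> \<longrightarrow> start_point N m F tbar \<in> K_hat n N m F a R tmax \<and>
            \<bar>t_coord (start_point N m F tbar) - (INF x\<in>Rn n. f x)\<bar> \<le> \<epsilon>)"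
proof -
  define w where "w = start_point N m F tbar"
  define D where "D = (top_of_set S) interior_of (K_hat n N m F a R tmax)"
  define fmin where "fmin = (INF x\<in>Rn n. f x)"
  define Q where "Q = sqrt (\<Prod>k=1..n. ((norm2 n (b k))\<^sup>2 + 1))"
  define \<Delta> where "\<Delta> = real_of_int (\<lceil>f 0\<rceil> - \<lfloor>t_min N m F\<rfloor>)"
  define B where "B = (a_max n N m a + 1) * R"
  have tm0: "t_min N m F \<le> f 0" by (rule t_min_le_f[OF zero_in_Rn])
  have \<Delta>: "f 0 - t_min N m F \<le> \<Delta>" "0 \<le> \<Delta>" using tm0 unfolding \<Delta>_def by linarith+
  have "1 \<le> (\<Prod>k=1..n. ((norm2 n (b k))\<^sup>2 + 1))" by (intro prod_ge_1) simp
  then have Q: "1 \<le> Q" by (simp add: Q_def)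
  have "0 < ln (4::real)" by simp
  then have c4: "1 \<le> \<lceil>ln 4 :: real\<rceil>" by linarith
  have RQ: "R = \<Delta> * real_of_int \<lceil>Q\<rceil> + 1 + real_of_int \<lceil>ln 4 :: real\<rceil>"
    by (simp add: R \<Delta>_def Q_def)
  have "\<Delta> * Q \<le> \<Delta> * real_of_int \<lceil>Q\<rceil>" using \<Delta> by (intro mult_left_mono) auto
  moreover have "\<Delta> * 1 \<le> \<Delta> * Q" using \<Delta> Q by (intro mult_left_mono) auto
  \<comment> \<open>The summand \<open>1 + \<lceil>ln 4\<rceil>\<close> is at least 2; it makes the
    box bound strict and keeps \<open>R\<close> at least 2.\<close>
  ultimately have R1: "\<Delta> * Q + 2 \<le> R" "\<Delta> + 2 \<le> R" using RQ c4 by linarith+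
  then have R2: "2 \<le> R" using \<Delta> by linarith
  have "1 * R \<le> B" unfolding B_def using a_max_nonneg R2 by (intro mult_right_mono) auto
  then have B: "R \<le> B" by simp
  have Rmax': "Rmax = B + \<Delta>" by (simp add: Rmax B_def \<Delta>_def)
  have Rpos: "0 < Rmax" using B R2 \<Delta> by (simp add: Rmax')
  have box: "\<bar>lookup x k\<bar> < R" if x: "x \<in> Rn n" "f x \<le> f 0" and k: "k \<in> {1..n}" for x k
  proof -
    have "\<bar>lookup x k\<bar> \<le> (f 0 - t_min N m F) * Q"
      unfolding Q_def
      using sorted dot_le_of_sublevel[OF x(2)] tm0
      by (intro polytope_coordinate_bound[OF finite_exponents Z cone b _ x(1) _ _ k]) auto
    also have "\<dots> \<le> \<Delta> * Q" using \<Delta> Q by (intro mult_right_mono) auto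
    finally show ?thesis using R1(1) by linarith
  qed
  have tmax1: "f 0 + 1 < tmax" using B R2 unfolding tmax B_def[symmetric] by linarith
  have tb: "f 0 + (a_max n N m a + 1) * R / 2 \<le> tbar" unfolding tbar by simp
  have tm: "tmax = tbar + (a_max n N m a + 1) * R / 2" by (simp add: tmax tbar)
  have range: "tmax - t_min N m F \<le> Rmax"
    unfolding tmax Rmax by linarith
  \<comment> \<open>Since \<open>\<Delta> \<le> R \<le> B\<close>, the range of \<open>t\<close> is
    comparable to the slack \<open>B / 2\<close> at the start.\<close>
  have range2: "tmax - t_min N m F \<le> 2 * ((a_max n N m a + 1) * R)"
    using range B R1(2) unfolding Rmax' B_def[symmetric] by linarith
  have wG: "w \<in> strict_K_hat R tmax \<inter> S"
    unfolding w_def using R2 B tb tm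
    by (intro start_point_strict_K_hat) (auto simp: B_def[symmetric])
  then have "S \<noteq> {}" by blast
  interpret sc_barrier_affine "strict_K_hat R tmax" "barrier n N m F a R tmax" "barrier_grad R tmax" "barrier_hess R tmax" \<theta> S
    "point_basis n N m"
    by (rule sc_barrier_affine_barrier) fact
  have gw: "\<bar>barrier_grad R tmax w (u - v)\<bar> \<le> 6 * \<theta> / mu N m F"
    if "u \<in> strict_K_hat R tmax \<inter> S" "v \<in> strict_K_hat R tmax \<inter> S" for u v
    unfolding w_def using R2 by (intro barrier_grad_start_point_bound tb tm range2 that) simp
  have ct: "\<bar>t_coord (u - v)\<bar> \<le> Rmax" if "u \<in> strict_K_hat R tmax \<inter> S" "v \<in> strict_K_hat R tmax \<inter> S" for u v
  proof -
    obtain x t z x' t' z' where uv: "u = (x, t, z)" "v = (x', t', z')" by (cases u, cases v)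
    show ?thesis
      using strict_K_hat_bounds(1,2)[OF that(1)[unfolded uv]] strict_K_hat_bounds(1,2)[OF that(2)[unfolded uv]] range
      by (simp add: uv t_coord_def)
  qed
  have GD: "strict_K_hat R tmax \<inter> S \<subseteq> D" unfolding D_def by (rule strict_K_hat_subset_interior)
  have INF: "(INF v\<in>closure D. t_coord v) = fmin"
    unfolding D_def fmin_def by (rule Inf_t_coord(2)[OF box tmax1])
  have dense: "\<exists>v\<in>strict_K_hat R tmax \<inter> S. t_coord v < (INF v\<in>closure D. t_coord v) + e" if "0 < e" for e
    unfolding INF using Inf_t_coord(1)[OF box tmax1 that] by (simp add: fmin_def)
  have e: "(0, 1, 0) \<in> directions S" "t_coord (0, 1, 0) \<noteq> 0"
  proof -
    obtain x t z where xtz: "w = (x, t, z)" by (cases w)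
    have "(x, t + 1, z) \<in> S" using wG by (simp add: xtz aff_space_def)
    then have "(x, t + 1, z) - (x, t, z) \<in> directions S"
      using wG unfolding xtz directions_def by blast
    then show "(0, 1, 0) \<in> directions S" by simp
  qed (simp add: t_coord_def)
  obtain k y where ipm: "short_step_ipm D S (barrier n N m F a R tmax) \<theta> t_coord \<delta> \<kappa> \<epsilon> w k y"
    and y: "y \<in> strict_K_hat R tmax \<inter> S"
    and k: "real k \<le> 8 * sqrt \<theta> * ln (max 1 (4 * (6 * \<theta> / mu N m F) / \<delta>))
      + 16 * sqrt \<theta> * ln (max 1 (4 * \<theta> * Rmax / (\<kappa> * \<epsilon>))) + real J + 2"
    using short_step_ipm_complexity[of w "6 * \<theta> / mu N m F" t_coord "(0, 1, 0)" Rmax D \<delta> \<kappa> \<epsilon> J]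
      wG gw linear_t_coord e ct GD dense \<delta> \<kappa> \<epsilon> J by blast
  have yK: "y \<in> K_hat n N m F a R tmax" using y strict_K_hat_subset_K_hat by blast
  have fmin_le: "fmin \<le> t_coord v" if "v \<in> K_hat n N m F a R tmax" for v
  proof -
    obtain x t z where xtz: "v = (x, t, z)" by (cases v)
    show ?thesis
      using K_hat_t_ge[OF that[unfolded xtz]] Inf_f_le[of x] by (simp add: xtz t_coord_def fmin_def)
  qed
  have "t_coord y \<le> fmin + \<epsilon>" using ipm unfolding short_step_ipm_def INF by blast
  then have gap: "\<bar>t_coord y - fmin\<bar> \<le> \<epsilon>" using fmin_le[OF yK] \<epsilon> by simp
  have "1 \<le> (\<Sum>j=1..N. m j)"
    using N_pos m_pos[of 1] member_le_sum[of 1 "{1..N}" m] by simp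
  then have "3 \<le> 1 + n + 2 * (\<Sum>j=1..N. m j)" by simp
  from of_nat_mono[OF this, where 'a = real] have \<theta>3: "3 \<le> \<theta>" by (simp only: of_nat_numeral)
  have kb: "real k \<le> (8 * (ln (12 / \<delta>) + 1) + 16 * (ln (2 / \<kappa>) + 1) + real J + 2)
      * (sqrt \<theta> * ln (2 * \<theta> * Rmax / (min \<epsilon> Rmax * mu N m F)))"
    using \<delta> \<kappa> by (intro iteration_bound[OF \<theta>3 mu_bounds _ _ _ _ \<epsilon> Rpos k]) auto
  have wK: "w \<in> K_hat n N m F a R tmax" using wG strict_K_hat_subset_K_hat by blast
  have "t_min N m F \<le> fmin" unfolding fmin_def by (rule t_min_le_Inf_f)
  moreover have "t_coord w = tbar" by (simp add: w_def t_coord_def start_point_def)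
  moreover have "tbar \<le> tmax" using B R2 unfolding tm B_def[symmetric] by simp
  ultimately have "\<bar>t_coord w - fmin\<bar> \<le> Rmax" using fmin_le[OF wK] range by linarith
  then show ?thesis
    using ipm yK gap kb wK unfolding D_def w_def fmin_def by (intro conjI exI impI) auto
qed

theorem corollary7p5:
  fixes \<delta> \<kappa> :: real
  assumes "0 < \<delta>" and "0 < \<kappa>" and "\<delta> + \<kappa> \<le> 1 / 9"
  shows "\<exists>C>0. \<forall>(n::nat) (N::nat) (m::nat \<Rightarrow> nat) (F::nat \<Rightarrow> nat \<Rightarrow> real)
           (a::nat \<Rightarrow> nat \<Rightarrow> rvec) (b::nat \<Rightarrow> rvec) (\<epsilon>::real).
     1 \<le> N \<longrightarrow>
     (\<forall>j\<in>{1..N}. 1 \<le> m j) \<longrightarrow>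
     (\<forall>j\<in>{1..N}. \<forall>i\<in>{1..m j}. 0 < F i j) \<longrightarrow>
     (\<forall>j\<in>{1..N}. inj_on (\<lambda>i. a i j) {1..m j}) \<longrightarrow>
     exponents N m a \<subseteq> Zn n \<longrightarrow>
     {x \<in> Rn n. \<forall>v\<in>exponents N m a. dot n v x \<le> 0} = {0} \<longrightarrow>
     bij_betw b {1..card (exponents N m a)} (exponents N m a) \<longrightarrow>
     (\<forall>k\<in>{1..card (exponents N m a)}. \<forall>l\<in>{k..card (exponents N m a)}.
        norm2 n (b l) \<le> norm2 n (b k)) \<longrightarrow>
     0 < \<epsilon> \<longrightarrow>
     (let f = max_lse n N m F a;
          tmin = t_min N m F;
          af = a_max n N m a;
          R = real_of_int ((\<lceil>f 0\<rceil> - \<lfloor>tmin\<rfloor>) * \<lceil>sqrt (\<Prod>k=1..n. ((norm2 n (b k))\<^sup>2 + 1))\<rceil>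
                + 1 + \<lceil>ln 4 :: real\<rceil>);
          tmax = \<lceil>f 0\<rceil> + (af + 1) * R;
          tbar = \<lceil>f 0\<rceil> + (af + 1) * R / 2;
          Rmax = (af + 1) * R + \<lceil>f 0\<rceil> - \<lfloor>tmin\<rfloor>;
          Khat = K_hat n N m F a R tmax;
          w = start_point N m F tbar;
          S = aff_space n N m;
          D = (top_of_set S) interior_of Khat;
          \<theta> = real (1 + n + 2 * (\<Sum>j=1..N. m j));
          fmin = (INF x\<in>Rn n. f x)
      in (\<exists>k y. short_step_ipm D S (barrier n N m F a R tmax) \<theta> t_coord \<delta> \<kappa> \<epsilon> w k y \<and>
            y \<in> Khat \<and> \<bar>t_coord y - fmin\<bar> \<le> \<epsilon> \<and>
            real k \<le> C * (sqrt \<theta> * ln (2 * \<theta> * Rmax / (min \<epsilon> Rmax * mu N m F)))) \<and>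
         (Rmax < \<epsilon> \<longrightarrow> w \<in> Khat \<and> \<bar>t_coord w - fmin\<bar> \<le> \<epsilon>))"
proof -
  \<comment> \<open>\<open>J\<close> counts the steps by which the factor \<open>4/9\<close> reaches
    \<delta>; it depends on \<delta> alone, so \<open>C\<close> is fixed before all problem
    data.\<close>
  obtain J :: nat where "(4 / 9) ^ J < \<delta>"
    using real_arch_pow_inv[OF assms(1), of "4 / 9"] by auto
  then have J: "(4 / 9) ^ J \<le> \<delta>" by simp
  define C where "C = 8 * (ln (12 / \<delta>) + 1) + 16 * (ln (2 / \<kappa>) + 1) + real J + 2"
  have "1 \<le> 12 / \<delta>" "1 \<le> 2 / \<kappa>" using assms by (auto simp: field_simps)
  then have "0 \<le> ln (12 / \<delta>)" "0 \<le> ln (2 / \<kappa>)" by auto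
  then have "0 < C" by (simp add: C_def)
  show ?thesis
  proof (intro exI[of _ C] conjI allI impI)
    show "0 < C" by fact
    fix n N :: nat and m :: "nat \<Rightarrow> nat" and F :: "nat \<Rightarrow> nat \<Rightarrow> real"
      and a :: "nat \<Rightarrow> nat \<Rightarrow> rvec" and b :: "nat \<Rightarrow> rvec" and \<epsilon> :: real
    assume hyps: "1 \<le> N" "\<forall>j\<in>{1..N}. 1 \<le> m j" "\<forall>j\<in>{1..N}. \<forall>i\<in>{1..m j}. 0 < F i j"
      "{x \<in> Rn n. \<forall>v\<in>exponents N m a. dot n v x \<le> 0} = {0}"
      and Z: "exponents N m a \<subseteq> Zn n"
      and b: "bij_betw b {1..card (exponents N m a)} (exponents N m a)"
      and sorted: "\<forall>k\<in>{1..card (exponents N m a)}. \<forall>l\<in>{k..card (exponents N m a)}.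
        norm2 n (b l) \<le> norm2 n (b k)" and \<epsilon>: "0 < \<epsilon>"
    interpret lse_problem n N m F a
      using hyps by (intro lse_problem.intro) auto
    show "(let f = max_lse n N m F a;
          tmin = t_min N m F;
          af = a_max n N m a;
          R = real_of_int ((\<lceil>f 0\<rceil> - \<lfloor>tmin\<rfloor>) * \<lceil>sqrt (\<Prod>k=1..n. ((norm2 n (b k))\<^sup>2 + 1))\<rceil>
                + 1 + \<lceil>ln 4 :: real\<rceil>);
          tmax = \<lceil>f 0\<rceil> + (af + 1) * R;
          tbar = \<lceil>f 0\<rceil> + (af + 1) * R / 2;
          Rmax = (af + 1) * R + \<lceil>f 0\<rceil> - \<lfloor>tmin\<rfloor>;
          Khat = K_hat n N m F a R tmax;
          w = start_point N m F tbar;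
          S = aff_space n N m;
          D = (top_of_set S) interior_of Khat;
          \<theta> = real (1 + n + 2 * (\<Sum>j=1..N. m j));
          fmin = (INF x\<in>Rn n. f x)
      in (\<exists>k y. short_step_ipm D S (barrier n N m F a R tmax) \<theta> t_coord \<delta> \<kappa> \<epsilon> w k y \<and>
            y \<in> Khat \<and> \<bar>t_coord y - fmin\<bar> \<le> \<epsilon> \<and>
            real k \<le> C * (sqrt \<theta> * ln (2 * \<theta> * Rmax / (min \<epsilon> Rmax * mu N m F)))) \<and>
         (Rmax < \<epsilon> \<longrightarrow> w \<in> Khat \<and> \<bar>t_coord w - fmin\<bar> \<le> \<epsilon>))"
      unfolding Let_def C_def
      by (rule short_step_ipm_lse[OF Z b sorted assms \<epsilon> J refl refl refl refl])
  qed
qed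

end
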